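(* Let $m,n,p,q\in\mathbb{N}_0$ be such that $p\ge n\ge0$ and $q\ge m\ge0$. Assume: (1) $a_i\in\mathbb{R}$ and $\alpha_i>0$ for $i=1,\dots,p$ are such that $a_i+\alpha_i<1$ for $i=1,\dots,n$, $a_i+\alpha_i>0$ for $i=n+1,\dots,p$, and the poles $a_{ik}=\frac{1-a_i+k}{\alpha_i}$ ($i=1,\dots,n$, $k\in\mathbb{N}_0$) are simple; (2) $b_j\in\mathbb{R}$ and $\beta_j>0$ for $j=1,\dots,q$ are such that $b_j+\beta_j>0$ for $j=1,\dots,m$ and $b_j+\beta_j<1$ for $j=m+1,\dots,q$; (3) either $a^*>0$, or $a^*=0$ and $\mu<-1$; (4) $H^{m,n}_{p,q}\left[\,\cdot\,\Big|{(a_i,\alpha_i)_{1,p}\atop(b_j,\beta_j)_{1,q}}\right]$ is non-negative on $(0,\infty)$. Then the function $$\varrho(x)=\frac1K H^{m,n}_{p,q}\left[x\,\Big|{(a_i,\alpha_i)_{1,p}\atop(b_j,\beta_j)_{1,q}}\right],\quad x>0,\qquad K=\mathcal{H}^{m,n}_{p,q}(1),$$ is a Fox-$H$ density on $(0,\infty)$ (i.e. it is non-negative and $\int_0^\infty\varrho(x)\,\mathrm{d}x=1$). Furthermore, its Laplace transform is given, for every $s\ge0$, by $$\phi(s)=\int_0^\infty\mathrm{e}^{-sx}\varrho(x)\,\mathrm{d}x=\frac1KH^{n+1,m}_{q,p+1}\left[s\,\Big|{(1-b_j-\beta_j,\beta_j)_{1,q}\atop(0,1),(1-a_i-\alpha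_i,\alpha_i)_{1,p}}\right].$$
   Context: Fox-$H$ function: for integers $0\le m\le q$, $0\le n\le p$, parameters $a_i,b_j$ and $\alpha_i,\beta_j>0$, $$H^{m,n}_{p,q}\left[z\,\Big|{(a_i,\alpha_i)_{1,p}\atop(b_j,\beta_j)_{1,q}}\right]=\frac{1}{2\pi\mathrm{i}}\int_{\mathcal{L}}\mathcal{H}^{m,n}_{p,q}(s)z^{-s}\,\mathrm{d}s,\qquad \mathcal{H}^{m,n}_{p,q}(s)=\frac{\prod_{j=1}^{m}\Gamma(b_j+s\beta_j)\prod_{i=1}^{n}\Gamma(1-a_i-s\alpha_i)}{\prod_{i=n+1}^{p}\Gamma(a_i+s\alpha_i)\prod_{j=m+1}^{q}\Gamma(1-b_j-s\beta_j)},$$ with empty products equal to $1$, empty sums $0$, $z^{-s}=\exp[-s(\mathrm{Log}|z|+\mathrm{i}\arg z)]$. Here the contour is $\mathcal{L}=\mathcal{L}_{\mathrm{i}\gamma\infty}$, running from $\gamma-\mathrm{i}\infty$ to $\gamma+\mathrm{i}\infty$ for some $\gamma\in\mathbb{R}$ and separating the poles $b_{jl}=-\frac{b_j+l}{\beta_j}$ ($j\le m$, $l\in\mathbb{N}_0$), on its left, from the poles $a_{ik}=\frac{1-a_i+k}{\alpha_i}$ ($i\le n$, $k\in\mathbb{N}_0$), on its right. The value at $s=0$ of a Fox-$H$ function giving a Laplace transform is understood as its limit as $s\to0^+$. Constants: $a^*=\sum_{j=1}^m\beta_j-\sum_{i=n+1}^p\alpha_i+\sum_{i=1}^n\alpha_i-\sum_{j=m+1}^q\beta_j$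 and $\mu=\sum_{j=1}^qb_j-\sum_{i=1}^pa_i+(p-q)/2$. *)

theory Defs
  imports "HOL-Complex_Analysis.Complex_Analysis"
begin

(* Parameter families are functions on nat of which only the indices 1..p (for a, \<alpha>) and
   1..q (for b, \<beta>) matter.  In Isabelle/HOL Gamma and division satisfy Gamma w = 0 at the poles
   of Gamma and x / 0 = 0, so every factor 1 / Gamma w below agrees with the entire
   function rGamma w. *)
definition fox_kernel ::
  "nat \<Rightarrow> nat \<Rightarrow> nat \<Rightarrow> nat \<Rightarrow> (nat \<Rightarrow> real) \<Rightarrow> (nat \<Rightarrow> real) \<Rightarrow> (nat \<Rightarrow> real) \<Rightarrow> (nat \<Rightarrow> real)
    \<Rightarrow> complex \<Rightarrow> complex" where
  "fox_kernel m n p q a \<alpha> b \<beta> s =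
     ((\<Prod>j=1..m. Gamma (of_real (b j) + s * of_real (\<beta> j))) *
      (\<Prod>i=1..n. Gamma (1 - of_real (a i) - s * of_real (\<alpha> i)))) /
     ((\<Prod>i=n+1..p. Gamma (of_real (a i) + s * of_real (\<alpha> i))) *
      (\<Prod>j=m+1..q. Gamma (1 - of_real (b j) - s * of_real (\<beta> j))))"

definition fox_a_pole :: "(nat \<Rightarrow> real) \<Rightarrow> (nat \<Rightarrow> real) \<Rightarrow> nat \<Rightarrow> nat \<Rightarrow> complex" where
  "fox_a_pole a \<alpha> i k = of_real ((1 - a i + real k) / \<alpha> i)"

definition fox_b_pole :: "(nat \<Rightarrow> real) \<Rightarrow> (nat \<Rightarrow> real) \<Rightarrow> nat \<Rightarrow> nat \<Rightarrow> complex" where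
  "fox_b_pole b \<beta> j l = of_real (- (b j + real l) / \<beta> j)"

definition simple_pole :: "(complex \<Rightarrow> complex) \<Rightarrow> complex \<Rightarrow> bool" where
  "simple_pole f w \<longleftrightarrow> is_pole f w \<and> zorder f w = - 1"

(* A contour from \<gamma> - i\<infinity> to \<gamma> + i\<infinity>: it is the vertical line Re s = \<gamma> outside a bounded
   part, where it may be deformed so as to separate the poles. *)
definition vertical_contour :: "real \<Rightarrow> (real \<Rightarrow> complex) \<Rightarrow> bool" where
  "vertical_contour \<gamma> g \<longleftrightarrow>
     g piecewise_C1_differentiable_on UNIV \<and>
     (\<forall>\<^sub>F t in at_bot. g t = Complex \<gamma> t) \<and> (\<forall>\<^sub>F t in at_top. g t = Complex \<gamma> t)"

(* The side of an upward contour is decided by the component of its complement: the points to its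
   left are those that can be joined to points far out on the negative real axis. *)
definition left_of :: "(real \<Rightarrow> complex) \<Rightarrow> complex \<Rightarrow> bool" where
  "left_of g w \<longleftrightarrow> (\<forall>\<^sub>F x in at_bot. connected_component (- range g) w (of_real x))"

definition right_of :: "(real \<Rightarrow> complex) \<Rightarrow> complex \<Rightarrow> bool" where
  "right_of g w \<longleftrightarrow> (\<forall>\<^sub>F x in at_top. connected_component (- range g) w (of_real x))"

definition fox_contour ::
  "nat \<Rightarrow> nat \<Rightarrow> (nat \<Rightarrow> real) \<Rightarrow> (nat \<Rightarrow> real) \<Rightarrow> (nat \<Rightarrow> real) \<Rightarrow> (nat \<Rightarrow> real)
    \<Rightarrow> (real \<Rightarrow> complex) \<Rightarrow> bool" where
  "fox_contour m n a \<alpha> b \<beta> g \<longleftrightarrow>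
     (\<exists>\<gamma>. vertical_contour \<gamma> g) \<and>
     (\<forall>j\<in>{1..m}. \<forall>l. left_of g (fox_b_pole b \<beta> j l)) \<and>
     (\<forall>i\<in>{1..n}. \<forall>k. right_of g (fox_a_pole a \<alpha> i k))"

(* Whether the integral converges may depend on \<gamma> when a* = 0, so convergence along the contour is
   part of the condition.  For z \<noteq> 0, z powr (- s) is exp (- s * (ln |z| + i Arg z)). *)
definition has_fox_H ::
  "nat \<Rightarrow> nat \<Rightarrow> nat \<Rightarrow> nat \<Rightarrow> (nat \<Rightarrow> real) \<Rightarrow> (nat \<Rightarrow> real) \<Rightarrow> (nat \<Rightarrow> real) \<Rightarrow> (nat \<Rightarrow> real)
    \<Rightarrow> complex \<Rightarrow> complex \<Rightarrow> bool" where
  "has_fox_H m n p q a \<alpha> b \<beta> z h \<longleftrightarrow>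
     (\<exists>g. fox_contour m n a \<alpha> b \<beta> g \<and>
        integrable lborel
          (\<lambda>t. fox_kernel m n p q a \<alpha> b \<beta> (g t) * z powr (- g t) * vector_derivative g (at t)) \<and>
        h = 1 / (2 * of_real pi * \<i>) *
          (LINT t|lborel. fox_kernel m n p q a \<alpha> b \<beta> (g t) * z powr (- g t) *
             vector_derivative g (at t)))"

definition fox_H ::
  "nat \<Rightarrow> nat \<Rightarrow> nat \<Rightarrow> nat \<Rightarrow> (nat \<Rightarrow> real) \<Rightarrow> (nat \<Rightarrow> real) \<Rightarrow> (nat \<Rightarrow> real) \<Rightarrow> (nat \<Rightarrow> real)
    \<Rightarrow> complex \<Rightarrow> complex" where
  "fox_H m n p q a \<alpha> b \<beta> z = (THE h. has_fox_H m n p q a \<alpha> b \<beta> z h)"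

definition fox_a_star ::
  "nat \<Rightarrow> nat \<Rightarrow> nat \<Rightarrow> nat \<Rightarrow> (nat \<Rightarrow> real) \<Rightarrow> (nat \<Rightarrow> real) \<Rightarrow> real" where
  "fox_a_star m n p q \<alpha> \<beta> =
     (\<Sum>j=1..m. \<beta> j) - (\<Sum>i=n+1..p. \<alpha> i) + (\<Sum>i=1..n. \<alpha> i) - (\<Sum>j=m+1..q. \<beta> j)"

definition fox_mu :: "nat \<Rightarrow> nat \<Rightarrow> (nat \<Rightarrow> real) \<Rightarrow> (nat \<Rightarrow> real) \<Rightarrow> real" where
  "fox_mu p q a b = (\<Sum>j=1..q. b j) - (\<Sum>i=1..p. a i) + (real p - real q) / 2"

end

theory Submission
  imports Defs "HOL-Real_Asymp.Real_Asymp"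
begin

text \<open>
  Write \<open>k\<close> for the kernel of the given Fox-H function \<open>H\<close>, and \<open>a*\<close>, \<open>\<mu>\<close> for its two constants. The
  integral of \<open>H\<close> ought to be the Mellin transform at \<open>1\<close>, that is \<open>k 1\<close>; but if \<open>a* = 0\<close>, then \<open>k\<close> need
  not be absolutely integrable on the line \<open>Re s = 1\<close>, so that Mellin inversion on this line is not at
  hand. The total mass is obtained instead from the Laplace transform, in the limit \<open>y \<rightarrow> 0\<close>.

  \<^item> On a vertical line \<open>Re s = \<sigma>\<close> the kernel has the exact order
    \<open>\<bar>t\<bar> powr (\<mu> + \<Delta> \<sigma>) * exp (- \<pi> a* \<bar>t\<bar> / 2)\<close>, where \<open>\<Delta>\<close> is the sum of the \<open>\<beta> j\<close> minus the sum of the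
    \<open>\<alpha> i\<close>. This follows from the corresponding statement for a single Gamma factor
    (\<open>Gamma_defect_bounded\<close>, \<open>fox_kernel_growth\<close>). In particular the kernel is absolutely integrable
    over the two ends of the imaginary axis whenever \<open>a* > 0\<close>, or \<open>a* = 0\<close> and \<open>\<mu> < -1\<close>.

  \<^item> \<open>H\<close> is defined as the unique value of an integral over all admissible contours. Two such
    integrals agree (\<open>Mellin_Barnes_contour_independent\<close>): a finite part of each contour is closed up
    to a loop which winds around no pole, Cauchy's theorem applies, and the horizontal parts of the
    loop become negligible because of the growth estimate.

  \<^item> All poles are real, those that have to lie on the left are less than \<open>1\<close> and those that have to
    lie on the right are greater than \<open>1\<close>. So the imaginary axis with a bulge, which meets the real axis
    at a suitable \<open>c\<close> with \<open>0 < c < 1\<close>, is an admissible contour on which \<open>0 \<le> Re s \<le> c\<close>. Then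
    \<open>exp (- y * x) * x powr (- s)\<close> is integrable in \<open>x\<close>, uniformly along the contour, and Fubini's
    theorem turns the Laplace transform of \<open>H\<close> into the contour integral of
    \<open>k s * Gamma (1 - s) * y powr (s - 1)\<close>. The substitution of \<open>1 - s\<close> for \<open>s\<close> makes this the second
    Fox-H function of the theorem (\<open>laplace_transform\<close>).

  \<^item> The new kernel \<open>Gamma s * k (1 - s)\<close> has the constant \<open>a* + 1 > 0\<close> and decays exponentially on
    every vertical line. Its contour can therefore be moved across the simple pole of \<open>Gamma\<close> at \<open>0\<close>,
    where the residue is \<open>k 1\<close>, to a line \<open>Re s = - \<delta>\<close>, where the integral is of order \<open>y powr \<delta>\<close>. Hence
    the Laplace transform tends to \<open>k 1\<close> as \<open>y\<close> tends to \<open>0\<close> (\<open>laplace_fox_H_at_0\<close>). Since \<open>H\<close> is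
    non-negative, monotone convergence yields that its integral is \<open>k 1\<close>
    (\<open>mass_from_laplace_transform\<close>).
\<close>

section \<open>The size of the Gamma function on vertical lines\<close>

text \<open>
  The reflection formula, because \<open>1 - z\<close> is the conjugate of \<open>z\<close> on the line \<open>Re z = 1/2\<close>.
\<close>
lemma norm_Gamma_half:
  fixes y :: real
  shows "norm (Gamma (Complex (1/2) y)) ^ 2 = pi / cosh (pi * y)"
proof -
  define z where "z = Complex (1/2) y"
  have "1 - z = cnj z" by (simp add: z_def complex_eq_iff)
  then have "Gamma z * cnj (Gamma z) = of_real pi / sin (of_real pi * z)"
    using Gamma_reflection_complex[of z] by (simp add: cnj_Gamma)
  moreover have "sin (of_real pi * z) = of_real (cosh (pi * y))"
  proof -
    have "of_real pi * z = of_real (pi / 2) + \<i> * of_real (pi * y)" by (simp add: z_def complex_eq_iff)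
    then have "sin (of_real pi * z) = cos (\<i> * of_real (pi * y))"
      by (simp only: sin_add cos_of_real sin_of_real) simp
    also have "\<dots> = of_real (cosh (pi * y))"
      by (simp only: cosh_conv_cos[symmetric]) (simp add: cosh_field_def exp_of_real[symmetric])
    finally show ?thesis .
  qed
  ultimately have "of_real (norm (Gamma z) ^ 2) = complex_of_real (pi / cosh (pi * y))"
    by (simp only: complex_norm_square of_real_divide)
  then show ?thesis unfolding z_def of_real_eq_iff .
qed

lemma norm_Gamma_series:
  fixes x y :: real
  assumes "n > 0" and "x > 0"
  shows "ln (norm (Gamma_series (Complex x y) n)) =
    ln (fact n) + x * ln (real n) - (\<Sum>k\<le>n. ln (norm (Complex (x + real k) y)))"
proof -
  have nz: "Complex (x + real k) y \<noteq> 0" for k using assms by (simp add: complex_eq_iff)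
  have "pochhammer (Complex x y) (n+1) = (\<Prod>k\<le>n. Complex (x + real k) y)"
    unfolding pochhammer_prod Suc_eq_plus1[symmetric]
    by (intro prod.cong) (auto simp: complex_eq_iff)
  then have "norm (Gamma_series (Complex x y) n) =
      fact n * exp (x * ln (real n)) / (\<Prod>k\<le>n. norm (Complex (x + real k) y))"
    using assms by (simp add: Gamma_series_def norm_divide norm_mult prod_norm)
  also have "ln \<dots> = ln (fact n) + x * ln (real n) - ln (\<Prod>k\<le>n. norm (Complex (x + real k) y))"
    using nz by (subst ln_div) (auto simp: ln_mult prod_pos)
  also have "ln (\<Prod>k\<le>n. norm (Complex (x + real k) y)) = (\<Sum>k\<le>n. ln (norm (Complex (x + real k) y)))"
    using nz by (subst ln_prod) auto
  finally show ?thesis .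
qed

text \<open>
  The error of linear interpolation between \<open>u\<close> and \<open>u + 1\<close> is controlled by the second derivative of
  \<open>ln (norm (Complex x y))\<close> in \<open>x\<close>, whose absolute value is at most \<open>1 / (x\<^sup>2 + y\<^sup>2)\<close>. What
  matters is that the bound is summable over \<open>u = 1/2 + k\<close> and does not depend on \<open>y\<close>.
\<close>
lemma ln_norm_interpolation:
  fixes y u \<theta> :: real
  assumes y: "\<bar>y\<bar> \<ge> 1" and u: "u \<ge> 0" and \<theta>: "0 \<le> \<theta>" "\<theta> \<le> 1"
  defines "l \<equiv> (\<lambda>x. ln (norm (Complex x y)))"
  shows "\<bar>(l (u + \<theta>) - l u) - \<theta> * (l (u + 1) - l u)\<bar> \<le> 1 / (u^2 + 1)"
proof -
  define l1 where "l1 = (\<lambda>x. x / (x^2 + y^2))"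
  have y2: "1 \<le> y^2" using y by (auto simp: power2_ge_1_iff)
  have pos: "x^2 + y^2 > 0" for x :: real
    using y2 zero_le_power2[of x] by linarith
  have l_eq: "l = (\<lambda>x. ln (x^2 + y^2) / 2)"
    using pos by (auto simp: l_def cmod_def ln_sqrt)
  have d1: "(l has_real_derivative l1 x) (at x)" for x
  proof -
    have "((\<lambda>x. ln (x^2 + y^2)) has_real_derivative 2 * x / (x^2+y^2)) (at x)"
      using pos[of x] by (auto intro!: derivative_eq_intros)
    from DERIV_cdivide[OF this, of 2]
    have "(l has_real_derivative 2 * x / (x^2+y^2) / 2) (at x)" unfolding l_eq .
    moreover have "2 * x / d / 2 = x / d" for d :: real by simp
    ultimately show ?thesis by (simp only: l1_def)
  qed
  have d2: "(l1 has_real_derivative (y^2 - x^2) / (x^2+y^2)^2) (at x)" for x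
    unfolding l1_def using pos[of x]
    by (auto intro!: derivative_eq_intros simp: field_simps power2_eq_square)
  have bd: "\<bar>(y^2 - x^2) / (x^2+y^2)^2\<bar> \<le> 1 / (u^2 + 1)" if "x \<ge> u" for x
  proof -
    have "\<bar>y^2 - x^2\<bar> \<le> x^2 + y^2" by (simp add: abs_le_iff)
    then have "\<bar>(y^2 - x^2) / (x^2+y^2)^2\<bar> \<le> (x^2+y^2) / (x^2+y^2)^2"
      by (simp add: abs_divide divide_right_mono)
    also have "\<dots> = 1 / (x^2+y^2)" using pos[of x] by (simp add: power2_eq_square)
    also have "\<dots> \<le> 1 / (u^2 + 1)"
      using that u y2 by (intro divide_left_mono add_mono power_mono mult_pos_pos) (auto simp: pos add_nonneg_pos)
    finally show ?thesis .
  qed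
  have mvt: "\<exists>\<xi>. u \<le> \<xi> \<and> \<xi> \<le> u + h \<and> l (u + h) - l u = h * l1 \<xi>" if "0 \<le> h" for h
  proof (cases "h = 0")
    case False
    then obtain \<xi> where "u < \<xi>" "\<xi> < u + h" "l (u + h) - l u = (u + h - u) * l1 \<xi>"
      using MVT2[of u "u+h" l l1] d1 \<open>0 \<le> h\<close> by auto
    then show ?thesis by (intro exI[of _ \<xi>]) auto
  qed auto
  obtain \<xi> where \<xi>: "u \<le> \<xi>" "\<xi> \<le> u + \<theta>" "l (u + \<theta>) - l u = \<theta> * l1 \<xi>" using mvt \<theta> by blast
  obtain \<eta> where \<eta>: "u \<le> \<eta>" "\<eta> \<le> u + 1" "l (u + 1) - l u = l1 \<eta>" using mvt[of 1] by auto
  have "norm (l1 \<xi> - l1 \<eta>) \<le> 1 / (u^2+1) * norm (\<xi> - \<eta>)"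
    by (rule field_differentiable_bound[where S="{u..}" and f'="\<lambda>x. (y^2 - x^2) / (x^2+y^2)^2"])
       (use bd d2 \<xi> \<eta> in \<open>auto intro: has_field_derivative_at_within\<close>)
  also have "\<dots> \<le> 1 / (u^2+1) * 1" using \<xi> \<eta> \<theta> by (intro mult_left_mono) auto
  finally have "\<bar>l1 \<xi> - l1 \<eta>\<bar> \<le> 1 / (u^2+1)" by simp
  moreover have "(l (u + \<theta>) - l u) - \<theta> * (l (u + 1) - l u) = \<theta> * (l1 \<xi> - l1 \<eta>)"
    using \<xi> \<eta> by (simp add: algebra_simps)
  moreover have "\<bar>\<theta> * (l1 \<xi> - l1 \<eta>)\<bar> \<le> 1 * \<bar>l1 \<xi> - l1 \<eta>\<bar>"
    using \<theta> unfolding abs_mult by (intro mult_right_mono) auto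
  ultimately show ?thesis by (metis mult_1 order_trans)
qed


lemma Gamma_nonreal_nonzero: "y \<noteq> 0 \<Longrightarrow> Gamma (Complex x y) \<noteq> 0"
  by (subst Gamma_eq_zero_iff) (auto simp: complex_eq_iff elim!: nonpos_Ints_cases)

text \<open>
  In Euler's limit for \<open>Gamma\<close> the logarithm of the quotient is, up to the terms with \<open>ln n\<close>, a sum of
  differences over steps of length \<open>\<theta>\<close>. Replacing each of them by \<open>\<theta>\<close> times the difference over a full
  step costs a bounded amount by the previous lemma, and the sum of full steps telescopes.
\<close>
lemma ln_norm_Gamma_ratio:
  obtains C :: real where
    "\<And>\<theta> y. 0 \<le> \<theta> \<Longrightarrow> \<theta> \<le> 1 \<Longrightarrow> \<bar>y\<bar> \<ge> 1 \<Longrightarrow>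
       \<bar>ln (norm (Gamma (Complex (1/2 + \<theta>) y))) - ln (norm (Gamma (Complex (1/2) y)))
         - \<theta> * ln (norm (Complex (1/2) y))\<bar> \<le> C"
proof -
  define e where "e = (\<lambda>k. 1 / ((1/2 + real k)^2 + 1))"
  have e_nonneg: "e k \<ge> 0" for k by (simp add: e_def add_nonneg_nonneg)
  have "summable e"
  proof (rule summable_comparison_test')
    show "summable (\<lambda>k. 4 * inverse (real (Suc k) ^ 2))"
      using inverse_power_summable[of 2, where 'a = real] summable_Suc_iff[of "\<lambda>k. inverse (real k ^ 2)"]
      by (intro summable_mult) auto
    show "norm (e k) \<le> 4 * inverse (real (Suc k) ^ 2)" if "k \<ge> 0" for k
    proof -
      have "(real (Suc k))^2 \<le> 4 * ((1/2 + real k)^2 + 1)" by (simp add: power2_eq_square algebra_simps)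
      moreover have "(1/2 + real k)^2 + 1 > 0" by (simp add: add_nonneg_pos)
      ultimately have "1 / ((1/2 + real k)^2 + 1) \<le> 4 / (real (Suc k))^2"
        by (simp add: pos_divide_le_eq pos_le_divide_eq mult.commute del: of_nat_Suc)
      then show ?thesis using e_nonneg[of k] unfolding e_def by (simp add: inverse_eq_divide)
    qed
  qed
  have "\<bar>ln (norm (Gamma (Complex (1/2 + \<theta>) y))) - ln (norm (Gamma (Complex (1/2) y)))
         - \<theta> * ln (norm (Complex (1/2) y))\<bar> \<le> suminf e"
    if \<theta>: "0 \<le> \<theta>" "\<theta> \<le> 1" and y: "\<bar>y\<bar> \<ge> 1" for \<theta> y :: real
  proof -
    define l where "l = (\<lambda>x. ln (norm (Complex x y)))"
    define d where "d = (\<lambda>n. ln (norm (Gamma_series (Complex (1/2 + \<theta>) y) n))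
      - ln (norm (Gamma_series (Complex (1/2) y) n)))"
    define r where "r = (\<lambda>n. \<theta> * (ln (real n) - l (1/2 + real (Suc n)) + l (1/2)))"
    have bound: "\<bar>d n - r n\<bar> \<le> suminf e" if "n > 0" for n
    proof -
      define w where "w = (\<lambda>k. l (1/2 + real k + \<theta>) - l (1/2 + real k)
        - \<theta> * (l (1/2 + real k + 1) - l (1/2 + real k)))"
      have tele: "(\<Sum>k\<le>n. l (1/2 + real k + 1) - l (1/2 + real k)) = l (1/2 + real (Suc n)) - l (1/2)"
        by (induction n) (simp_all add: algebra_simps)
      have "d n = \<theta> * ln (real n) - (\<Sum>k\<le>n. l (1/2 + real k + \<theta>) - l (1/2 + real k))"
        using \<open>n > 0\<close> \<theta> unfolding d_def
        by (subst (1 2) norm_Gamma_series) (auto simp: l_def sum_subtractf algebra_simps)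
      also have "(\<Sum>k\<le>n. l (1/2 + real k + \<theta>) - l (1/2 + real k)) =
          (\<Sum>k\<le>n. w k) + \<theta> * (\<Sum>k\<le>n. l (1/2 + real k + 1) - l (1/2 + real k))"
        unfolding w_def sum_distrib_left sum.distrib[symmetric] by simp
      finally have "d n - r n = - (\<Sum>k\<le>n. w k)" unfolding tele r_def by (simp add: algebra_simps)
      then have "\<bar>d n - r n\<bar> \<le> (\<Sum>k\<le>n. \<bar>w k\<bar>)" by (simp add: sum_abs)
      also have "\<dots> \<le> (\<Sum>k\<le>n. e k)"
        unfolding w_def e_def l_def by (intro sum_mono ln_norm_interpolation y \<theta>) auto
      also have "\<dots> \<le> suminf e" using e_nonneg \<open>summable e\<close> by (intro sum_le_suminf) auto
      finally show ?thesis .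
    qed
    have Gnz: "Gamma (Complex (1/2 + \<theta>) y) \<noteq> 0" "Gamma (Complex (1/2) y) \<noteq> 0"
      using y by (auto intro!: Gamma_nonreal_nonzero)
    have "d \<longlonglongrightarrow> ln (norm (Gamma (Complex (1/2 + \<theta>) y))) - ln (norm (Gamma (Complex (1/2) y)))"
      unfolding d_def using Gnz by (intro tendsto_intros Gamma_series_LIMSEQ) auto
    moreover have "r \<longlonglongrightarrow> \<theta> * l (1/2)"
    proof -
      have "(\<lambda>n. ln (real n) - ln (sqrt ((1/2 + real (Suc n))^2 + y^2))) \<longlonglongrightarrow> 0"
        by real_asymp
      then have "(\<lambda>n. \<theta> * ((ln (real n) - l (1/2 + real (Suc n))) + l (1/2))) \<longlonglongrightarrow> \<theta> * (0 + l (1/2))"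
        unfolding l_def cmod_def by (intro tendsto_intros) auto
      then show ?thesis by (simp add: r_def)
    qed
    ultimately have "(\<lambda>n. \<bar>d n - r n\<bar>) \<longlonglongrightarrow>
       \<bar>ln (norm (Gamma (Complex (1/2 + \<theta>) y))) - ln (norm (Gamma (Complex (1/2) y))) - \<theta> * l (1/2)\<bar>"
      by (intro tendsto_intros)
    then show ?thesis
      unfolding l_def using bound by (intro tendsto_upperbound[where F=sequentially]) (auto intro: eventually_sequentiallyI[of 1])
  qed
  then show ?thesis by (rule that)
qed

text \<open>
  The logarithmic deviation of \<open>norm (Gamma (Complex x y))\<close> from Stirling's main term
  \<open>\<bar>y\<bar> powr (x - 1/2) * exp (- \<pi> \<bar>y\<bar> / 2)\<close>, up to an additive constant.
\<close>
definition Gamma_defect :: "real \<Rightarrow> real \<Rightarrow> real" where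
  "Gamma_defect x y = ln (norm (Gamma (Complex x y))) - ((x - 1/2) * ln \<bar>y\<bar> - pi / 2 * \<bar>y\<bar>)"

lemma Gamma_defect_plus1:
  assumes "\<bar>y\<bar> \<ge> 1"
  shows "\<bar>Gamma_defect (x + 1) y - Gamma_defect x y\<bar> \<le> \<bar>x\<bar>"
proof -
  have "Complex (x + 1) y = Complex x y + 1" "Complex x y \<noteq> 0" using assms by (auto simp: complex_eq_iff)
  then have "Gamma (Complex (x + 1) y) = Complex x y * Gamma (Complex x y)"
    using assms by (subst \<open>Complex (x+1) y = _\<close>, subst Gamma_plus1) (auto simp: complex_eq_iff elim!: nonpos_Ints_cases)
  then have "Gamma_defect (x + 1) y - Gamma_defect x y = ln (norm (Complex x y)) - ln \<bar>y\<bar>"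
    using assms Gamma_nonreal_nonzero[of y x] \<open>Complex x y \<noteq> 0\<close>
    by (simp add: Gamma_defect_def norm_mult ln_mult algebra_simps)
  also have "\<dots> = ln (norm (Complex x y) / \<bar>y\<bar>)" using assms \<open>Complex x y \<noteq> 0\<close> by (simp add: ln_div)
  finally have eq: "Gamma_defect (x + 1) y - Gamma_defect x y = ln (norm (Complex x y) / \<bar>y\<bar>)" .
  have "\<bar>y\<bar> \<le> norm (Complex x y)" using abs_Im_le_cmod[of "Complex x y"] by simp
  moreover have "norm (Complex x y) \<le> \<bar>x\<bar> + \<bar>y\<bar>" using cmod_le[of "Complex x y"] by simp
  moreover have "\<bar>x\<bar> + \<bar>y\<bar> \<le> (1 + \<bar>x\<bar>) * \<bar>y\<bar>" using assms mult_left_mono[of 1 "\<bar>y\<bar>" "\<bar>x\<bar>"] by (simp add: algebra_simps)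
  ultimately have "1 \<le> norm (Complex x y) / \<bar>y\<bar>" "norm (Complex x y) / \<bar>y\<bar> \<le> 1 + \<bar>x\<bar>"
    using assms by (auto simp: field_simps)
  moreover from this have "ln (norm (Complex x y) / \<bar>y\<bar>) \<le> ln (1 + \<bar>x\<bar>)" by (subst ln_le_cancel_iff) auto
  moreover have "0 \<le> ln (norm (Complex x y) / \<bar>y\<bar>)" using calculation(1) by (rule ln_ge_zero)
  ultimately show ?thesis unfolding eq using ln_add_one_self_le_self[of "\<bar>x\<bar>"] by linarith
qed

text \<open>
  The line \<open>x = 1/2\<close> is explicit, the strip \<open>1/2 \<le> x \<le> 3/2\<close> follows by comparison with this line, and the
  functional equation carries the bound to the neighbouring strips.
\<close>
lemma Gamma_defect_bounded:
  obtains C where "\<And>x y. \<bar>x\<bar> \<le> R \<Longrightarrow> \<bar>y\<bar> \<ge> 1 \<Longrightarrow> \<bar>Gamma_defect x y\<bar> \<le> C"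
proof -
  have half: "\<bar>Gamma_defect (1/2) y\<bar> \<le> 1 + ln pi" if "\<bar>y\<bar> \<ge> 1" for y
  proof -
    have "ln (norm (Gamma (Complex (1/2) y)) ^ 2) = ln pi - ln (cosh (pi * y))"
      unfolding norm_Gamma_half by (subst ln_div) auto
    then have eq: "2 * Gamma_defect (1/2) y = ln pi - ln (cosh (pi * y)) + pi * \<bar>y\<bar>"
      using Gamma_nonreal_nonzero[of y "1/2"] that by (simp add: Gamma_defect_def ln_realpow)
    have c: "cosh (pi * y) = cosh (pi * \<bar>y\<bar>)" by (simp add: abs_if)
    have "exp (pi * \<bar>y\<bar>) / 2 \<le> cosh (pi * y)" unfolding c by (simp add: cosh_field_def)
    then have "ln (exp (pi * \<bar>y\<bar>) / 2) \<le> ln (cosh (pi * y))" by (subst ln_le_cancel_iff) auto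
    then have "pi * \<bar>y\<bar> - ln 2 \<le> ln (cosh (pi * y))" by (simp add: ln_div)
    moreover have "cosh (pi * y) \<le> exp (pi * \<bar>y\<bar>)" unfolding c by (simp add: cosh_field_def)
    then have "ln (cosh (pi * y)) \<le> ln (exp (pi * \<bar>y\<bar>))" by (subst ln_le_cancel_iff) auto
    then have "ln (cosh (pi * y)) \<le> pi * \<bar>y\<bar>" by simp
    moreover have "ln 2 \<le> (1::real)" using ln_2_less_1 by simp
    moreover have "ln pi \<ge> 0" using pi_ge_two by (simp add: ln_ge_zero)
    ultimately show ?thesis using eq by linarith
  qed
  obtain C0 where C0: "\<And>\<theta> y. 0 \<le> \<theta> \<Longrightarrow> \<theta> \<le> 1 \<Longrightarrow> \<bar>y\<bar> \<ge> 1 \<Longrightarrow>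
       \<bar>ln (norm (Gamma (Complex (1/2 + \<theta>) y))) - ln (norm (Gamma (Complex (1/2) y)))
         - \<theta> * ln (norm (Complex (1/2) y))\<bar> \<le> C0"
    using ln_norm_Gamma_ratio by blast
  have base: "\<bar>Gamma_defect (1/2 + \<theta>) y\<bar> \<le> C0 + 2 + ln pi" if "0 \<le> \<theta>" "\<theta> \<le> 1" "\<bar>y\<bar> \<ge> 1" for \<theta> y
  proof -
    have "\<bar>y\<bar> \<le> norm (Complex (1/2) y)" using abs_Im_le_cmod[of "Complex (1/2) y"] by simp
    moreover have "norm (Complex (1/2) y) \<le> 1/2 + \<bar>y\<bar>" using cmod_le[of "Complex (1/2) y"] by simp
    ultimately have "ln \<bar>y\<bar> \<le> ln (norm (Complex (1/2) y))" "ln (norm (Complex (1/2) y)) \<le> ln (exp 1 * \<bar>y\<bar>)"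
      using that exp_ge_add_one_self[of 1] mult_right_mono[of 2 "exp 1" "\<bar>y\<bar>"]
      by (subst ln_le_cancel_iff; force)+
    then have "0 \<le> ln (norm (Complex (1/2) y)) - ln \<bar>y\<bar>" "ln (norm (Complex (1/2) y)) - ln \<bar>y\<bar> \<le> 1"
      using that by (auto simp: ln_mult split: if_splits)
    then have "\<theta> * (ln (norm (Complex (1/2) y)) - ln \<bar>y\<bar>) \<le> 1 * 1"
        "0 \<le> \<theta> * (ln (norm (Complex (1/2) y)) - ln \<bar>y\<bar>)"
      using that by (intro mult_mono mult_nonneg_nonneg; auto)+
    moreover have "Gamma_defect (1/2 + \<theta>) y = Gamma_defect (1/2) y +
      (ln (norm (Gamma (Complex (1/2 + \<theta>) y))) - ln (norm (Gamma (Complex (1/2) y)))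
         - \<theta> * ln (norm (Complex (1/2) y))) + \<theta> * (ln (norm (Complex (1/2) y)) - ln \<bar>y\<bar>)"
      by (simp add: Gamma_defect_def algebra_simps)
    ultimately show ?thesis using C0[OF that] half[OF that(3)] by linarith
  qed
  have "\<exists>C. \<forall>x y. 1/2 - real N \<le> x \<and> x \<le> 3/2 + real N \<and> \<bar>y\<bar> \<ge> 1 \<longrightarrow> \<bar>Gamma_defect x y\<bar> \<le> C" for N
  proof (induction N)
    case 0
    have "\<bar>Gamma_defect x y\<bar> \<le> C0 + 2 + ln pi" if "1/2 \<le> x" "x \<le> 3/2" "\<bar>y\<bar> \<ge> 1" for x y
      using base[of "x - 1/2" y] that by simp
    then show ?case by auto
  next
    case (Suc N)
    then obtain C where C: "\<And>x y. 1/2 - real N \<le> x \<Longrightarrow> x \<le> 3/2 + real N \<Longrightarrow> \<bar>y\<bar> \<ge> 1 \<Longrightarrow> \<bar>Gamma_defect x y\<bar> \<le> C"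
      by blast
    have "\<bar>Gamma_defect x y\<bar> \<le> C + real N + 2"
      if x: "1/2 - real (Suc N) \<le> x" "x \<le> 3/2 + real (Suc N)" and y: "\<bar>y\<bar> \<ge> 1" for x y
    proof -
      consider "x < 1/2 - real N" | "1/2 - real N \<le> x" "x \<le> 3/2 + real N" | "x > 3/2 + real N" by linarith
      then show ?thesis
      proof cases
        case 1
        then show ?thesis using C[of "x+1" y] Gamma_defect_plus1[OF y, of x] x y by auto
      next
        case 2
        then show ?thesis using C[of x y] y by auto
      next
        case 3
        then show ?thesis using C[of "x-1" y] Gamma_defect_plus1[OF y, of "x-1"] x y by auto
      qed
    qed
    then show ?case by blast
  qed
  from this[of "nat \<lceil>R\<rceil> + 1"] obtain C where C: "\<And>x y. 1/2 - real (nat \<lceil>R\<rceil> + 1) \<le> x \<Longrightarrow>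
      x \<le> 3/2 + real (nat \<lceil>R\<rceil> + 1) \<Longrightarrow> \<bar>y\<bar> \<ge> 1 \<Longrightarrow> \<bar>Gamma_defect x y\<bar> \<le> C" by blast
  have "real (nat \<lceil>R\<rceil>) \<ge> R" by linarith
  then have "1/2 - real (nat \<lceil>R\<rceil> + 1) \<le> x \<and> x \<le> 3/2 + real (nat \<lceil>R\<rceil> + 1)" if "\<bar>x\<bar> \<le> R" for x
    using that unfolding of_nat_add by linarith
  then show ?thesis by (intro that[of C] C) blast+
qed

text \<open>
  \<open>norm (f s)\<close> is of the exact order \<open>\<bar>t\<bar> powr (u + v * \<sigma>) * exp (- e * \<pi> * \<bar>t\<bar> / 2)\<close> at
  \<open>s = Complex \<sigma> t\<close>, uniformly in \<open>\<sigma>\<close> in bounded sets. The two-sided logarithmic form makes the exponents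
  additive under products and lets them change sign under inversion, so that Gamma factors in a
  denominator are treated like those in a numerator.
\<close>
definition vertical_growth :: "(complex \<Rightarrow> complex) \<Rightarrow> real \<Rightarrow> real \<Rightarrow> real \<Rightarrow> bool" where
  "vertical_growth f e u v \<longleftrightarrow> (\<forall>R. \<exists>C T0. \<forall>\<sigma> t. \<bar>\<sigma>\<bar> \<le> R \<and> \<bar>t\<bar> \<ge> T0 \<longrightarrow>
     f (Complex \<sigma> t) \<noteq> 0 \<and>
     \<bar>ln (norm (f (Complex \<sigma> t))) - ((u + v * \<sigma>) * ln \<bar>t\<bar> - e * pi / 2 * \<bar>t\<bar>)\<bar> \<le> C)"

lemma vertical_growthE:
  assumes "vertical_growth f e u v"
  obtains C T0 where "T0 > 0" "C \<ge> 0"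
    "\<And>\<sigma> t. \<bar>\<sigma>\<bar> \<le> R \<Longrightarrow> \<bar>t\<bar> \<ge> T0 \<Longrightarrow> f (Complex \<sigma> t) \<noteq> 0"
    "\<And>\<sigma> t. \<bar>\<sigma>\<bar> \<le> R \<Longrightarrow> \<bar>t\<bar> \<ge> T0 \<Longrightarrow>
      \<bar>ln (norm (f (Complex \<sigma> t))) - ((u + v * \<sigma>) * ln \<bar>t\<bar> - e * pi / 2 * \<bar>t\<bar>)\<bar> \<le> C"
proof -
  from assms obtain C T0 where *: "\<And>\<sigma> t. \<bar>\<sigma>\<bar> \<le> R \<and> \<bar>t\<bar> \<ge> T0 \<Longrightarrow>
     f (Complex \<sigma> t) \<noteq> 0 \<and>
     \<bar>ln (norm (f (Complex \<sigma> t))) - ((u + v * \<sigma>) * ln \<bar>t\<bar> - e * pi / 2 * \<bar>t\<bar>)\<bar> \<le> C"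
    unfolding vertical_growth_def by blast
  then have "\<And>\<sigma> t. \<bar>\<sigma>\<bar> \<le> R \<and> \<bar>t\<bar> \<ge> max 1 T0 \<Longrightarrow>
     f (Complex \<sigma> t) \<noteq> 0 \<and>
     \<bar>ln (norm (f (Complex \<sigma> t))) - ((u + v * \<sigma>) * ln \<bar>t\<bar> - e * pi / 2 * \<bar>t\<bar>)\<bar> \<le> max C 0"
    by fastforce
  then show ?thesis by (intro that[of "max 1 T0" "max C 0"]) auto
qed

lemma vertical_growth_1: "vertical_growth (\<lambda>_. 1) 0 0 0"
  unfolding vertical_growth_def by (auto intro!: exI[of _ 0])

lemma vertical_growth_mult:
  assumes "vertical_growth f e u v" "vertical_growth g e' u' v'"
  shows "vertical_growth (\<lambda>s. f s * g s) (e + e') (u + u') (v + v')"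
  unfolding vertical_growth_def
proof
  fix R
  obtain C T where f: "\<And>\<sigma> t. \<bar>\<sigma>\<bar> \<le> R \<Longrightarrow> \<bar>t\<bar> \<ge> T \<Longrightarrow> f (Complex \<sigma> t) \<noteq> 0"
    "\<And>\<sigma> t. \<bar>\<sigma>\<bar> \<le> R \<Longrightarrow> \<bar>t\<bar> \<ge> T \<Longrightarrow>
      \<bar>ln (norm (f (Complex \<sigma> t))) - ((u + v * \<sigma>) * ln \<bar>t\<bar> - e * pi / 2 * \<bar>t\<bar>)\<bar> \<le> C"
    using vertical_growthE[OF assms(1), of R] by metis
  obtain C' T' where g: "\<And>\<sigma> t. \<bar>\<sigma>\<bar> \<le> R \<Longrightarrow> \<bar>t\<bar> \<ge> T' \<Longrightarrow> g (Complex \<sigma> t) \<noteq> 0"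
    "\<And>\<sigma> t. \<bar>\<sigma>\<bar> \<le> R \<Longrightarrow> \<bar>t\<bar> \<ge> T' \<Longrightarrow>
      \<bar>ln (norm (g (Complex \<sigma> t))) - ((u' + v' * \<sigma>) * ln \<bar>t\<bar> - e' * pi / 2 * \<bar>t\<bar>)\<bar> \<le> C'"
    using vertical_growthE[OF assms(2), of R] by metis
  have "\<bar>ln (norm (f (Complex \<sigma> t) * g (Complex \<sigma> t)))
      - ((u + u' + (v + v') * \<sigma>) * ln \<bar>t\<bar> - (e + e') * pi / 2 * \<bar>t\<bar>)\<bar> \<le> C + C'"
    if "\<bar>\<sigma>\<bar> \<le> R" "\<bar>t\<bar> \<ge> max T T'" for \<sigma> t
  proof -
    have "ln (norm (f (Complex \<sigma> t) * g (Complex \<sigma> t))) = ln (norm (f (Complex \<sigma> t))) + ln (norm (g (Complex \<sigma> t)))"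
      using f(1) g(1) that by (simp add: norm_mult ln_mult)
    then have split: "ln (norm (f (Complex \<sigma> t) * g (Complex \<sigma> t)))
        - ((u + u' + (v + v') * \<sigma>) * ln \<bar>t\<bar> - (e + e') * pi / 2 * \<bar>t\<bar>) =
      (ln (norm (f (Complex \<sigma> t))) - ((u + v * \<sigma>) * ln \<bar>t\<bar> - e * pi / 2 * \<bar>t\<bar>)) +
      (ln (norm (g (Complex \<sigma> t))) - ((u' + v' * \<sigma>) * ln \<bar>t\<bar> - e' * pi / 2 * \<bar>t\<bar>))"
      by (simp add: field_simps)
    show ?thesis
      unfolding split by (rule order_trans[OF abs_triangle_ineq add_mono[OF f(2) g(2)]]) (use that in auto)
  qed
  then show "\<exists>C T0. \<forall>\<sigma> t. \<bar>\<sigma>\<bar> \<le> R \<and> \<bar>t\<bar> \<ge> T0 \<longrightarrow> f (Complex \<sigma> t) * g (Complex \<sigma> t) \<noteq> 0 \<and>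
     \<bar>ln (norm (f (Complex \<sigma> t) * g (Complex \<sigma> t)))
       - ((u + u' + (v + v') * \<sigma>) * ln \<bar>t\<bar> - (e + e') * pi / 2 * \<bar>t\<bar>)\<bar> \<le> C"
    using f(1) g(1) by (intro exI[of _ "C+C'"] exI[of _ "max T T'"]) auto
qed

lemma vertical_growth_inverse:
  assumes "vertical_growth f e u v"
  shows "vertical_growth (\<lambda>s. inverse (f s)) (- e) (- u) (- v)"
  unfolding vertical_growth_def
proof
  fix R
  obtain C T where f: "\<And>\<sigma> t. \<bar>\<sigma>\<bar> \<le> R \<Longrightarrow> \<bar>t\<bar> \<ge> T \<Longrightarrow> f (Complex \<sigma> t) \<noteq> 0"
    "\<And>\<sigma> t. \<bar>\<sigma>\<bar> \<le> R \<Longrightarrow> \<bar>t\<bar> \<ge> T \<Longrightarrow>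
      \<bar>ln (norm (f (Complex \<sigma> t))) - ((u + v * \<sigma>) * ln \<bar>t\<bar> - e * pi / 2 * \<bar>t\<bar>)\<bar> \<le> C"
    using vertical_growthE[OF assms(1), of R] by metis
  have "\<bar>ln (norm (inverse (f (Complex \<sigma> t)))) - ((- u + - v * \<sigma>) * ln \<bar>t\<bar> - - e * pi / 2 * \<bar>t\<bar>)\<bar> \<le> C"
    if "\<bar>\<sigma>\<bar> \<le> R" "\<bar>t\<bar> \<ge> T" for \<sigma> t
  proof -
    have "ln (norm (inverse (f (Complex \<sigma> t)))) - ((- u + - v * \<sigma>) * ln \<bar>t\<bar> - - e * pi / 2 * \<bar>t\<bar>) =
      - (ln (norm (f (Complex \<sigma> t))) - ((u + v * \<sigma>) * ln \<bar>t\<bar> - e * pi / 2 * \<bar>t\<bar>))"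
      using f(1) that by (simp add: norm_inverse ln_inverse algebra_simps)
    then show ?thesis using f(2)[OF that] by linarith
  qed
  then show "\<exists>C T0. \<forall>\<sigma> t. \<bar>\<sigma>\<bar> \<le> R \<and> \<bar>t\<bar> \<ge> T0 \<longrightarrow> inverse (f (Complex \<sigma> t)) \<noteq> 0 \<and>
     \<bar>ln (norm (inverse (f (Complex \<sigma> t)))) - ((- u + - v * \<sigma>) * ln \<bar>t\<bar> - - e * pi / 2 * \<bar>t\<bar>)\<bar> \<le> C"
    using f(1) by (intro exI[of _ "C"] exI[of _ "T"]) auto
qed

lemma vertical_growth_prod:
  assumes "\<And>i. i \<in> I \<Longrightarrow> vertical_growth (f i) (e i) (u i) (v i)"
  shows "vertical_growth (\<lambda>s. \<Prod>i\<in>I. f i s) (\<Sum>i\<in>I. e i) (\<Sum>i\<in>I. u i) (\<Sum>i\<in>I. v i)"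
  using assms
  by (induction I rule: infinite_finite_induct) (auto intro: vertical_growth_1 vertical_growth_mult)

lemma vertical_growth_Gamma:
  assumes "\<kappa> \<noteq> 0"
  shows "vertical_growth (\<lambda>s. Gamma (of_real c + s * of_real \<kappa>)) \<bar>\<kappa>\<bar> (c - 1/2) \<kappa>"
  unfolding vertical_growth_def
proof
  fix R :: real
  obtain C where C: "\<And>x y. \<bar>x\<bar> \<le> \<bar>c\<bar> + R * \<bar>\<kappa>\<bar> \<Longrightarrow> \<bar>y\<bar> \<ge> 1 \<Longrightarrow> \<bar>Gamma_defect x y\<bar> \<le> C"
    using Gamma_defect_bounded by blast
  define D where "D = (\<bar>c\<bar> + R * \<bar>\<kappa>\<bar> + 1/2) * \<bar>ln \<bar>\<kappa>\<bar>\<bar>"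
  have "Gamma (of_real c + Complex \<sigma> t * of_real \<kappa>) \<noteq> 0 \<and> \<bar>ln (norm (Gamma (of_real c + Complex \<sigma> t * of_real \<kappa>)))
      - ((c - 1/2 + \<kappa> * \<sigma>) * ln \<bar>t\<bar> - \<bar>\<kappa>\<bar> * pi / 2 * \<bar>t\<bar>)\<bar> \<le> C + D"
    if \<sigma>: "\<bar>\<sigma>\<bar> \<le> R" and t: "\<bar>t\<bar> \<ge> 1 / \<bar>\<kappa>\<bar>" for \<sigma> t
  proof -
    have z: "of_real c + Complex \<sigma> t * of_real \<kappa> = Complex (c + \<kappa> * \<sigma>) (\<kappa> * t)"
      by (simp add: complex_eq_iff)
    have "\<bar>t\<bar> > 0" using t assms by (smt (verit) divide_pos_pos)
    have "\<bar>\<kappa> * t\<bar> \<ge> 1" using t assms by (simp add: field_simps abs_mult)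
    have "\<bar>\<kappa> * \<sigma>\<bar> \<le> R * \<bar>\<kappa>\<bar>" using mult_right_mono[OF \<sigma>, of "\<bar>\<kappa>\<bar>"] by (simp add: abs_mult mult.commute)
    then have x: "\<bar>c + \<kappa> * \<sigma>\<bar> \<le> \<bar>c\<bar> + R * \<bar>\<kappa>\<bar>" by linarith
    have "ln \<bar>\<kappa> * t\<bar> = ln \<bar>\<kappa>\<bar> + ln \<bar>t\<bar>" using assms \<open>\<bar>t\<bar> > 0\<close> by (simp add: abs_mult ln_mult)
    then have "ln (norm (Gamma (Complex (c + \<kappa> * \<sigma>) (\<kappa> * t))))
      - ((c - 1/2 + \<kappa> * \<sigma>) * ln \<bar>t\<bar> - \<bar>\<kappa>\<bar> * pi / 2 * \<bar>t\<bar>) =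
        Gamma_defect (c + \<kappa> * \<sigma>) (\<kappa> * t) + (c + \<kappa> * \<sigma> - 1/2) * ln \<bar>\<kappa>\<bar>"
      by (simp add: Gamma_defect_def abs_mult field_simps)
    moreover have "\<bar>(c + \<kappa> * \<sigma> - 1/2) * ln \<bar>\<kappa>\<bar>\<bar> \<le> D"
      unfolding D_def abs_mult using x by (intro mult_right_mono) auto
    moreover have "Gamma (Complex (c + \<kappa> * \<sigma>) (\<kappa> * t)) \<noteq> 0"
      using \<open>\<bar>t\<bar> > 0\<close> assms by (intro Gamma_nonreal_nonzero) auto
    ultimately show ?thesis unfolding z using C[OF x \<open>\<bar>\<kappa> * t\<bar> \<ge> 1\<close>] by linarith
  qed
  then show "\<exists>C T0. \<forall>\<sigma> t. \<bar>\<sigma>\<bar> \<le> R \<and> \<bar>t\<bar> \<ge> T0 \<longrightarrow> Gamma (of_real c + Complex \<sigma> t * of_real \<kappa>) \<noteq> 0 \<and>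
     \<bar>ln (norm (Gamma (of_real c + Complex \<sigma> t * of_real \<kappa>)))
      - ((c - 1/2 + \<kappa> * \<sigma>) * ln \<bar>t\<bar> - \<bar>\<kappa>\<bar> * pi / 2 * \<bar>t\<bar>)\<bar> \<le> C"
    by blast
qed

section \<open>Comparing integrals along two contours\<close>

lemma vertical_contour_continuous:
  assumes "vertical_contour \<gamma> g"
  shows "continuous_on S g"
  using assms unfolding vertical_contour_def piecewise_C1_differentiable_on_def
  by (meson continuous_on_subset subset_UNIV)

lemma vertical_contour_bounds:
  assumes g: "vertical_contour \<gamma> g"
  obtains T0 M where "T0 > 0" "M > 0" "\<bar>\<gamma>\<bar> \<le> M" "\<And>t. \<bar>t\<bar> \<ge> T0 \<Longrightarrow> g t = Complex \<gamma> t" "\<And>t. \<bar>Re (g t)\<bar> \<le> M"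
proof -
  from g obtain A B where A: "\<And>t. t \<le> A \<Longrightarrow> g t = Complex \<gamma> t" and B: "\<And>t. t \<ge> B \<Longrightarrow> g t = Complex \<gamma> t"
    unfolding vertical_contour_def eventually_at_bot_linorder eventually_at_top_linorder by blast
  define T0 where "T0 = max 1 (max (- A) B)"
  have tail: "g t = Complex \<gamma> t" if "\<bar>t\<bar> \<ge> T0" for t
  proof (cases "t \<ge> 0")
    case True
    then show ?thesis using that by (intro B) (simp add: T0_def)
  next
    case False
    then show ?thesis using that by (intro A) (simp add: T0_def)
  qed
  have "compact ((\<lambda>t. Re (g t)) ` {-T0..T0})"
    using vertical_contour_continuous[OF g]
    by (intro compact_continuous_image continuous_on_Re) auto
  then obtain M where M: "\<And>t. t \<in> {-T0..T0} \<Longrightarrow> \<bar>Re (g t)\<bar> \<le> M"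
    using compact_imp_bounded bounded_iff by (metis image_eqI real_norm_def)
  have "\<bar>Re (g t)\<bar> \<le> max 1 (max M \<bar>\<gamma>\<bar>)" for t
  proof (cases "\<bar>t\<bar> \<ge> T0")
    case True
    then show ?thesis using tail by simp
  next
    case False
    then have "t \<in> {-T0..T0}" by auto
    then show ?thesis using M[of t] by (simp add: le_max_iff_disj)
  qed
  then show ?thesis using tail by (intro that[of T0 "max 1 (max M \<bar>\<gamma>\<bar>)"]) (auto simp: T0_def)
qed

lemma closed_vertical_contour:
  assumes g: "vertical_contour \<gamma> g"
  shows "closed (range g)"
proof -
  obtain T0 M where T0: "T0 > 0" "\<And>t. \<bar>t\<bar> \<ge> T0 \<Longrightarrow> g t = Complex \<gamma> t"
    using vertical_contour_bounds[OF g] by metis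
  have "range g = g ` {-T0..T0} \<union> {z. Re z = \<gamma> \<and> Im z \<ge> T0} \<union> {z. Re z = \<gamma> \<and> Im z \<le> - T0}" (is "_ = ?R")
  proof (intro equalityI subsetI)
    fix z assume "z \<in> range g"
    then obtain t where "z = g t" by blast
    then show "z \<in> ?R" using T0(2)[of t] by (cases "\<bar>t\<bar> \<ge> T0") (auto simp: abs_if split: if_splits)
  next
    fix z assume "z \<in> ?R"
    moreover have "z \<in> range g" if "Re z = \<gamma>" "\<bar>Im z\<bar> \<ge> T0"
      using T0(2)[OF that(2)] that(1) by (intro image_eqI[of _ _ "Im z"]) (auto simp: complex_eq_iff)
    ultimately show "z \<in> range g" using T0(1) by auto
  qed
  moreover have "closed (g ` {-T0..T0})"
    using vertical_contour_continuous[OF g]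
    by (intro compact_imp_closed compact_continuous_image) auto
  moreover have "closed {z. Re z = \<gamma> \<and> Im z \<ge> T0}" "closed {z. Re z = \<gamma> \<and> Im z \<le> - T0}"
    by (intro closed_Collect_conj closed_Collect_eq closed_Collect_le continuous_intros)+
  ultimately show ?thesis by auto
qed

text \<open>
  Rescaled to the unit interval, on which paths and their contour integrals are defined.
\<close>
definition truncation :: "(real \<Rightarrow> complex) \<Rightarrow> real \<Rightarrow> real \<Rightarrow> complex" where
  "truncation g T = g \<circ> (\<lambda>u. (2 * T) *\<^sub>R u + (- T))"

lemma truncation_image:
  assumes "T > 0"
  shows "(\<lambda>u. (2 * T) *\<^sub>R u + (- T)) ` {0..1} = {-T..T}"
proof -
  have "(\<lambda>u. (2 * T) * u + (- T)) ` {0..1} = {-T..T}"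
    using assms by (subst image_affinity_atLeastAtMost) auto
  then show ?thesis by simp
qed

lemma truncation_ends: "pathstart (truncation g T) = g (- T)" "pathfinish (truncation g T) = g T"
  by (simp_all add: pathstart_def pathfinish_def truncation_def)

lemma path_image_truncation: "T > 0 \<Longrightarrow> path_image (truncation g T) = g ` {-T..T}"
  unfolding path_image_def truncation_def image_comp[symmetric] by (simp only: truncation_image)

lemma valid_path_truncation:
  assumes "vertical_contour \<gamma> g"
  shows "valid_path (truncation g T)"
  using assms unfolding valid_path_def truncation_def vertical_contour_def
  by (intro piecewise_C1_differentiable_affine) (auto intro: piecewise_C1_differentiable_on_subset)

lemma contour_integral_truncation:
  assumes g: "vertical_contour \<gamma> g" and T: "T > 0"
    and f: "f contour_integrable_on truncation g T"
  shows "contour_integral (truncation g T) f = integral {-T..T} (\<lambda>t. f (g t) * vector_derivative g (at t))"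
proof -
  define I where "I = contour_integral (truncation g T) f"
  obtain S where S: "finite S" "\<And>t. t \<notin> S \<Longrightarrow> g differentiable at t"
    using g unfolding vertical_contour_def piecewise_C1_differentiable_on_def
    by (auto simp: C1_differentiable_on_eq)
  define F where "F = (\<lambda>u. f (truncation g T u) * vector_derivative (truncation g T) (at u))"
  have "(F has_integral I) (cbox 0 1)"
    using f unfolding I_def F_def by (simp add: has_contour_integral[symmetric] has_contour_integral_integral)
  from has_integral_affinity[OF this, of "1 / (2 * T)" "1/2"] T
  have "((\<lambda>t. F (t / (2 * T) + 1/2)) has_integral (2 * T) *\<^sub>R I)
     ((\<lambda>x. (2 * T) * x + - T) ` {0..1})"
    by simp
  also have "(\<lambda>x. (2 * T) * x + - T) ` {0..1} = {-T..T}" using truncation_image[OF T] by simp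
  finally have 1: "((\<lambda>t. (1 / (2 * T)) *\<^sub>R F (t / (2 * T) + 1/2)) has_integral (1 / (2 * T)) *\<^sub>R ((2 * T) *\<^sub>R I)) {-T..T}"
    by (rule has_integral_cmul)
  have 2: "(1 / (2 * T)) *\<^sub>R F (t / (2 * T) + 1/2) = f (g t) * vector_derivative g (at t)" if "t \<notin> S" for t
  proof -
    define u where "u = t / (2 * T) + 1/2"
    have u: "(2 * T) *\<^sub>R u + (- T) = t" using T by (simp add: u_def field_simps)
    have d1: "((\<lambda>u. (2 * T) *\<^sub>R u + (- T)) has_vector_derivative (2 * T)) (at u)"
      by (auto intro!: derivative_eq_intros simp: has_vector_derivative_def)
    have "(g has_vector_derivative vector_derivative g (at t)) (at ((2 * T) *\<^sub>R u + (- T)))"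
      unfolding u using S(2)[OF that] vector_derivative_works by blast
    from vector_diff_chain_at[OF d1 this]
    have "vector_derivative (truncation g T) (at u) = (2 * T) *\<^sub>R vector_derivative g (at t)"
      unfolding truncation_def by (rule vector_derivative_at)
    moreover have "truncation g T u = g t" unfolding truncation_def comp_def u ..
    ultimately show ?thesis unfolding u_def[symmetric] F_def using T by simp
  qed
  have "((\<lambda>t. f (g t) * vector_derivative g (at t)) has_integral (1 / (2 * T)) *\<^sub>R ((2 * T) *\<^sub>R I)) {-T..T}"
    using has_integral_spike_finite[OF S(1) _ 1] 2 by (metis (no_types, lifting) DiffD2)
  then show ?thesis unfolding I_def using T by (simp add: integral_unique)
qed

text \<open>
  Three sides of a rectangle. For \<open>R = T\<close> they close a truncated contour up on the right, for
  \<open>R = - T\<close> on the left.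
\<close>
definition closing :: "real \<Rightarrow> real \<Rightarrow> real \<Rightarrow> real \<Rightarrow> complex" where
  "closing \<gamma> T R = linepath (Complex \<gamma> T) (Complex R T) +++ linepath (Complex R T) (Complex R (-T))
     +++ linepath (Complex R (-T)) (Complex \<gamma> (-T))"

lemma closed_segment_same_Re_Complex:
  "closed_segment (Complex x a) (Complex x b) = {z. Re z = x \<and> Im z \<in> closed_segment a b}"
  by (auto simp: closed_segment_same_Re)

lemma closed_segment_same_Im_Complex:
  "closed_segment (Complex a y) (Complex b y) = {z. Im z = y \<and> Re z \<in> closed_segment a b}"
  by (auto simp: closed_segment_same_Im)

lemma path_image_closing:
  "path_image (closing \<gamma> T R) = closed_segment (Complex \<gamma> T) (Complex R T)
     \<union> closed_segment (Complex R T) (Complex R (-T)) \<union> closed_segment (Complex R (-T)) (Complex \<gamma> (-T))"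
  unfolding closing_def by (simp add: path_image_join Un_assoc)

lemma closing_props:
  "path (closing \<gamma> T R)" "pathstart (closing \<gamma> T R) = Complex \<gamma> T" "pathfinish (closing \<gamma> T R) = Complex \<gamma> (-T)"
  unfolding closing_def by auto

text \<open>
  For \<open>s = 1\<close> the point \<open>x0\<close> lies to the left of the whole contour, and the loop is closed up on the
  right; the case \<open>s = -1\<close> is the mirror image. A path from \<open>w\<close> to \<open>x0\<close> that avoids the contour is
  bounded, so it also avoids the closing part if \<open>T\<close> is large, and the loop has the same winding number
  about \<open>w\<close> as about \<open>x0\<close>, which is separated from the loop by a vertical line.
\<close>
lemma winding_number_closing_zero:
  assumes g: "vertical_contour \<gamma> g" and s: "s = 1 \<or> s = -1"
    and conn: "connected_component (- range g) w (of_real x0)"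
    and x0: "\<And>t. s * x0 < s * Re (g t)"
  shows "\<forall>\<^sub>F T in at_top. winding_number (truncation g T +++ closing \<gamma> T (s * T)) w = 0"
proof -
  obtain T0 M where T0: "T0 > 0" "\<And>t. \<bar>t\<bar> \<ge> T0 \<Longrightarrow> g t = Complex \<gamma> t"
    using vertical_contour_bounds[OF g] by metis
  have "path_component (- range g) w (of_real x0)"
    using conn open_path_connected_component[OF open_Compl[OF closed_vertical_contour[OF g]]] by simp
  then obtain p where p: "path p" "path_image p \<subseteq> - range g" "pathstart p = w" "pathfinish p = of_real x0"
    unfolding path_component_def by blast
  then obtain r where r: "path_image p \<subseteq> ball 0 r"
    using bounded_subset_ballD[OF bounded_path_image[OF p(1)]] by metis
  have wp: "w \<in> path_image p" "of_real x0 \<in> path_image p"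
    using p pathstart_in_path_image pathfinish_in_path_image by metis+
  show ?thesis
    using eventually_gt_at_top[of T0] eventually_gt_at_top[of r] eventually_gt_at_top[of "\<bar>x0\<bar>"]
  proof eventually_elim
    case (elim T)
    define q where "q = truncation g T +++ closing \<gamma> T (s * T)"
    have "T > 0" using elim T0(1) by linarith
    have ends: "g T = Complex \<gamma> T" "g (-T) = Complex \<gamma> (-T)" using T0 elim by auto
    have x\<gamma>: "s * x0 < s * \<gamma>" using x0[of T] ends by simp
    have sT: "\<bar>s * T\<bar> = T" "s * x0 < s * (s * T)" using s elim by auto
    have "path q" "pathfinish q = pathstart q"
      unfolding q_def using valid_path_truncation[OF g] closing_props ends
      by (auto intro!: path_join_imp valid_path_imp_path simp: truncation_ends)
    moreover have qi: "path_image q = g ` {-T..T} \<union> path_image (closing \<gamma> T (s * T))"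
      unfolding q_def using ends \<open>T > 0\<close> closing_props
      by (subst path_image_join) (auto simp: truncation_ends path_image_truncation)
    have far: "norm z \<ge> T" if "z \<in> path_image (closing \<gamma> T (s * T))" for z
    proof -
      have "\<bar>Re z\<bar> = T \<or> \<bar>Im z\<bar> = T"
        using that sT \<open>T > 0\<close> unfolding path_image_closing by (auto simp: closed_segment_same_Re_Complex closed_segment_same_Im_Complex)
      then show ?thesis using abs_Re_le_cmod[of z] abs_Im_le_cmod[of z] by auto
    qed
    have "path_image p \<inter> path_image q = {}"
      using p(2) far r elim unfolding qi by (fastforce simp: subset_iff)
    ultimately have "winding_number q w = winding_number q (of_real x0)"
      using wp connected_path_image[OF p(1)] by (intro winding_number_eq)
    also have "\<dots> = 0"
    proof (rule winding_number_zero_outside)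
      show "convex {z. s * x0 < s * Re z}"
        using convex_halfspace_gt[of "s * x0" "of_real s :: complex"] by (simp add: inner_complex_def)
      have ends_in: "Complex \<gamma> T \<in> {z. s * x0 < s * Re z}" "Complex (s*T) T \<in> {z. s * x0 < s * Re z}"
        "Complex (s*T) (-T) \<in> {z. s * x0 < s * Re z}" "Complex \<gamma> (-T) \<in> {z. s * x0 < s * Re z}"
        using x\<gamma> sT by auto
      show "path_image q \<subseteq> {z. s * x0 < s * Re z}"
        unfolding qi path_image_closing using x0
        by (intro Un_least closed_segment_subset ends_in \<open>convex _\<close>) auto
    qed (use \<open>path q\<close> \<open>pathfinish q = pathstart q\<close> in auto)
    finally show ?case unfolding q_def .
  qed
qed

text \<open>
  Holds for \<open>b\<close> outside of the segment as well: the loop through the three points stays on a line that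
  does not contain \<open>w\<close>.
\<close>
lemma winding_number_collinear:
  assumes "y \<noteq> Im w"
  shows "winding_number (linepath (Complex a y) (Complex c y)) w =
    winding_number (linepath (Complex a y) (Complex b y)) w + winding_number (linepath (Complex b y) (Complex c y)) w"
proof -
  define l where "l = (\<lambda>a b. linepath (Complex a y) (Complex b y))"
  have image: "path_image (l a b) \<subseteq> {z. Im z = y}" for a b
    by (auto simp: l_def closed_segment_same_Im_Complex)
  then have w: "w \<notin> path_image (l a b)" for a b using assms by blast
  have [simp]: "path (l a b)" "pathstart (l a b) = Complex a y" "pathfinish (l a b) = Complex b y" for a b
    by (auto simp: l_def)
  have "winding_number ((l a b +++ l b c) +++ l c a) w = 0"
  proof (rule winding_number_zero_outside)
    show "convex {z. Im z = y}"
      by (auto simp: convex_alt algebra_simps)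
    show "path_image ((l a b +++ l b c) +++ l c a) \<subseteq> {z. Im z = y}"
      using image by (simp add: path_image_join)
  qed (use assms in auto)
  then have "winding_number (l a b) w + winding_number (l b c) w + winding_number (l c a) w = 0"
    using w by (simp add: winding_number_join path_image_join)
  moreover have "winding_number (l c a) w = - winding_number (l a c) w"
    using winding_number_reversepath[of "l a c" w] w by (simp add: l_def)
  ultimately show ?thesis unfolding l_def by (simp add: add_eq_0_iff2)
qed

definition contour_loop :: "real \<Rightarrow> (real \<Rightarrow> complex) \<Rightarrow> real \<Rightarrow> (real \<Rightarrow> complex) \<Rightarrow> real \<Rightarrow> real \<Rightarrow> complex" where
  "contour_loop \<gamma>1 g1 \<gamma>2 g2 T = truncation g1 T +++ linepath (Complex \<gamma>1 T) (Complex \<gamma>2 T)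
     +++ reversepath (truncation g2 T) +++ linepath (Complex \<gamma>2 (-T)) (Complex \<gamma>1 (-T))"

text \<open>
  Closing up both truncated contours through the same vertical side, the loop between them is the
  difference of the two closed curves.
\<close>
lemma winding_number_contour_loop:
  assumes g1: "vertical_contour \<gamma>1 g1" and g2: "vertical_contour \<gamma>2 g2"
    and w: "w \<in> \<real>" "w \<notin> range g1" "w \<notin> range g2" and s: "s = 1 \<or> s = -1"
    and wn: "\<forall>\<^sub>F T in at_top. winding_number (truncation g1 T +++ closing \<gamma>1 T (s * T)) w = 0"
      "\<forall>\<^sub>F T in at_top. winding_number (truncation g2 T +++ closing \<gamma>2 T (s * T)) w = 0"
  shows "\<forall>\<^sub>F T in at_top. winding_number (contour_loop \<gamma>1 g1 \<gamma>2 g2 T) w = 0"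
proof -
  obtain T1 where T1: "T1 > 0" "\<And>t. \<bar>t\<bar> \<ge> T1 \<Longrightarrow> g1 t = Complex \<gamma>1 t"
    using vertical_contour_bounds[OF g1] by metis
  obtain T2 where T2: "T2 > 0" "\<And>t. \<bar>t\<bar> \<ge> T2 \<Longrightarrow> g2 t = Complex \<gamma>2 t"
    using vertical_contour_bounds[OF g2] by metis
  show ?thesis
    using wn eventually_gt_at_top[of T1] eventually_gt_at_top[of T2] eventually_gt_at_top[of "\<bar>Re w\<bar>"]
  proof eventually_elim
    case (elim T)
    have T: "T > 0" using elim T1 by linarith
    have Im: "Im w = 0" using w by (simp add: complex_is_Real_iff)
    have ends: "g1 T = Complex \<gamma>1 T" "g1 (-T) = Complex \<gamma>1 (-T)" "g2 T = Complex \<gamma>2 T" "g2 (-T) = Complex \<gamma>2 (-T)"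
      using T1 T2 elim by auto
    have hor: "w \<notin> closed_segment (Complex a T) (Complex b T)" "w \<notin> closed_segment (Complex a (-T)) (Complex b (-T))" for a b
      using Im T by (auto simp: closed_segment_same_Im_Complex)
    have ver: "w \<notin> closed_segment (Complex (s*T) a) (Complex (s*T) b)" for a b
      using s elim by (auto simp: closed_segment_same_Re_Complex)
    have arcs: "w \<notin> path_image (truncation g1 T)" "w \<notin> path_image (truncation g2 T)"
      using w T by (auto simp: path_image_truncation)
    have paths [simp]: "path (truncation g1 T)" "path (truncation g2 T)"
      using valid_path_truncation[OF g1] valid_path_truncation[OF g2] valid_path_imp_path by auto
    let ?h = "\<lambda>a b y. winding_number (linepath (Complex a y) (Complex b y)) w"
    define V where "V = winding_number (linepath (Complex (s*T) T) (Complex (s*T) (-T))) w"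
    have c1: "winding_number (truncation g1 T) w + (?h \<gamma>1 (s*T) T + (V + ?h (s*T) \<gamma>1 (-T))) = 0"
      using elim(1) hor ver arcs ends unfolding closing_def V_def
      by (simp add: winding_number_join path_image_join truncation_ends)
    have c2: "winding_number (truncation g2 T) w + (?h \<gamma>2 (s*T) T + (V + ?h (s*T) \<gamma>2 (-T))) = 0"
      using elim(2) hor ver arcs ends unfolding closing_def V_def
      by (simp add: winding_number_join path_image_join truncation_ends)
    have h1: "?h \<gamma>1 (s*T) T = ?h \<gamma>1 \<gamma>2 T + ?h \<gamma>2 (s*T) T" using T Im by (intro winding_number_collinear) auto
    have h2: "?h (s*T) \<gamma>1 (-T) = ?h (s*T) \<gamma>2 (-T) + ?h \<gamma>2 \<gamma>1 (-T)" using T Im by (intro winding_number_collinear) auto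
    have "winding_number (contour_loop \<gamma>1 g1 \<gamma>2 g2 T) w = winding_number (truncation g1 T) w
        + (?h \<gamma>1 \<gamma>2 T + (- winding_number (truncation g2 T) w + ?h \<gamma>2 \<gamma>1 (-T)))"
      unfolding contour_loop_def using hor arcs ends
      by (simp add: winding_number_join path_image_join truncation_ends winding_number_reversepath)
    also have "\<dots> = (winding_number (truncation g1 T) w + (?h \<gamma>1 (s*T) T + (V + ?h (s*T) \<gamma>1 (-T))))
        - (winding_number (truncation g2 T) w + (?h \<gamma>2 (s*T) T + (V + ?h (s*T) \<gamma>2 (-T))))"
      unfolding h1 h2 by (simp add: algebra_simps)
    also have "\<dots> = 0" unfolding c1 c2 by simp
    finally show ?case .
  qed
qed

lemma finite_in_balls_imp_closed:
  fixes P :: "complex set"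
  assumes "\<And>r. finite (P \<inter> cball 0 r)"
  shows "closed P"
proof -
  have "\<not> x islimpt P" for x
  proof
    assume "x islimpt P"
    then have "infinite (P \<inter> ball x 1)" by (simp add: islimpt_eq_infinite_ball)
    moreover have "ball x 1 \<subseteq> cball 0 (norm x + 1)"
    proof
      fix y assume "y \<in> ball x 1"
      then show "y \<in> cball 0 (norm x + 1)"
        using norm_triangle_ineq2[of y x] by (simp add: dist_norm norm_minus_commute)
    qed
    then have "P \<inter> ball x 1 \<subseteq> P \<inter> cball 0 (norm x + 1)" by blast
    ultimately show False using assms finite_subset by blast
  qed
  then show ?thesis by (simp add: closed_limpt)
qed

lemma left_of_notin_range: "left_of g w \<Longrightarrow> w \<notin> range g"
  unfolding left_of_def by (meson ComplD connected_component_in eventually_happens trivial_limit_at_bot_linorder)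

lemma right_of_notin_range: "right_of g w \<Longrightarrow> w \<notin> range g"
  unfolding right_of_def by (meson ComplD connected_component_in eventually_happens trivial_limit_at_top_linorder)

lemma winding_number_contour_loop_left:
  assumes g1: "vertical_contour \<gamma>1 g1" and g2: "vertical_contour \<gamma>2 g2"
    and w: "w \<in> \<real>" and l: "left_of g1 w" "left_of g2 w"
  shows "\<forall>\<^sub>F T in at_top. winding_number (contour_loop \<gamma>1 g1 \<gamma>2 g2 T) w = 0"
proof -
  have wn: "\<forall>\<^sub>F T in at_top. winding_number (truncation g T +++ closing \<gamma> T (1 * T)) w = 0"
    if g: "vertical_contour \<gamma> g" and l: "left_of g w" for \<gamma> g
  proof -
    obtain T0 M where M: "\<And>t. \<bar>Re (g t)\<bar> \<le> M" using vertical_contour_bounds[OF g] by metis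
    have "\<forall>\<^sub>F x in at_bot. x < - M \<and> connected_component (- range g) w (of_real x)"
      using l unfolding left_of_def by (intro eventually_conj) (auto simp: eventually_at_bot_dense)
    then obtain x where x: "x < - M" "connected_component (- range g) w (of_real x)"
      using eventually_happens trivial_limit_at_bot_linorder by (metis (no_types, lifting))
    have side: "1 * x < 1 * Re (g t)" for t using M[of t] x(1) by linarith
    show ?thesis by (rule winding_number_closing_zero[OF g _ x(2) side]) simp
  qed
  show ?thesis
    by (rule winding_number_contour_loop[OF g1 g2 w _ _ _ wn wn])
       (use g1 g2 l left_of_notin_range in blast)+
qed

lemma winding_number_contour_loop_right:
  assumes g1: "vertical_contour \<gamma>1 g1" and g2: "vertical_contour \<gamma>2 g2"
    and w: "w \<in> \<real>" and l: "right_of g1 w" "right_of g2 w"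
  shows "\<forall>\<^sub>F T in at_top. winding_number (contour_loop \<gamma>1 g1 \<gamma>2 g2 T) w = 0"
proof -
  have wn: "\<forall>\<^sub>F T in at_top. winding_number (truncation g T +++ closing \<gamma> T (-1 * T)) w = 0"
    if g: "vertical_contour \<gamma> g" and l: "right_of g w" for \<gamma> g
  proof -
    obtain T0 M where M: "\<And>t. \<bar>Re (g t)\<bar> \<le> M" using vertical_contour_bounds[OF g] by metis
    have "\<forall>\<^sub>F x in at_top. x > M \<and> connected_component (- range g) w (of_real x)"
      using l unfolding right_of_def by (intro eventually_conj) (auto simp: eventually_at_top_dense)
    then obtain x where x: "x > M" "connected_component (- range g) w (of_real x)"
      using eventually_happens trivial_limit_at_top_linorder by (metis (no_types, lifting))
    have side: "-1 * x < -1 * Re (g t)" for t using M[of t] x(1) by linarith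
    show ?thesis by (rule winding_number_closing_zero[OF g _ x(2) side]) simp
  qed
  show ?thesis
    by (rule winding_number_contour_loop[OF g1 g2 w _ _ _ wn wn])
       (use g1 g2 l right_of_notin_range in blast)+
qed

text \<open>
  The conclusion is about truncated integrals because it will also be applied to a function with a
  term of order \<open>1 / s\<close>, whose integral converges only conditionally. The winding number about a
  given pole is known to vanish only for \<open>T\<close> beyond a bound that depends on the pole. This suffices
  because all but finitely many poles lie outside of the vertical strip which contains both contours,
  and about these the winding number is zero for every \<open>T\<close>.
\<close>
theorem contour_shift:
  assumes g1: "vertical_contour \<gamma>1 g1" and g2: "vertical_contour \<gamma>2 g2"
    and real: "PL \<union> PR \<subseteq> \<real>" and fin: "\<And>r. finite ((PL \<union> PR) \<inter> cball 0 r)"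
    and left: "\<And>w. w \<in> PL \<Longrightarrow> left_of g1 w \<and> left_of g2 w"
    and right: "\<And>w. w \<in> PR \<Longrightarrow> right_of g1 w \<and> right_of g2 w"
    and hol: "f holomorphic_on - (PL \<union> PR)"
    and decay: "\<And>\<epsilon>. \<epsilon> > 0 \<Longrightarrow> \<forall>\<^sub>F T in at_top. \<forall>\<sigma>\<in>closed_segment \<gamma>1 \<gamma>2.
       norm (f (Complex \<sigma> T)) \<le> \<epsilon> \<and> norm (f (Complex \<sigma> (-T))) \<le> \<epsilon>"
  shows "((\<lambda>T. integral {-T..T} (\<lambda>t. f (g1 t) * vector_derivative g1 (at t))
             - integral {-T..T} (\<lambda>t. f (g2 t) * vector_derivative g2 (at t))) \<longlongrightarrow> 0) at_top"
proof -
  let ?P = "PL \<union> PR" and ?I = "\<lambda>g T. integral {-T..T} (\<lambda>t. f (g t) * vector_derivative g (at t))"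
  obtain T1 M1 where T1: "T1 > 0" "\<bar>\<gamma>1\<bar> \<le> M1" "\<And>t. \<bar>t\<bar> \<ge> T1 \<Longrightarrow> g1 t = Complex \<gamma>1 t" "\<And>t. \<bar>Re (g1 t)\<bar> \<le> M1"
    using vertical_contour_bounds[OF g1] by metis
  obtain T2 M2 where T2: "T2 > 0" "\<bar>\<gamma>2\<bar> \<le> M2" "\<And>t. \<bar>t\<bar> \<ge> T2 \<Longrightarrow> g2 t = Complex \<gamma>2 t" "\<And>t. \<bar>Re (g2 t)\<bar> \<le> M2"
    using vertical_contour_bounds[OF g2] by metis
  define M where "M = max M1 M2"
  have M: "\<bar>\<gamma>1\<bar> \<le> M" "\<bar>\<gamma>2\<bar> \<le> M" "\<And>t. \<bar>Re (g1 t)\<bar> \<le> M" "\<And>t. \<bar>Re (g2 t)\<bar> \<le> M"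
    using T1 T2 by (auto simp: M_def max.coboundedI1 max.coboundedI2)
  have U: "open (- ?P)" using open_Compl[OF finite_in_balls_imp_closed[OF fin]] .
  \<comment> \<open>only the finitely many poles in the strip \<open>\<bar>Re z\<bar> \<le> M\<close> impose a condition on \<open>T\<close>\<close>
  have wn: "\<forall>\<^sub>F T in at_top. \<forall>w\<in>?P \<inter> cball 0 M. winding_number (contour_loop \<gamma>1 g1 \<gamma>2 g2 T) w = 0"
    using fin[of M] real left right
    by (intro eventually_ball_finite ballI)
       (blast intro: winding_number_contour_loop_left[OF g1 g2] winding_number_contour_loop_right[OF g1 g2])+
  have close: "\<forall>\<^sub>F T in at_top. norm (?I g1 T - ?I g2 T) \<le> 2 * \<epsilon> * \<bar>\<gamma>2 - \<gamma>1\<bar>" if "\<epsilon> > 0" for \<epsilon>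
    using wn decay[OF that] eventually_gt_at_top[of T1] eventually_gt_at_top[of T2]
  proof eventually_elim
    case (elim T)
    have T: "T > 0" using elim T1 by linarith
    have ends: "g1 T = Complex \<gamma>1 T" "g1 (-T) = Complex \<gamma>1 (-T)" "g2 T = Complex \<gamma>2 T" "g2 (-T) = Complex \<gamma>2 (-T)"
      using T1 T2 elim by auto
    have vp [simp]: "valid_path (truncation g1 T)" "valid_path (truncation g2 T)"
      using valid_path_truncation[OF g1] valid_path_truncation[OF g2] by auto
    define C where "C = contour_loop \<gamma>1 g1 \<gamma>2 g2 T"
    have vC: "valid_path C" and loop: "pathfinish C = pathstart C"
      unfolding C_def contour_loop_def using ends
      by (auto intro!: valid_path_join valid_path_imp_reverse simp: truncation_ends)
    let ?top = "closed_segment (Complex \<gamma>1 T) (Complex \<gamma>2 T)"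
    let ?bot = "closed_segment (Complex \<gamma>2 (-T)) (Complex \<gamma>1 (-T))"
    have iC: "path_image C = g1 ` {-T..T} \<union> ?top \<union> g2 ` {-T..T} \<union> ?bot"
      unfolding C_def contour_loop_def using ends T
      by (simp add: path_image_join truncation_ends path_image_truncation Un_assoc)
    have range: "range g1 \<subseteq> - ?P" "range g2 \<subseteq> - ?P"
      using left right left_of_notin_range right_of_notin_range by blast+
    have "?top \<inter> \<real> = {}" "?bot \<inter> \<real> = {}"
      using T by (auto simp: closed_segment_same_Im_Complex complex_is_Real_iff)
    then have hor: "?top \<subseteq> - ?P" "?bot \<subseteq> - ?P" using real by blast+
    have CP: "path_image C \<subseteq> - ?P" unfolding iC using range hor by blast
    \<comment> \<open>the strip contains the loop, which therefore does not wind around the remaining poles\<close>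
    have cv: "convex {z. \<bar>Re z\<bar> \<le> M}"
    proof -
      have eq: "{z. \<bar>Re z\<bar> \<le> M} = {z. inner 1 z \<le> M} \<inter> {z. inner 1 z \<ge> - M}"
        by (auto simp: inner_complex_def)
      show ?thesis unfolding eq by (intro convex_Int convex_halfspace_le convex_halfspace_ge)
    qed
    have CM: "path_image C \<subseteq> {z. \<bar>Re z\<bar> \<le> M}"
      unfolding iC using M by (intro Un_least closed_segment_subset cv) auto
    have zero: "winding_number C w = 0" if "w \<notin> - ?P" for w
    proof (cases "w \<in> cball 0 M")
      case True
      then show ?thesis using elim(1) that unfolding C_def by auto
    next
      case False
      have "Im w = 0" using that real by (auto simp: complex_is_Real_iff)
      then have "norm w = \<bar>Re w\<bar>" by (simp add: cmod_eq_Re)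
      then have "w \<notin> {z. \<bar>Re z\<bar> \<le> M}" using False by simp
      then show ?thesis
        using winding_number_zero_outside[OF valid_path_imp_path[OF vC] cv loop _ CM] by blast
    qed
    have int: "f contour_integrable_on p" if "valid_path p" "path_image p \<subseteq> - ?P" for p
      using contour_integrable_holomorphic_simple[OF hol U that] .
    have i1: "f contour_integrable_on truncation g1 T" "f contour_integrable_on truncation g2 T"
      using range T by (intro int vp; simp add: path_image_truncation image_subset_iff; blast)+
    have i2: "f contour_integrable_on linepath (Complex \<gamma>1 T) (Complex \<gamma>2 T)"
        "f contour_integrable_on linepath (Complex \<gamma>2 (-T)) (Complex \<gamma>1 (-T))"
      using hor by (intro int; simp)+
    let ?t = "contour_integral (linepath (Complex \<gamma>1 T) (Complex \<gamma>2 T)) f"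
    let ?b = "contour_integral (linepath (Complex \<gamma>2 (-T)) (Complex \<gamma>1 (-T))) f"
    have "0 = contour_integral C f"
      using Cauchy_theorem_global[OF U hol vC loop CP zero] contour_integral_unique by metis
    also have "\<dots> = contour_integral (truncation g1 T) f + (?t + (- contour_integral (truncation g2 T) f + ?b))"
      unfolding C_def contour_loop_def using i1 i2 ends
      by (simp add: truncation_ends valid_path_imp_reverse contour_integrable_reversepath contour_integral_reversepath)
    also have "\<dots> = ?I g1 T - ?I g2 T + (?t + ?b)"
      using contour_integral_truncation[OF g1 T i1(1)] contour_integral_truncation[OF g2 T i1(2)] by simp
    finally have "?I g1 T - ?I g2 T = - (?t + ?b)" by (subst eq_neg_iff_add_eq_0) (rule sym)
    then have "norm (?I g1 T - ?I g2 T) \<le> norm ?t + norm ?b"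
      by (simp only: norm_minus_cancel norm_triangle_ineq)
    also have "norm ?t \<le> \<epsilon> * norm (Complex \<gamma>2 T - Complex \<gamma>1 T)"
    proof (rule has_contour_integral_bound_linepath[OF has_contour_integral_integral[OF i2(1)]])
      fix z assume "z \<in> ?top"
      then have "z = Complex (Re z) T" "Re z \<in> closed_segment \<gamma>1 \<gamma>2"
        by (auto simp: closed_segment_same_Im_Complex complex_eq_iff)
      then show "norm (f z) \<le> \<epsilon>" using elim(2) by metis
    qed (use that in auto)
    also have "norm ?b \<le> \<epsilon> * norm (Complex \<gamma>1 (-T) - Complex \<gamma>2 (-T))"
    proof (rule has_contour_integral_bound_linepath[OF has_contour_integral_integral[OF i2(2)]])
      fix z assume "z \<in> ?bot"
      then have "z = Complex (Re z) (-T)" "Re z \<in> closed_segment \<gamma>1 \<gamma>2"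
        by (auto simp: closed_segment_same_Im_Complex complex_eq_iff closed_segment_commute)
      then show "norm (f z) \<le> \<epsilon>" using elim(2) by metis
    qed (use that in auto)
    also have "norm (Complex \<gamma>2 T - Complex \<gamma>1 T) = \<bar>\<gamma>2 - \<gamma>1\<bar>" by (simp add: cmod_def)
    also have "norm (Complex \<gamma>1 (-T) - Complex \<gamma>2 (-T)) = \<bar>\<gamma>2 - \<gamma>1\<bar>" by (simp add: cmod_def)
    finally show ?case by simp
  qed
  show ?thesis
  proof (rule tendstoI)
    fix e :: real assume e: "e > 0"
    define D where "D = 2 * \<bar>\<gamma>2 - \<gamma>1\<bar> + 1"
    define \<epsilon> where "\<epsilon> = e / (2 * D)"
    have D: "D > 0" unfolding D_def by (intro add_nonneg_pos mult_nonneg_nonneg) auto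
    have "2 * \<epsilon> * D = e" using D by (simp add: \<epsilon>_def)
    then have sum: "(2 * \<epsilon> * \<bar>\<gamma>2 - \<gamma>1\<bar>) * 2 + 2 * \<epsilon> = e" unfolding D_def by (simp add: algebra_simps)
    have "\<epsilon> > 0" using e D by (simp add: \<epsilon>_def)
    moreover have "2 * \<epsilon> * \<bar>\<gamma>2 - \<gamma>1\<bar> \<ge> 0" using \<open>\<epsilon> > 0\<close> by simp
    moreover have "y < z" if "y * 2 + 2 * \<epsilon> = z" "\<epsilon> > 0" "y \<ge> 0" for y z :: real using that by linarith
    ultimately have lt: "2 * \<epsilon> * \<bar>\<gamma>2 - \<gamma>1\<bar> < e" using sum by blast
    show "\<forall>\<^sub>F T in at_top. dist (?I g1 T - ?I g2 T) 0 < e"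
      using close[OF \<open>\<epsilon> > 0\<close>] by eventually_elim (rule le_less_trans[OF _ lt], simp add: dist_norm)
  qed
qed

section \<open>Contour independence of Mellin-Barnes integrals\<close>

lemma vertical_contour_derivative_tail:
  assumes "\<And>t. \<bar>t\<bar> \<ge> T0 \<Longrightarrow> g t = Complex \<gamma> t" and "\<bar>t\<bar> > T0"
  shows "vector_derivative g (at t) = \<i>"
proof (rule vector_derivative_at)
  have "((\<lambda>t. of_real \<gamma> + of_real t * \<i>) has_vector_derivative \<i>) (at t)"
    by (auto intro!: derivative_eq_intros has_vector_derivative_real_field)
  then show "(g has_vector_derivative \<i>) (at t)"
  proof (rule has_vector_derivative_transform_within_open)
    show "open {t. \<bar>t\<bar> > T0}" by (intro open_Collect_less continuous_intros)
    show "of_real \<gamma> + of_real s * \<i> = g s" if "s \<in> {t. \<bar>t\<bar> > T0}" for s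
      using assms(1)[of s] that by (simp add: complex_eq_iff)
  qed (use assms(2) in auto)
qed

lemma vertical_growth_bounds:
  assumes "vertical_growth f e u v"
  obtains C T0 where "T0 \<ge> 1"
    "\<And>\<sigma> t. \<bar>\<sigma>\<bar> \<le> R \<Longrightarrow> \<bar>t\<bar> \<ge> T0 \<Longrightarrow>
       norm (f (Complex \<sigma> t)) \<le> exp (C + ((u + v * \<sigma>) * ln \<bar>t\<bar> - e * pi / 2 * \<bar>t\<bar>))"
    "\<And>\<sigma> t. \<bar>\<sigma>\<bar> \<le> R \<Longrightarrow> \<bar>t\<bar> \<ge> T0 \<Longrightarrow>
       exp ((u + v * \<sigma>) * ln \<bar>t\<bar> - e * pi / 2 * \<bar>t\<bar> - C) \<le> norm (f (Complex \<sigma> t))"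
proof -
  obtain C T0 where T0: "T0 > 0" and nz: "\<And>\<sigma> t. \<bar>\<sigma>\<bar> \<le> R \<Longrightarrow> \<bar>t\<bar> \<ge> T0 \<Longrightarrow> f (Complex \<sigma> t) \<noteq> 0"
    and bd: "\<And>\<sigma> t. \<bar>\<sigma>\<bar> \<le> R \<Longrightarrow> \<bar>t\<bar> \<ge> T0 \<Longrightarrow>
      \<bar>ln (norm (f (Complex \<sigma> t))) - ((u + v * \<sigma>) * ln \<bar>t\<bar> - e * pi / 2 * \<bar>t\<bar>)\<bar> \<le> C"
    using vertical_growthE[OF assms, of R] by metis
  show ?thesis
  proof (rule that[of "max 1 T0" C])
    fix \<sigma> t assume "\<bar>\<sigma>\<bar> \<le> R" "max 1 T0 \<le> \<bar>t\<bar>"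
    then have t: "\<bar>\<sigma>\<bar> \<le> R" "T0 \<le> \<bar>t\<bar>" by auto
    have eq: "norm (f (Complex \<sigma> t)) = exp (ln (norm (f (Complex \<sigma> t))))" using nz[OF t] by simp
    show "norm (f (Complex \<sigma> t)) \<le> exp (C + ((u + v * \<sigma>) * ln \<bar>t\<bar> - e * pi / 2 * \<bar>t\<bar>))"
      using bd[OF t] by (subst eq, subst exp_le_cancel_iff) linarith
    show "exp ((u + v * \<sigma>) * ln \<bar>t\<bar> - e * pi / 2 * \<bar>t\<bar> - C) \<le> norm (f (Complex \<sigma> t))"
      using bd[OF t] by (subst eq, subst exp_le_cancel_iff) linarith
  qed simp
qed

lemma norm_of_real_powr_minus:
  assumes "x > 0"
  shows "norm (of_real x powr (- s)) = exp (- Re s * ln x)"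
  using norm_powr_real[of "of_real x" "- s"] assms by simp

lemma closed_segment_bounds:
  fixes a b \<sigma> u v :: real
  assumes "\<sigma> \<in> closed_segment a b"
  shows "\<bar>\<sigma>\<bar> \<le> max \<bar>a\<bar> \<bar>b\<bar>" and "u + v * \<sigma> \<le> max (u + v * a) (u + v * b)"
proof -
  show "\<bar>\<sigma>\<bar> \<le> max \<bar>a\<bar> \<bar>b\<bar>" using assms by (auto simp: closed_segment_eq_real_ivl split: if_splits)
  from assms obtain l where l: "0 \<le> l" "l \<le> 1" "\<sigma> = (1 - l) * a + l * b" by (auto simp: closed_segment_def)
  have "u + v * \<sigma> = (1 - l) * (u + v * a) + l * (u + v * b)" unfolding l(3) by (simp add: algebra_simps)
  also have "\<dots> \<le> (1 - l) * max (u + v * a) (u + v * b) + l * max (u + v * a) (u + v * b)"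
    using l by (intro add_mono mult_left_mono) auto
  also have "\<dots> = max (u + v * a) (u + v * b)" by (simp add: algebra_simps)
  finally show "u + v * \<sigma> \<le> max (u + v * a) (u + v * b)" .
qed

text \<open>
  The factor \<open>x powr (- s)\<close> is bounded on vertical strips. If \<open>e = 0\<close>, then negative exponents at both
  ends of the segment suffice, since the exponent is affine in \<open>\<sigma>\<close>.
\<close>
lemma vertical_growth_decay:
  assumes f: "vertical_growth f e u v"
    and e: "e > 0 \<or> e = 0 \<and> u + v * \<gamma>1 < 0 \<and> u + v * \<gamma>2 < 0" and x: "x > 0" and \<epsilon>: "\<epsilon> > (0::real)"
  shows "\<forall>\<^sub>F T in at_top. \<forall>\<sigma>\<in>closed_segment \<gamma>1 \<gamma>2.
     norm (f (Complex \<sigma> T) * of_real x powr (- Complex \<sigma> T)) \<le> \<epsilon> \<and>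
     norm (f (Complex \<sigma> (-T)) * of_real x powr (- Complex \<sigma> (-T))) \<le> \<epsilon>"
proof -
  define R where "R = max \<bar>\<gamma>1\<bar> \<bar>\<gamma>2\<bar>"
  define m where "m = max (u + v * \<gamma>1) (u + v * \<gamma>2)"
  obtain C T0 where T0: "T0 \<ge> 1" and bd: "\<And>\<sigma> t. \<bar>\<sigma>\<bar> \<le> R \<Longrightarrow> \<bar>t\<bar> \<ge> T0 \<Longrightarrow>
       norm (f (Complex \<sigma> t)) \<le> exp (C + ((u + v * \<sigma>) * ln \<bar>t\<bar> - e * pi / 2 * \<bar>t\<bar>))"
    using vertical_growth_bounds[OF f, of R] by metis
  have lim: "((\<lambda>T. exp (C + (m * ln T - e * pi / 2 * T)) * exp (R * \<bar>ln x\<bar>)) \<longlongrightarrow> 0) at_top"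
  proof (cases "e > 0")
    case True
    define c where "c = e * pi / 2"
    have "c > 0" using True by (simp add: c_def)
    show ?thesis unfolding c_def[symmetric] using \<open>c > 0\<close> by real_asymp
  next
    case False
    then have "e = 0" "m < 0" using e by (auto simp: m_def)
    then show ?thesis using \<open>m < 0\<close> by simp real_asymp
  qed
  have bound: "norm (f (Complex \<sigma> t) * of_real x powr (- Complex \<sigma> t))
      \<le> exp (C + (m * ln \<bar>t\<bar> - e * pi / 2 * \<bar>t\<bar>)) * exp (R * \<bar>ln x\<bar>)"
    if \<sigma>: "\<sigma> \<in> closed_segment \<gamma>1 \<gamma>2" and t: "\<bar>t\<bar> \<ge> T0" for \<sigma> t
  proof -
    have s: "\<bar>\<sigma>\<bar> \<le> R" "u + v * \<sigma> \<le> m" using closed_segment_bounds[OF \<sigma>] by (auto simp: R_def m_def)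
    have "norm (f (Complex \<sigma> t)) \<le> exp (C + ((u + v * \<sigma>) * ln \<bar>t\<bar> - e * pi / 2 * \<bar>t\<bar>))"
      by (rule bd[OF s(1) t])
    also have "\<dots> \<le> exp (C + (m * ln \<bar>t\<bar> - e * pi / 2 * \<bar>t\<bar>))"
      using mult_right_mono[OF s(2), of "ln \<bar>t\<bar>"] t T0 by auto
    finally have 1: "norm (f (Complex \<sigma> t)) \<le> exp (C + (m * ln \<bar>t\<bar> - e * pi / 2 * \<bar>t\<bar>))" .
    have "- \<sigma> * ln x \<le> \<bar>\<sigma> * ln x\<bar>" by linarith
    also have "\<dots> \<le> R * \<bar>ln x\<bar>" unfolding abs_mult using s(1) by (intro mult_right_mono) auto
    finally have 2: "norm (of_real x powr (- Complex \<sigma> t)) \<le> exp (R * \<bar>ln x\<bar>)"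
      unfolding norm_of_real_powr_minus[OF x] by simp
    show ?thesis unfolding norm_mult by (intro mult_mono 1 2) auto
  qed
  show ?thesis
    using order_tendstoD(2)[OF lim \<epsilon>] eventually_ge_at_top[of T0]
  proof eventually_elim
    case (elim T)
    have T: "\<bar>T\<bar> = T" "\<bar>-T\<bar> = T" using T0 elim by auto
    show ?case
    proof (intro ballI conjI)
      fix \<sigma> assume \<sigma>: "\<sigma> \<in> closed_segment \<gamma>1 \<gamma>2"
      show "norm (f (Complex \<sigma> T) * of_real x powr (- Complex \<sigma> T)) \<le> \<epsilon>"
        using bound[OF \<sigma>, of T] elim unfolding T by linarith
      show "norm (f (Complex \<sigma> (-T)) * of_real x powr (- Complex \<sigma> (-T))) \<le> \<epsilon>"
        using bound[OF \<sigma>, of "-T"] elim unfolding T by linarith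
    qed
  qed
qed

lemma integrable_powr_tail:
  assumes "p < -1" and "T > (0::real)"
  shows "integrable lborel (\<lambda>t. indicator {T..} t * t powr p)"
proof (rule integrableI_nonneg)
  have "(\<integral>\<^sup>+ t. ennreal (t powr p) * indicator {T..} t \<partial>lborel) = 0 - T powr (p + 1) / (p + 1)"
  proof (rule nn_integral_FTC_atLeast)
    show "((\<lambda>t. t powr (p + 1) / (p + 1)) has_real_derivative t powr p) (at t)" if "T \<le> t" for t
      using that assms by (auto intro!: derivative_eq_intros)
    have "p + 1 < 0" using assms by simp
    then show "((\<lambda>t. t powr (p + 1) / (p + 1)) \<longlongrightarrow> 0) at_top"
      by real_asymp
  qed auto
  also have "(\<integral>\<^sup>+ t. ennreal (t powr p) * indicator {T..} t \<partial>lborel)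
      = (\<integral>\<^sup>+ t. ennreal (indicator {T..} t * t powr p) \<partial>lborel)"
    by (intro nn_integral_cong) (auto simp: indicator_def)
  finally show "(\<integral>\<^sup>+ t. ennreal (indicator {T..} t * t powr p) \<partial>lborel) < \<infinity>" by simp
qed auto

lemma vertical_growth_integrable:
  fixes F :: "real \<Rightarrow> complex"
  assumes f: "vertical_growth f e u v" and e: "e > 0 \<or> e = 0 \<and> u + v * \<gamma> < -1"
    and cont: "continuous_on UNIV F"
    and bound: "\<And>t. \<bar>t\<bar> \<ge> T1 \<Longrightarrow> norm (F t) \<le> B * norm (f (Complex \<gamma> t))"
  shows "integrable lborel F"
proof -
  obtain C T0 where T0: "T0 \<ge> 1" and bd: "\<And>t. \<bar>t\<bar> \<ge> T0 \<Longrightarrow>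
       norm (f (Complex \<gamma> t)) \<le> exp (C + ((u + v * \<gamma>) * ln \<bar>t\<bar> - e * pi / 2 * \<bar>t\<bar>))"
    using vertical_growth_bounds[OF f, of "\<bar>\<gamma>\<bar>"] by (metis order_refl)
  obtain p where p: "p < -1" "\<forall>\<^sub>F T in at_top. (u + v * \<gamma>) * ln T - e * pi / 2 * T \<le> p * ln T"
  proof (cases "e > 0")
    case True
    define c where "c = e * pi / 2"
    have "c > 0" using True by (simp add: c_def)
    \<comment> \<open>exponential decay beats any power; \<open>-2\<close> is an arbitrary integrable exponent\<close>
    then have "\<forall>\<^sub>F T in at_top. (u + v * \<gamma>) * ln T - c * T \<le> (-2) * ln T" by real_asymp
    then show ?thesis using that[of "-2"] by (simp add: c_def)
  next
    case False
    then show ?thesis using e by (intro that[of "u + v * \<gamma>"]) auto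
  qed
  then obtain T2 where T2: "\<And>T. T \<ge> T2 \<Longrightarrow> (u + v * \<gamma>) * ln T - e * pi / 2 * T \<le> p * ln T"
    unfolding eventually_at_top_linorder by blast
  define T where "T = max 1 (max T0 (max T1 T2))"
  define B' where "B' = max 0 B"
  have T: "T \<ge> 1" "T \<ge> T0" "T \<ge> T1" "T \<ge> T2" by (auto simp: T_def)
  define G where "G = (\<lambda>t. indicator {T..} t * t powr p :: real)"
  have tail: "norm (F t) \<le> B' * exp C * (\<bar>t\<bar> powr p)" if "\<bar>t\<bar> \<ge> T" for t
  proof -
    have "norm (F t) \<le> B' * norm (f (Complex \<gamma> t))"
      using bound[of t] that T unfolding B'_def by (smt (verit) mult_right_mono norm_ge_zero)
    also have "norm (f (Complex \<gamma> t)) \<le> exp (C + ((u + v * \<gamma>) * ln \<bar>t\<bar> - e * pi / 2 * \<bar>t\<bar>))"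
      using bd[of t] that T by auto
    also have "\<dots> \<le> exp (C + p * ln \<bar>t\<bar>)" using T2[of "\<bar>t\<bar>"] that T by auto
    also have "\<dots> = exp C * \<bar>t\<bar> powr p" using that T by (auto simp: exp_add powr_def)
    finally show ?thesis by (simp add: B'_def mult_left_mono mult.assoc)
  qed
  have G: "integrable lborel G" unfolding G_def using T p by (intro integrable_powr_tail) auto
  have G': "integrable lborel (\<lambda>t. G (0 + (-1) * t))"
    by (intro lborel_integrable_real_affine G) simp
  have mid: "integrable lborel (\<lambda>t. indicator {-T..T} t *\<^sub>R F t)"
    using borel_integrable_compact[of "{-T..T}" F] continuous_on_subset[OF cont]
    by (auto simp: set_integrable_def)
  have "integrable lborel (\<lambda>t. norm (indicator {-T..T} t *\<^sub>R F t) + B' * exp C * (G t + G (0 + (-1) * t)))"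
    by (intro Bochner_Integration.integrable_add integrable_mult_right integrable_norm mid G G')
  then show ?thesis
  proof (rule Bochner_Integration.integrable_bound)
    show "F \<in> borel_measurable lborel" using borel_measurable_continuous_onI[OF cont] by simp
    have Gnn: "G t \<ge> 0" for t by (simp add: G_def)
    have B'nn: "B' * exp C \<ge> 0" by (simp add: B'_def)
    show "AE t in lborel. norm (F t) \<le> norm (norm (indicator {-T..T} t *\<^sub>R F t) + B' * exp C * (G t + G (0 + (-1) * t)))"
    proof (rule AE_I2)
      fix t
      have nn: "0 \<le> B' * exp C * (G t + G (0 + (-1) * t))" using Gnn B'nn by simp
      show "norm (F t) \<le> norm (norm (indicator {-T..T} t *\<^sub>R F t) + B' * exp C * (G t + G (0 + (-1) * t)))"
      proof (cases "\<bar>t\<bar> \<ge> T")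
        case True
        then have "\<bar>t\<bar> powr p \<le> G t + G (0 + (-1) * t)"
          using T by (auto simp: G_def indicator_def abs_if)
        then have "norm (F t) \<le> B' * exp C * (G t + G (0 + (-1) * t))"
          using tail[OF True] mult_left_mono[OF _ B'nn] by fastforce
        then show ?thesis using nn norm_ge_zero[of "indicator {-T..T} t *\<^sub>R F t"] by (simp only: real_norm_def)
      next
        case False
        then have "t \<in> {-T..T}" by auto
        then show ?thesis using nn by simp
      qed
    qed
  qed
qed

lemma integrable_not_bounded_below:
  fixes F :: "real \<Rightarrow> complex"
  assumes F: "integrable lborel F" and c: "c > 0" and lower: "\<And>t. t \<ge> T \<Longrightarrow> norm (F t) \<ge> c"
  shows False
proof -
  have "(\<integral>\<^sup>+ t. ennreal c * indicator {T..} t \<partial>lborel) \<le> (\<integral>\<^sup>+ t. ennreal (norm (F t)) \<partial>lborel)"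
    using lower by (intro nn_integral_mono) (auto simp: indicator_def intro!: ennreal_leI)
  also have "\<dots> < \<infinity>" using F by (simp add: integrable_iff_bounded)
  also have "(\<integral>\<^sup>+ t. ennreal c * indicator {T..} t \<partial>lborel) = \<infinity>"
  proof -
    have "ennreal (real n) \<le> emeasure lborel {T..}" for n
      using emeasure_mono[of "{T..T + real n}" "{T..}" lborel] by (simp add: subset_iff)
    then have "\<not> emeasure lborel {T..} < of_nat n" for n
      by (simp add: ennreal_of_nat_eq_real_of_nat not_less)
    then have "emeasure lborel {T..} = \<infinity>"
      using ennreal_Ex_less_of_nat[of "emeasure lborel {T..}"] top.not_eq_extremum by auto
    then show ?thesis using c by (simp add: nn_integral_cmult_indicator ennreal_mult_eq_top_iff)
  qed
  finally show False by simp
qed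

lemma integral_truncated_tendsto:
  fixes F :: "real \<Rightarrow> complex"
  assumes F: "integrable lborel F"
  shows "((\<lambda>T. integral {-T..T} F) \<longlongrightarrow> (LINT t|lborel. F t)) at_top"
proof -
  have "((\<lambda>T. LINT t|lborel. indicator {-T..T} t *\<^sub>R F t) \<longlongrightarrow> (LINT t|lborel. F t)) at_top"
  proof (rule integral_dominated_convergence_at_top[where w="\<lambda>t. norm (F t)"])
    show "AE t in lborel. ((\<lambda>T. indicator {-T..T} t *\<^sub>R F t) \<longlongrightarrow> F t) at_top"
    proof (rule AE_I2, rule tendsto_eventually)
      fix t show "\<forall>\<^sub>F T in at_top. indicator {-T..T} t *\<^sub>R F t = F t"
        using eventually_ge_at_top[of "\<bar>t\<bar>"] by eventually_elim (auto simp: indicator_def)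
    qed
  qed (use F in \<open>auto simp: indicator_def intro!: always_eventually\<close>)
  moreover have "(LINT t|lborel. indicator {-T..T} t *\<^sub>R F t) = integral {-T..T} F" for T
  proof -
    have "set_integrable lborel {-T..T} F"
      unfolding set_integrable_def using F by (intro integrable_mult_indicator) auto
    from set_borel_integral_eq_integral(2)[OF this] show ?thesis by (simp add: set_lebesgue_integral_def)
  qed
  ultimately show ?thesis by simp
qed

text \<open>
  Absolute convergence along a contour forces the kernel to decay on its vertical ends; here the lower
  bound contained in \<open>vertical_growth\<close> is used. This is what makes the horizontal segments between
  two contours negligible when \<open>e = 0\<close>.
\<close>
lemma vertical_growth_integrable_exponent:
  assumes f: "vertical_growth f e u v" and e: "e \<ge> 0" and g: "vertical_contour \<gamma> g" and x: "x > 0"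
    and int: "integrable lborel (\<lambda>t. f (g t) * of_real x powr (- g t) * vector_derivative g (at t))"
  shows "e > 0 \<or> e = 0 \<and> u + v * \<gamma> < 0"
proof (rule ccontr)
  assume "\<not> ?thesis"
  then have e0: "e = 0" and ex: "u + v * \<gamma> \<ge> 0" using e by auto
  obtain C T0 where T0: "T0 \<ge> 1" and bd: "\<And>t. \<bar>t\<bar> \<ge> T0 \<Longrightarrow>
       exp ((u + v * \<gamma>) * ln \<bar>t\<bar> - e * pi / 2 * \<bar>t\<bar> - C) \<le> norm (f (Complex \<gamma> t))"
    using vertical_growth_bounds[OF f, of "\<bar>\<gamma>\<bar>"] by (metis order_refl)
  obtain T1 M where T1: "\<And>t. \<bar>t\<bar> \<ge> T1 \<Longrightarrow> g t = Complex \<gamma> t"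
    using vertical_contour_bounds[OF g] by metis
  show False
  proof (rule integrable_not_bounded_below[OF int])
    show "exp (- C) * exp (- \<gamma> * ln x) > 0" by simp
    fix t assume "t \<ge> max T0 (T1 + 1)"
    then have t: "t \<ge> T0" "t > T1" "t \<ge> 1" using T0 by auto
    have "g t = Complex \<gamma> t" "vector_derivative g (at t) = \<i>"
      using T1[of t] vertical_contour_derivative_tail[where t=t, OF T1] t by auto
    moreover have "exp (- C) \<le> norm (f (Complex \<gamma> t))"
    proof -
      have "exp (- C) \<le> exp ((u + v * \<gamma>) * ln \<bar>t\<bar> - e * pi / 2 * \<bar>t\<bar> - C)" using e0 ex t by simp
      then show ?thesis using order_trans[OF _ bd[of t]] t by simp
    qed
    ultimately show "exp (- C) * exp (- \<gamma> * ln x) \<le> norm (f (g t) * of_real x powr (- g t) * vector_derivative g (at t))"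
      by (simp add: norm_mult norm_of_real_powr_minus[OF x])
  qed
qed

theorem Mellin_Barnes_contour_independent:
  assumes g1: "vertical_contour \<gamma>1 g1" and g2: "vertical_contour \<gamma>2 g2"
    and real: "PL \<union> PR \<subseteq> \<real>" and fin: "\<And>r. finite ((PL \<union> PR) \<inter> cball 0 r)"
    and left: "\<And>w. w \<in> PL \<Longrightarrow> left_of g1 w \<and> left_of g2 w"
    and right: "\<And>w. w \<in> PR \<Longrightarrow> right_of g1 w \<and> right_of g2 w"
    and hol: "f holomorphic_on - (PL \<union> PR)"
    and growth: "vertical_growth f e u v" and e: "e \<ge> 0" and x: "x > 0"
    and int1: "integrable lborel (\<lambda>t. f (g1 t) * of_real x powr (- g1 t) * vector_derivative g1 (at t))"
    and int2: "integrable lborel (\<lambda>t. f (g2 t) * of_real x powr (- g2 t) * vector_derivative g2 (at t))"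
  shows "(LINT t|lborel. f (g1 t) * of_real x powr (- g1 t) * vector_derivative g1 (at t)) =
    (LINT t|lborel. f (g2 t) * of_real x powr (- g2 t) * vector_derivative g2 (at t))"
proof -
  define h where "h = (\<lambda>s. f s * of_real x powr (- s))"
  have "h holomorphic_on - (PL \<union> PR)"
    unfolding h_def using x by (intro holomorphic_intros hol) auto
  moreover have ex: "e > 0 \<or> e = 0 \<and> u + v * \<gamma>1 < 0 \<and> u + v * \<gamma>2 < 0"
    using vertical_growth_integrable_exponent[OF growth e g1 x int1]
      vertical_growth_integrable_exponent[OF growth e g2 x int2] by blast
  ultimately have lim0: "((\<lambda>T. integral {-T..T} (\<lambda>t. h (g1 t) * vector_derivative g1 (at t))
             - integral {-T..T} (\<lambda>t. h (g2 t) * vector_derivative g2 (at t))) \<longlongrightarrow> 0) at_top"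
    using vertical_growth_decay[OF growth ex x]
    by (intro contour_shift[OF g1 g2 real fin left right]) (auto simp: h_def)
  have lim1: "((\<lambda>T. integral {-T..T} (\<lambda>t. h (g1 t) * vector_derivative g1 (at t))
             - integral {-T..T} (\<lambda>t. h (g2 t) * vector_derivative g2 (at t))) \<longlongrightarrow>
         (LINT t|lborel. h (g1 t) * vector_derivative g1 (at t)) - (LINT t|lborel. h (g2 t) * vector_derivative g2 (at t))) at_top"
    using int1 int2 unfolding h_def by (intro tendsto_diff integral_truncated_tendsto)
  have "(LINT t|lborel. h (g1 t) * vector_derivative g1 (at t)) - (LINT t|lborel. h (g2 t) * vector_derivative g2 (at t)) = 0"
    by (rule tendsto_unique[OF trivial_limit_at_top_linorder lim1 lim0])
  then show ?thesis by (simp add: h_def)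
qed

section \<open>Fox-H functions on an explicit contour\<close>

text \<open>
  The vertical line \<open>Re s = \<gamma>\<close> with a bulge that crosses the real axis at \<open>c\<close>. The square of the
  positive part makes it continuously differentiable without exceptional points. For \<open>c = \<gamma>\<close> it is the
  line itself, and \<open>bump 1 (1 - c)\<close> is the image of \<open>bump 0 c\<close> under \<open>s \<mapsto> 1 - s\<close>, traversed upwards
  again.
\<close>
definition bump :: "real \<Rightarrow> real \<Rightarrow> real \<Rightarrow> complex" where
  "bump \<gamma> c t = Complex (\<gamma> + (c - \<gamma>) * (max 0 (1 - t\<^sup>2))\<^sup>2) t"

definition bump_deriv :: "real \<Rightarrow> real \<Rightarrow> real \<Rightarrow> complex" where
  "bump_deriv \<gamma> c t = Complex ((c - \<gamma>) * (2 * max 0 (1 - t\<^sup>2) * (- 2 * t))) 1"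

lemma has_derivative_positive_part_square:
  "((\<lambda>y::real. (max 0 y)\<^sup>2) has_real_derivative 2 * max 0 y) (at y)"
proof -
  consider "y < 0" | "y = 0" | "y > 0" by linarith
  then show ?thesis
  proof cases
    case 1
    have "((\<lambda>y::real. 0) has_real_derivative 2 * max 0 y) (at y)" using 1 by simp
    then show ?thesis
      by (rule has_field_derivative_transform_within_open[of _ _ _ "{..<0}"]) (use 1 in auto)
  next
    case 2
    have "(\<lambda>h. ((max 0 h)\<^sup>2 - (max 0 0)\<^sup>2) / h :: real) \<midarrow>0\<rightarrow> 0"
    proof (rule Lim_null_comparison)
      show "\<forall>\<^sub>F h in at (0::real). norm (((max 0 h)\<^sup>2 - (max 0 0)\<^sup>2) / h) \<le> \<bar>h\<bar>"
        by (intro always_eventually) (auto simp: max_def power2_eq_square)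
      show "((\<lambda>h::real. \<bar>h\<bar>) \<longlongrightarrow> 0) (at 0)" by (intro tendsto_eq_intros) auto
    qed
    then show ?thesis unfolding 2 DERIV_def by simp
  next
    case 3
    have "((\<lambda>y::real. y\<^sup>2) has_real_derivative 2 * max 0 y) (at y)"
      using 3 by (auto intro!: derivative_eq_intros)
    then show ?thesis
      by (rule has_field_derivative_transform_within_open[of _ _ _ "{0<..}"]) (use 3 in auto)
  qed
qed

lemma has_vector_derivative_Complex:
  assumes "(f has_real_derivative f') (at t)" "(g has_real_derivative g') (at t)"
  shows "((\<lambda>t. Complex (f t) (g t)) has_vector_derivative Complex f' g') (at t)"
proof -
  have "((\<lambda>t. of_real (f t) + \<i> * of_real (g t)) has_vector_derivative of_real f' + \<i> * of_real g') (at t)"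
    using assms by (auto intro!: derivative_eq_intros simp: has_real_derivative_iff_has_vector_derivative)
  then show ?thesis by (simp add: Complex_eq)
qed

lemma bump_has_derivative: "(bump \<gamma> c has_vector_derivative bump_deriv \<gamma> c t) (at t)"
proof -
  have "((\<lambda>t::real. (max 0 (1 - t\<^sup>2))\<^sup>2) has_real_derivative 2 * max 0 (1 - t\<^sup>2) * (- 2 * t)) (at t)"
    by (rule DERIV_chain2[OF has_derivative_positive_part_square]) (auto intro!: derivative_eq_intros)
  from DERIV_add[OF DERIV_const[of \<gamma>] DERIV_cmult[OF this, of "c - \<gamma>"]]
  have "((\<lambda>t. \<gamma> + (c - \<gamma>) * (max 0 (1 - t\<^sup>2))\<^sup>2) has_real_derivative
      (c - \<gamma>) * (2 * max 0 (1 - t\<^sup>2) * (- 2 * t))) (at t)"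
    by (simp only: add_0_left)
  then show ?thesis
    unfolding bump_def[abs_def] bump_deriv_def by (rule has_vector_derivative_Complex) auto
qed

lemma bump_vector_derivative: "vector_derivative (bump \<gamma> c) (at t) = bump_deriv \<gamma> c t"
  by (rule vector_derivative_at[OF bump_has_derivative])

lemma continuous_bump: "continuous_on S (bump \<gamma> c)" "continuous_on S (bump_deriv \<gamma> c)"
proof -
  show "continuous_on S (bump \<gamma> c)"
    using has_vector_derivative_continuous[OF bump_has_derivative]
    by (intro continuous_at_imp_continuous_on) blast
  have "continuous_on S (\<lambda>t. of_real ((c - \<gamma>) * (2 * max 0 (1 - t\<^sup>2) * (- 2 * t))) + \<i> * 1)"
    by (intro continuous_on_add continuous_on_const continuous_on_of_real continuous_on_mult_left
        continuous_on_mult[where f="\<lambda>t. 2 * max 0 (1 - t\<^sup>2)"] continuous_on_max continuous_on_diff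
        continuous_on_power continuous_on_id)
  then show "continuous_on S (bump_deriv \<gamma> c)"
    by (simp add: bump_deriv_def[abs_def] Complex_eq)
qed

lemma bump_tail: "\<bar>t\<bar> \<ge> 1 \<Longrightarrow> bump \<gamma> c t = Complex \<gamma> t" "\<bar>t\<bar> \<ge> 1 \<Longrightarrow> bump_deriv \<gamma> c t = \<i>"
proof -
  assume "\<bar>t\<bar> \<ge> 1"
  then have "1 \<le> t\<^sup>2" by (auto simp: power2_ge_1_iff)
  then have "max 0 (1 - t\<^sup>2) = 0" by simp
  then show "bump \<gamma> c t = Complex \<gamma> t" "bump_deriv \<gamma> c t = \<i>"
    by (auto simp: bump_def bump_deriv_def complex_eq_iff)
qed

lemma vertical_contour_bump: "vertical_contour \<gamma> (bump \<gamma> c)"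
  unfolding vertical_contour_def
proof (intro conjI)
  show "bump \<gamma> c piecewise_C1_differentiable_on UNIV"
    using bump_has_derivative continuous_bump(2)
    by (intro C1_differentiable_imp_piecewise) (unfold C1_differentiable_on_def, blast)
  show "\<forall>\<^sub>F t in at_bot. bump \<gamma> c t = Complex \<gamma> t"
    using eventually_le_at_bot[of "-1"] by eventually_elim (auto intro: bump_tail)
  show "\<forall>\<^sub>F t in at_top. bump \<gamma> c t = Complex \<gamma> t"
    using eventually_ge_at_top[of 1] by eventually_elim (auto intro: bump_tail)
qed

lemma Re_bump: "Re (bump \<gamma> c t) \<in> closed_segment \<gamma> c" and Im_bump: "Im (bump \<gamma> c t) = t"
proof -
  define l where "l = (max 0 (1 - t\<^sup>2))\<^sup>2"
  have "0 \<le> max 0 (1 - t\<^sup>2)" "max 0 (1 - t\<^sup>2) \<le> 1" by auto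
  then have "0 \<le> l" "l \<le> 1" unfolding l_def by (auto intro: power_le_one)
  moreover have "Re (bump \<gamma> c t) = (1 - l) * \<gamma> + l * c" by (simp add: bump_def l_def algebra_simps)
  ultimately show "Re (bump \<gamma> c t) \<in> closed_segment \<gamma> c" by (auto simp: closed_segment_def)
qed (simp add: bump_def)

lemma bump_real_iff: "of_real w \<in> range (bump \<gamma> c) \<longleftrightarrow> w = c"
proof
  assume "of_real w \<in> range (bump \<gamma> c)"
  then obtain t where t: "of_real w = bump \<gamma> c t" by blast
  then have "t = 0" using Im_bump[of \<gamma> c t] by (metis Im_complex_of_real)
  then show "w = c" using t by (simp add: bump_def complex_eq_iff)
next
  assume "w = c"
  then have "of_real w = bump \<gamma> c 0" by (simp add: bump_def complex_eq_iff)
  then show "of_real w \<in> range (bump \<gamma> c)" by blast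
qed

text \<open>
  The contour meets the real axis only at \<open>c\<close>, so that real points on one side of \<open>c\<close> can be joined
  along the axis.
\<close>
lemma left_of_bump:
  assumes "w < c"
  shows "left_of (bump \<gamma> c) (of_real w)"
  unfolding left_of_def eventually_at_bot_linorder
proof (intro exI allI impI)
  fix x :: real assume "x \<le> w"
  have "connected (of_real ` {x..w} :: complex set)"
    by (intro connected_continuous_image continuous_intros) auto
  moreover have "of_real y \<notin> range (bump \<gamma> c)" if "y \<le> w" for y using that assms unfolding bump_real_iff by simp
  then have "of_real ` {x..w} \<subseteq> - range (bump \<gamma> c)" by fastforce
  ultimately show "connected_component (- range (bump \<gamma> c)) (of_real w) (of_real x)"
    unfolding connected_component_def using \<open>x \<le> w\<close> by (intro exI[of _ "of_real ` {x..w}"]) auto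
qed

lemma right_of_bump:
  assumes "c < w"
  shows "right_of (bump \<gamma> c) (of_real w)"
  unfolding right_of_def eventually_at_top_linorder
proof (intro exI allI impI)
  fix x :: real assume "x \<ge> w"
  have "connected (of_real ` {w..x} :: complex set)"
    by (intro connected_continuous_image continuous_intros) auto
  moreover have "of_real y \<notin> range (bump \<gamma> c)" if "y \<ge> w" for y using that assms unfolding bump_real_iff by simp
  then have "of_real ` {w..x} \<subseteq> - range (bump \<gamma> c)" by fastforce
  ultimately show "connected_component (- range (bump \<gamma> c)) (of_real w) (of_real x)"
    unfolding connected_component_def using \<open>x \<ge> w\<close> by (intro exI[of _ "of_real ` {w..x}"]) auto
qed

lemma bump_integrable:
  assumes growth: "vertical_growth f e u v" and e: "e > 0 \<or> e = 0 \<and> u + v * \<gamma> < -1" and x: "x > 0"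
    and f: "f holomorphic_on S" and S: "range (bump \<gamma> c) \<subseteq> S"
  shows "integrable lborel (\<lambda>t. f (bump \<gamma> c t) * of_real x powr (- bump \<gamma> c t) * bump_deriv \<gamma> c t)"
proof (rule vertical_growth_integrable[OF growth e])
  have "continuous_on UNIV (\<lambda>t. f (bump \<gamma> c t))"
    by (rule continuous_on_compose2[OF holomorphic_on_imp_continuous_on[OF f] continuous_bump(1)]) (use S in auto)
  then show "continuous_on UNIV (\<lambda>t. f (bump \<gamma> c t) * of_real x powr (- bump \<gamma> c t) * bump_deriv \<gamma> c t)"
    using x by (intro continuous_intros continuous_bump) auto
  fix t :: real assume "\<bar>t\<bar> \<ge> 1"
  then show "norm (f (bump \<gamma> c t) * of_real x powr (- bump \<gamma> c t) * bump_deriv \<gamma> c t)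
      \<le> exp (- \<gamma> * ln x) * norm (f (Complex \<gamma> t))"
    by (simp add: bump_tail norm_mult norm_of_real_powr_minus[OF x])
qed

definition fox_left_poles :: "nat \<Rightarrow> (nat \<Rightarrow> real) \<Rightarrow> (nat \<Rightarrow> real) \<Rightarrow> complex set" where
  "fox_left_poles m b \<beta> = (\<Union>j\<in>{1..m}. range (fox_b_pole b \<beta> j))"

definition fox_right_poles :: "nat \<Rightarrow> (nat \<Rightarrow> real) \<Rightarrow> (nat \<Rightarrow> real) \<Rightarrow> complex set" where
  "fox_right_poles n a \<alpha> = (\<Union>i\<in>{1..n}. range (fox_a_pole a \<alpha> i))"

lemma finite_progression_cball:
  fixes c d r :: real
  assumes "d \<noteq> 0"
  shows "finite (range (\<lambda>k. of_real ((c + real k) / d)) \<inter> cball (0::complex) r)"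
proof (rule finite_subset)
  show "range (\<lambda>k. of_real ((c + real k) / d)) \<inter> cball (0::complex) r
      \<subseteq> (\<lambda>k. of_real ((c + real k) / d)) ` {.. nat \<lceil>r * \<bar>d\<bar> + \<bar>c\<bar>\<rceil>}"
  proof
    fix z assume "z \<in> range (\<lambda>k. of_real ((c + real k) / d)) \<inter> cball (0::complex) r"
    then obtain k where z: "z = of_real ((c + real k) / d)" and r: "norm z \<le> r" by auto
    have "\<bar>c + real k\<bar> / \<bar>d\<bar> \<le> r" using r unfolding z norm_of_real by simp
    then have "\<bar>c + real k\<bar> \<le> r * \<bar>d\<bar>" using assms by (simp add: pos_divide_le_eq)
    then have "real k \<le> r * \<bar>d\<bar> + \<bar>c\<bar>" by linarith
    then have "k \<le> nat \<lceil>r * \<bar>d\<bar> + \<bar>c\<bar>\<rceil>" by linarith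
    then show "z \<in> (\<lambda>k. of_real ((c + real k) / d)) ` {.. nat \<lceil>r * \<bar>d\<bar> + \<bar>c\<bar>\<rceil>}" using z by auto
  qed
qed auto

lemma finite_fox_poles:
  assumes "\<forall>j\<in>{1..m}. \<beta> j > 0" "\<forall>i\<in>{1..n}. \<alpha> i > 0"
  shows "finite ((fox_left_poles m b \<beta> \<union> fox_right_poles n a \<alpha>) \<inter> cball 0 r)"
proof -
  have fin1: "finite (range (fox_b_pole b \<beta> j) \<inter> cball 0 r)" if "j \<in> {1..m}" for j
  proof -
    have eq: "fox_b_pole b \<beta> j = (\<lambda>k. of_real ((b j + real k) / (- \<beta> j)))"
      by (rule ext, unfold fox_b_pole_def) (simp only: divide_minus_right minus_divide_left)
    have "- \<beta> j \<noteq> 0" using assms(1) that by force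
    then show ?thesis unfolding eq by (rule finite_progression_cball)
  qed
  have fin2: "finite (range (fox_a_pole a \<alpha> i) \<inter> cball 0 r)" if "i \<in> {1..n}" for i
  proof -
    have eq: "fox_a_pole a \<alpha> i = (\<lambda>k. of_real ((1 - a i + real k) / \<alpha> i))"
      by (auto simp: fox_a_pole_def)
    have "\<alpha> i \<noteq> 0" using assms(2) that by force
    then show ?thesis unfolding eq by (rule finite_progression_cball)
  qed
  have eq: "(fox_left_poles m b \<beta> \<union> fox_right_poles n a \<alpha>) \<inter> cball 0 r =
      (\<Union>j\<in>{1..m}. range (fox_b_pole b \<beta> j) \<inter> cball 0 r) \<union> (\<Union>i\<in>{1..n}. range (fox_a_pole a \<alpha> i) \<inter> cball 0 r)"
    unfolding fox_left_poles_def fox_right_poles_def by blast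
  show ?thesis
    unfolding eq by (intro finite_UnI finite_UN_I finite_atLeastAtMost fin1 fin2)
qed

lemma fox_poles_real: "fox_left_poles m b \<beta> \<union> fox_right_poles n a \<alpha> \<subseteq> \<real>"
  by (auto simp: fox_left_poles_def fox_right_poles_def fox_b_pole_def fox_a_pole_def)

text \<open>
  In terms of the entire function \<open>rGamma\<close> only the numerator factors contribute singularities.
\<close>
lemma fox_kernel_rGamma:
  "fox_kernel m n p q a \<alpha> b \<beta> s =
     ((\<Prod>j=1..m. Gamma (of_real (b j) + s * of_real (\<beta> j))) *
      (\<Prod>i=1..n. Gamma (1 - of_real (a i) - s * of_real (\<alpha> i)))) *
     ((\<Prod>i=n+1..p. rGamma (of_real (a i) + s * of_real (\<alpha> i))) *
      (\<Prod>j=m+1..q. rGamma (1 - of_real (b j) - s * of_real (\<beta> j))))"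
  unfolding fox_kernel_def by (simp add: rGamma_inverse_Gamma divide_inverse prod_inversef[symmetric, unfolded comp_def])

lemma fox_kernel_holomorphic:
  assumes "\<forall>j\<in>{1..m}. \<beta> j > 0" "\<forall>i\<in>{1..n}. \<alpha> i > 0"
  shows "fox_kernel m n p q a \<alpha> b \<beta> holomorphic_on - (fox_left_poles m b \<beta> \<union> fox_right_poles n a \<alpha>)"
proof -
  let ?S = "- (fox_left_poles m b \<beta> \<union> fox_right_poles n a \<alpha>)"
  have 1: "of_real (b j) + s * of_real (\<beta> j) \<notin> \<int>\<^sub>\<le>\<^sub>0" if "s \<in> ?S" "j \<in> {1..m}" for s j
  proof
    assume "of_real (b j) + s * of_real (\<beta> j) \<in> \<int>\<^sub>\<le>\<^sub>0"
    then obtain l where "of_real (b j) + s * of_real (\<beta> j) = - of_nat l" by (elim nonpos_Ints_cases')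
    then have "s * of_real (\<beta> j) = of_real (- (b j + real l))" by (simp add: algebra_simps eq_neg_iff_add_eq_0)
    moreover have nz: "complex_of_real (\<beta> j) \<noteq> 0" using assms(1) that by force
    ultimately have "s = of_real (- (b j + real l)) / of_real (\<beta> j)" by (simp only: nonzero_eq_divide_eq[OF nz])
    then have "s = fox_b_pole b \<beta> j l" by (simp add: fox_b_pole_def)
    then show False using that unfolding fox_left_poles_def by blast
  qed
  have 2: "1 - of_real (a i) - s * of_real (\<alpha> i) \<notin> \<int>\<^sub>\<le>\<^sub>0" if "s \<in> ?S" "i \<in> {1..n}" for s i
  proof
    assume "1 - of_real (a i) - s * of_real (\<alpha> i) \<in> \<int>\<^sub>\<le>\<^sub>0"
    then obtain l where "1 - of_real (a i) - s * of_real (\<alpha> i) = - of_nat l" by (elim nonpos_Ints_cases')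
    then have "s * of_real (\<alpha> i) = of_real (1 - a i + real l)" by (simp add: algebra_simps)
    moreover have nz: "complex_of_real (\<alpha> i) \<noteq> 0" using assms(2) that by force
    ultimately have "s = of_real (1 - a i + real l) / of_real (\<alpha> i)" by (simp only: nonzero_eq_divide_eq[OF nz])
    then have "s = fox_a_pole a \<alpha> i l" by (simp add: fox_a_pole_def)
    then show False using that unfolding fox_right_poles_def by blast
  qed
  show ?thesis
    unfolding fox_kernel_rGamma[abs_def] using 1 2
    by (intro holomorphic_on_mult holomorphic_on_prod holomorphic_Gamma' holomorphic_rGamma'
          holomorphic_intros) auto
qed

lemma sum_split_at:
  fixes h :: "nat \<Rightarrow> real"
  assumes "m \<le> q"
  shows "(\<Sum>j=1..q. h j) = (\<Sum>j=1..m. h j) + (\<Sum>j=m+1..q. h j)"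
  using assms sum.ub_add_nat[of 1 m h "q - m"] by simp

lemma fox_kernel_growth:
  assumes "n \<le> p" "m \<le> q" and \<alpha>: "\<forall>i\<in>{1..p}. \<alpha> i > 0" and \<beta>: "\<forall>j\<in>{1..q}. \<beta> j > 0"
  shows "vertical_growth (fox_kernel m n p q a \<alpha> b \<beta>) (fox_a_star m n p q \<alpha> \<beta>) (fox_mu p q a b)
    ((\<Sum>j=1..q. \<beta> j) - (\<Sum>i=1..p. \<alpha> i))"
proof -
  let ?A = "\<lambda>i s. Gamma (of_real (a i) + s * of_real (\<alpha> i))"
  let ?A' = "\<lambda>i s. Gamma (of_real (1 - a i) + s * of_real (- \<alpha> i))"
  let ?B = "\<lambda>j s. Gamma (of_real (b j) + s * of_real (\<beta> j))"
  let ?B' = "\<lambda>j s. Gamma (of_real (1 - b j) + s * of_real (- \<beta> j))"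
  have fac: "vertical_growth (?A i) (\<alpha> i) (a i - 1/2) (\<alpha> i)"
    "vertical_growth (?A' i) (\<alpha> i) (1 - a i - 1/2) (- \<alpha> i)" if "i \<in> {1..p}" for i
  proof -
    have "\<alpha> i > 0" using \<alpha> that by blast
    then show "vertical_growth (?A i) (\<alpha> i) (a i - 1/2) (\<alpha> i)"
      "vertical_growth (?A' i) (\<alpha> i) (1 - a i - 1/2) (- \<alpha> i)"
      using vertical_growth_Gamma[of "\<alpha> i" "a i"] vertical_growth_Gamma[of "- \<alpha> i" "1 - a i"] by auto
  qed
  have fbc: "vertical_growth (?B j) (\<beta> j) (b j - 1/2) (\<beta> j)"
    "vertical_growth (?B' j) (\<beta> j) (1 - b j - 1/2) (- \<beta> j)" if "j \<in> {1..q}" for j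
  proof -
    have "\<beta> j > 0" using \<beta> that by blast
    then show "vertical_growth (?B j) (\<beta> j) (b j - 1/2) (\<beta> j)"
      "vertical_growth (?B' j) (\<beta> j) (1 - b j - 1/2) (- \<beta> j)"
      using vertical_growth_Gamma[of "\<beta> j" "b j"] vertical_growth_Gamma[of "- \<beta> j" "1 - b j"] by auto
  qed
  define e where "e = (\<Sum>j=1..m. \<beta> j) + (\<Sum>i=1..n. \<alpha> i) + - ((\<Sum>i=n+1..p. \<alpha> i) + (\<Sum>j=m+1..q. \<beta> j))"
  define u where "u = (\<Sum>j=1..m. b j - 1/2) + (\<Sum>i=1..n. 1 - a i - 1/2)
    + - ((\<Sum>i=n+1..p. a i - 1/2) + (\<Sum>j=m+1..q. 1 - b j - 1/2))"
  define v where "v = (\<Sum>j=1..m. \<beta> j) + (\<Sum>i=1..n. - \<alpha> i) + - ((\<Sum>i=n+1..p. \<alpha> i) + (\<Sum>j=m+1..q. - \<beta> j))"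
  have "vertical_growth (\<lambda>s. ((\<Prod>j=1..m. ?B j s) * (\<Prod>i=1..n. ?A' i s)) *
      inverse ((\<Prod>i=n+1..p. ?A i s) * (\<Prod>j=m+1..q. ?B' j s))) e u v"
    unfolding e_def u_def v_def using assms(1,2)
    by (intro vertical_growth_mult vertical_growth_inverse vertical_growth_prod fac fbc) auto
  moreover have "(\<lambda>s. ((\<Prod>j=1..m. ?B j s) * (\<Prod>i=1..n. ?A' i s)) *
      inverse ((\<Prod>i=n+1..p. ?A i s) * (\<Prod>j=m+1..q. ?B' j s))) = fox_kernel m n p q a \<alpha> b \<beta>"
    unfolding fox_kernel_def by (simp add: fun_eq_iff divide_inverse)
  moreover have "e = fox_a_star m n p q \<alpha> \<beta>" by (simp add: e_def fox_a_star_def)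
  moreover have "u = fox_mu p q a b"
  proof -
    have "u = (\<Sum>j=1..q. b j - 1/2) - (\<Sum>i=1..p. a i - 1/2)"
      unfolding u_def sum_split_at[OF assms(1)] sum_split_at[OF assms(2)]
      by (simp add: sum_subtractf algebra_simps)
    also have "\<dots> = ((\<Sum>j=1..q. b j) - real q / 2) - ((\<Sum>i=1..p. a i) - real p / 2)"
      by (simp add: sum_subtractf)
    finally show ?thesis by (simp add: fox_mu_def field_simps)
  qed
  moreover have "v = (\<Sum>j=1..q. \<beta> j) - (\<Sum>i=1..p. \<alpha> i)"
    unfolding v_def sum_split_at[OF assms(1)] sum_split_at[OF assms(2)] by (simp add: sum_negf)
  ultimately show ?thesis by simp
qed

text \<open>
  Hence the definite description in the definition of \<open>fox_H\<close> can be evaluated on any one contour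
  along which the integral converges absolutely.
\<close>
lemma has_fox_H_unique:
  assumes "n \<le> p" "m \<le> q" and \<alpha>: "\<forall>i\<in>{1..p}. \<alpha> i > 0" and \<beta>: "\<forall>j\<in>{1..q}. \<beta> j > 0"
    and star: "fox_a_star m n p q \<alpha> \<beta> \<ge> 0" and x: "x > 0"
    and h1: "has_fox_H m n p q a \<alpha> b \<beta> (of_real x) h1" and h2: "has_fox_H m n p q a \<alpha> b \<beta> (of_real x) h2"
  shows "h1 = h2"
proof -
  from h1 obtain g1 \<gamma>1 where g1: "vertical_contour \<gamma>1 g1" "fox_contour m n a \<alpha> b \<beta> g1"
    and int1: "integrable lborel (\<lambda>t. fox_kernel m n p q a \<alpha> b \<beta> (g1 t) * of_real x powr (- g1 t) * vector_derivative g1 (at t))"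
    and h1: "h1 = 1 / (2 * of_real pi * \<i>) *
      (LINT t|lborel. fox_kernel m n p q a \<alpha> b \<beta> (g1 t) * of_real x powr (- g1 t) * vector_derivative g1 (at t))"
    unfolding has_fox_H_def fox_contour_def by blast
  from h2 obtain g2 \<gamma>2 where g2: "vertical_contour \<gamma>2 g2" "fox_contour m n a \<alpha> b \<beta> g2"
    and int2: "integrable lborel (\<lambda>t. fox_kernel m n p q a \<alpha> b \<beta> (g2 t) * of_real x powr (- g2 t) * vector_derivative g2 (at t))"
    and h2: "h2 = 1 / (2 * of_real pi * \<i>) *
      (LINT t|lborel. fox_kernel m n p q a \<alpha> b \<beta> (g2 t) * of_real x powr (- g2 t) * vector_derivative g2 (at t))"
    unfolding has_fox_H_def fox_contour_def by blast
  have pos: "\<forall>j\<in>{1..m}. \<beta> j > 0" "\<forall>i\<in>{1..n}. \<alpha> i > 0" using assms by auto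
  have "(LINT t|lborel. fox_kernel m n p q a \<alpha> b \<beta> (g1 t) * of_real x powr (- g1 t) * vector_derivative g1 (at t)) =
    (LINT t|lborel. fox_kernel m n p q a \<alpha> b \<beta> (g2 t) * of_real x powr (- g2 t) * vector_derivative g2 (at t))"
    using g1(2) g2(2)
    by (intro Mellin_Barnes_contour_independent[OF g1(1) g2(1) fox_poles_real finite_fox_poles[OF pos] _ _
          fox_kernel_holomorphic[OF pos] fox_kernel_growth[OF assms(1-4)] star x int1 int2])
       (auto simp: fox_contour_def fox_left_poles_def fox_right_poles_def)
  then show ?thesis unfolding h1 h2 by simp
qed

lemma fox_contour_bump:
  assumes \<beta>: "\<forall>j\<in>{1..m}. \<beta> j > 0 \<and> - b j / \<beta> j < c" and \<alpha>: "\<forall>i\<in>{1..n}. \<alpha> i > 0 \<and> c < (1 - a i) / \<alpha> i"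
  shows "fox_contour m n a \<alpha> b \<beta> (bump \<gamma> c)"
  unfolding fox_contour_def
proof (intro conjI ballI allI)
  show "\<exists>\<gamma>'. vertical_contour \<gamma>' (bump \<gamma> c)" using vertical_contour_bump by blast
  fix j l assume "j \<in> {1..m}"
  then have j: "\<beta> j > 0" "- b j / \<beta> j < c" using \<beta> by auto
  have "- (b j + real l) / \<beta> j \<le> - b j / \<beta> j" using j by (intro divide_right_mono) auto
  then show "left_of (bump \<gamma> c) (fox_b_pole b \<beta> j l)"
    unfolding fox_b_pole_def using j by (intro left_of_bump) simp
next
  fix i k assume "i \<in> {1..n}"
  then have i: "\<alpha> i > 0" "c < (1 - a i) / \<alpha> i" using \<alpha> by auto
  have "(1 - a i) / \<alpha> i \<le> (1 - a i + real k) / \<alpha> i" using i by (intro divide_right_mono) auto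
  then show "right_of (bump \<gamma> c) (fox_a_pole a \<alpha> i k)"
    unfolding fox_a_pole_def using i by (intro right_of_bump) simp
qed

lemma fox_contour_range:
  assumes "fox_contour m n a \<alpha> b \<beta> g"
  shows "range g \<subseteq> - (fox_left_poles m b \<beta> \<union> fox_right_poles n a \<alpha>)"
proof -
  have "w \<notin> range g" if "w \<in> fox_left_poles m b \<beta> \<union> fox_right_poles n a \<alpha>" for w
  proof -
    have "left_of g w \<or> right_of g w"
      using that assms unfolding fox_contour_def fox_left_poles_def fox_right_poles_def by auto
    then show ?thesis using left_of_notin_range right_of_notin_range by blast
  qed
  then show ?thesis by blast
qed

lemma fox_H_bump:
  assumes "n \<le> p" "m \<le> q" and \<alpha>: "\<forall>i\<in>{1..p}. \<alpha> i > 0" and \<beta>: "\<forall>j\<in>{1..q}. \<beta> j > 0"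
    and star: "fox_a_star m n p q \<alpha> \<beta> > 0 \<or> fox_a_star m n p q \<alpha> \<beta> = 0 \<and>
      fox_mu p q a b + ((\<Sum>j=1..q. \<beta> j) - (\<Sum>i=1..p. \<alpha> i)) * \<gamma> < -1"
    and contour: "fox_contour m n a \<alpha> b \<beta> (bump \<gamma> c)" and x: "x > 0"
  shows "integrable lborel (\<lambda>t. fox_kernel m n p q a \<alpha> b \<beta> (bump \<gamma> c t) * of_real x powr (- bump \<gamma> c t) * bump_deriv \<gamma> c t)"
    and "fox_H m n p q a \<alpha> b \<beta> (of_real x) = 1 / (2 * of_real pi * \<i>) *
      (LINT t|lborel. fox_kernel m n p q a \<alpha> b \<beta> (bump \<gamma> c t) * of_real x powr (- bump \<gamma> c t) * bump_deriv \<gamma> c t)"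
proof -
  have pos: "\<forall>j\<in>{1..m}. \<beta> j > 0" "\<forall>i\<in>{1..n}. \<alpha> i > 0" using assms(1-4) by auto
  show int: "integrable lborel (\<lambda>t. fox_kernel m n p q a \<alpha> b \<beta> (bump \<gamma> c t) * of_real x powr (- bump \<gamma> c t) * bump_deriv \<gamma> c t)"
    by (rule bump_integrable[OF fox_kernel_growth[OF assms(1-4)] star x fox_kernel_holomorphic[OF pos] fox_contour_range[OF contour]])
  then have has: "has_fox_H m n p q a \<alpha> b \<beta> (of_real x) (1 / (2 * of_real pi * \<i>) *
      (LINT t|lborel. fox_kernel m n p q a \<alpha> b \<beta> (bump \<gamma> c t) * of_real x powr (- bump \<gamma> c t) * bump_deriv \<gamma> c t))"
    unfolding has_fox_H_def using contour by (intro exI[of _ "bump \<gamma> c"]) (simp add: bump_vector_derivative)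
  have ge: "fox_a_star m n p q \<alpha> \<beta> \<ge> 0" using star by auto
  show "fox_H m n p q a \<alpha> b \<beta> (of_real x) = 1 / (2 * of_real pi * \<i>) *
      (LINT t|lborel. fox_kernel m n p q a \<alpha> b \<beta> (bump \<gamma> c t) * of_real x powr (- bump \<gamma> c t) * bump_deriv \<gamma> c t)"
    unfolding fox_H_def
  proof (rule the_equality)
    fix h assume "has_fox_H m n p q a \<alpha> b \<beta> (of_real x) h"
    then show "h = 1 / (2 * of_real pi * \<i>) *
      (LINT t|lborel. fox_kernel m n p q a \<alpha> b \<beta> (bump \<gamma> c t) * of_real x powr (- bump \<gamma> c t) * bump_deriv \<gamma> c t)"
      by (rule has_fox_H_unique[OF assms(1-4) ge x _ has])
  qed (rule has)
qed

section \<open>Laplace transforms and the residue at the origin\<close>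

text \<open>
  The parameter \<open>d\<close> is \<open>0\<close> for the Fox-H function that represents the Laplace transform. Taking
  \<open>d = 1\<close> replaces \<open>Gamma s\<close> by \<open>Gamma (1 + s) = s * Gamma s\<close>, so the pole at \<open>0\<close> is removed while
  the result is again a Fox kernel.
\<close>
lemma fox_kernel_of_laplace_parameters:
  "fox_kernel (n + 1) m q (p + 1) (\<lambda>j. 1 - b j - \<beta> j) \<beta>
     (\<lambda>i. if i = 1 then d else 1 - a (i - 1) - \<alpha> (i - 1)) (\<lambda>i. if i = 1 then 1 else \<alpha> (i - 1)) s
   = Gamma (of_real d + s) * fox_kernel m n p q a \<alpha> b \<beta> (1 - s)"
proof -
  define b' where "b' = (\<lambda>i. if i = 1 then d else 1 - a (i - 1) - \<alpha> (i - 1))"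
  define \<beta>' where "\<beta>' = (\<lambda>i. if i = 1 then 1 else \<alpha> (i - 1))"
  have b': "b' (Suc 0) = d" "\<beta>' (Suc 0) = 1" "i \<ge> 1 \<Longrightarrow> b' (Suc i) = 1 - a i - \<alpha> i" "i \<ge> 1 \<Longrightarrow> \<beta>' (Suc i) = \<alpha> i" for i
    by (auto simp: b'_def \<beta>'_def)
  have 1: "(\<Prod>j=1..n+1. Gamma (of_real (b' j) + s * of_real (\<beta>' j)))
      = Gamma (of_real d + s) * (\<Prod>i=1..n. Gamma (1 - of_real (a i) - (1 - s) * of_real (\<alpha> i)))"
  proof -
    have "(\<Prod>j=1..n+1. Gamma (of_real (b' j) + s * of_real (\<beta>' j)))
      = Gamma (of_real d + s) * (\<Prod>j=Suc 1..Suc n. Gamma (of_real (b' j) + s * of_real (\<beta>' j)))"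
      by (subst prod.atLeast_Suc_atMost) (auto simp: b')
    also have "(\<Prod>j=Suc 1..Suc n. Gamma (of_real (b' j) + s * of_real (\<beta>' j)))
      = (\<Prod>i=1..n. Gamma (1 - of_real (a i) - (1 - s) * of_real (\<alpha> i)))"
      unfolding prod.shift_bounds_cl_Suc_ivl
      by (intro prod.cong refl) (auto simp: b' algebra_simps)
    finally show ?thesis .
  qed
  have 2: "(\<Prod>i=m'..m''. Gamma (1 - of_real (1 - b i - \<beta> i) - s * of_real (\<beta> i)))
      = (\<Prod>j=m'..m''. Gamma (of_real (b j) + (1 - s) * of_real (\<beta> j)))" for m' m''
    by (intro prod.cong refl arg_cong[of _ _ Gamma]) (simp add: algebra_simps)
  have 3: "(\<Prod>i=m'..m''. Gamma (of_real (1 - b i - \<beta> i) + s * of_real (\<beta> i)))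
      = (\<Prod>j=m'..m''. Gamma (1 - of_real (b j) - (1 - s) * of_real (\<beta> j)))" for m' m''
    by (intro prod.cong refl arg_cong[of _ _ Gamma]) (simp add: algebra_simps)
  have 4: "(\<Prod>j=n+1+1..p+1. Gamma (1 - of_real (b' j) - s * of_real (\<beta>' j)))
      = (\<Prod>i=n+1..p. Gamma (of_real (a i) + (1 - s) * of_real (\<alpha> i)))"
    unfolding Suc_eq_plus1[symmetric] prod.shift_bounds_cl_Suc_ivl
    by (intro prod.cong refl) (auto simp: b' algebra_simps)
  show ?thesis
    unfolding fox_kernel_def b'_def[symmetric] \<beta>'_def[symmetric] 1 2 3 4 by (simp add: mult_ac)
qed

lemma fox_a_star_of_laplace_parameters:
  "fox_a_star (n + 1) m q (p + 1) \<beta> (\<lambda>i. if i = 1 then 1 else \<alpha> (i - 1)) = fox_a_star m n p q \<alpha> \<beta> + 1"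
proof -
  define \<beta>' where "\<beta>' = (\<lambda>i. if i = 1 then 1 else \<alpha> (i - 1))"
  have b': "\<beta>' (Suc 0) = 1" "i \<ge> 1 \<Longrightarrow> \<beta>' (Suc i) = \<alpha> i" for i
    by (auto simp: \<beta>'_def)
  have "(\<Sum>j=1..n+1. \<beta>' j) = 1 + (\<Sum>i=Suc 1..Suc n. \<beta>' i)"
    by (subst sum.atLeast_Suc_atMost) (auto simp: b')
  also have "(\<Sum>i=Suc 1..Suc n. \<beta>' i) = (\<Sum>i=1..n. \<alpha> i)"
    unfolding sum.shift_bounds_cl_Suc_ivl by (intro sum.cong refl) (auto simp: b')
  finally have 1: "(\<Sum>j=1..n+1. \<beta>' j) = 1 + (\<Sum>i=1..n. \<alpha> i)" .
  have 2: "(\<Sum>j=n+1+1..p+1. \<beta>' j) = (\<Sum>i=n+1..p. \<alpha> i)"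
    unfolding Suc_eq_plus1[symmetric] sum.shift_bounds_cl_Suc_ivl by (intro sum.cong refl) (auto simp: b')
  show ?thesis unfolding fox_a_star_def \<beta>'_def[symmetric] 1 2 by simp
qed

lemma laplace_powr:
  assumes z: "Re z > 0" and y: "y > 0"
  shows "integrable lborel (\<lambda>x. indicator {0<..} x *\<^sub>R (of_real (exp (- y * x)) * of_real x powr (z - 1)))"
    and "(LINT x|lborel. indicator {0<..} x *\<^sub>R (of_real (exp (- y * x)) * of_real x powr (z - 1)))
      = Gamma z * of_real y powr (- z)"
proof -
  define f where "f = (\<lambda>y x. indicator {0<..} x *\<^sub>R (of_real (exp (- y * x)) * of_real x powr (z - 1)) :: complex)"
  have f_alt: "f y = (\<lambda>x. indicator {0<..} x *\<^sub>R (of_real x powr (z - 1) / of_real (exp (y * x))))" for y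
    by (auto simp: f_def fun_eq_iff exp_minus field_simps)
  have meas: "f y \<in> borel_measurable lborel" for y
  proof -
    have eq: "f y = (\<lambda>x. indicator {0<..} x *\<^sub>R (of_real (exp (- y * x)) * exp ((z - 1) * of_real (ln x))))"
      by (auto simp: f_def fun_eq_iff powr_def indicator_def Ln_of_real)
    show ?thesis unfolding eq by measurable
  qed
  have int: "integrable lborel (f y)" if "y > 0" for y
    using absolutely_integrable_Gamma_integral[OF z that] meas[of y]
    unfolding set_integrable_def f_alt by (simp add: integrable_completion)
  then show "integrable lborel (\<lambda>x. indicator {0<..} x *\<^sub>R (of_real (exp (- y * x)) * of_real x powr (z - 1)))"
    using y unfolding f_def by blast
  have one: "(LINT x|lborel. f 1 x) = Gamma z"
  proof -
    have "set_integrable lborel {0<..} (\<lambda>x. of_real x powr (z - 1) / of_real (exp x))"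
      using int[of 1] unfolding f_alt set_integrable_def by simp
    from set_borel_integral_eq_integral(2)[OF this]
    have "(LINT x|lborel. f 1 x) = integral {0<..} (\<lambda>x. of_real x powr (z - 1) / of_real (exp x))"
      unfolding f_alt set_lebesgue_integral_def by simp
    then show ?thesis using integral_unique[OF Gamma_integral_complex'[OF z]] by simp
  qed
  have "(LINT x|lborel. f 1 x) = \<bar>y\<bar> *\<^sub>R (LINT x|lborel. f 1 (0 + y * x))"
    using y by (intro lborel_integral_real_affine) auto
  also have "(\<lambda>x. f 1 (0 + y * x)) = (\<lambda>x. of_real y powr (z - 1) * f y x)"
  proof
    fix x show "f 1 (0 + y * x) = of_real y powr (z - 1) * f y x"
      using y by (auto simp: f_def indicator_def powr_times_real zero_less_mult_iff)
  qed
  also have "(LINT x|lborel. of_real y powr (z - 1) * f y x) = of_real y powr (z - 1) * (LINT x|lborel. f y x)"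
    by simp
  finally have "Gamma z = of_real y * of_real y powr (z - 1) * (LINT x|lborel. f y x)"
    unfolding one using y by (simp add: scaleR_conv_of_real)
  also have "of_real y * of_real y powr (z - 1) = of_real y powr z"
    using y by (simp add: powr_diff)
  finally have "Gamma z * of_real y powr (- z) = (LINT x|lborel. f y x)"
    using y by (simp add: powr_minus field_simps)
  then show "(LINT x|lborel. indicator {0<..} x *\<^sub>R (of_real (exp (- y * x)) * of_real x powr (z - 1)))
      = Gamma z * of_real y powr (- z)" unfolding f_def by simp
qed

text \<open>
  The bounds on \<open>Re (g t)\<close> yield \<open>x powr (- Re (g t)) \<le> 1 + x powr (- c)\<close>, which is integrable against
  \<open>exp (- y * x)\<close> as \<open>c < 1\<close>. So Fubini's theorem reduces the claim to the Laplace transform of a power.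
\<close>
lemma laplace_contour_integral:
  fixes F g :: "real \<Rightarrow> complex"
  assumes F: "continuous_on UNIV F" "integrable lborel F" and g: "continuous_on UNIV g"
    and strip: "\<And>t. 0 \<le> Re (g t)" "\<And>t. Re (g t) \<le> c" "c < 1" and y: "y > 0"
  defines "H \<equiv> (\<lambda>x. LINT t|lborel. F t * of_real x powr (- g t))"
  shows "integrable lborel (\<lambda>x. indicator {0<..} x *\<^sub>R (of_real (exp (- y * x)) * H x))"
    and "(LINT x|lborel. indicator {0<..} x *\<^sub>R (of_real (exp (- y * x)) * H x))
      = (LINT t|lborel. F t * (Gamma (1 - g t) * of_real y powr (g t - 1)))"
proof -
  define k where "k = (\<lambda>t x. indicator {0<..} x *\<^sub>R (of_real (exp (- y * x)) * (F t * of_real x powr (- g t))) :: complex)"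
  define W where "W = (\<lambda>x. indicator {0<..} x * (exp (- y * x) * (1 + x powr (- c))) :: real)"
  have [measurable]: "F \<in> borel_measurable borel" "g \<in> borel_measurable borel"
    using F g by (auto intro: borel_measurable_continuous_onI)
  have W_nonneg: "W x \<ge> 0" for x by (auto simp: W_def indicator_def)
  have W: "integrable lborel W"
  proof -
    have 1: "integrable lborel (\<lambda>x. indicator {0<..} x *\<^sub>R (of_real (exp (- y * x)) * complex_of_real x powr (1 - 1)))"
      by (rule laplace_powr) (use y in auto)
    have 2: "integrable lborel (\<lambda>x. indicator {0<..} x *\<^sub>R (of_real (exp (- y * x)) * of_real x powr (of_real (1 - c) - 1)) :: complex)"
      by (rule laplace_powr) (use y strip in auto)
    have eq: "W x = norm (indicator {0<..} x *\<^sub>R (of_real (exp (- y * x)) * complex_of_real x powr (1 - 1))) +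
        norm (indicator {0<..} x *\<^sub>R (of_real (exp (- y * x)) * of_real x powr (of_real (1 - c) - 1)) :: complex)" for x
      by (auto simp: W_def indicator_def norm_mult norm_powr_real_powr algebra_simps)
    show ?thesis
      unfolding ext[of W, OF eq] by (intro Bochner_Integration.integrable_add integrable_norm 1 2)
  qed
  have meas: "case_prod k \<in> borel_measurable (lborel \<Otimes>\<^sub>M lborel)"
  proof -
    have "case_prod k = (\<lambda>(t, x). indicator {0<..} x *\<^sub>R (of_real (exp (- y * x)) * (F t * exp (- g t * of_real (ln x)))))"
      by (auto simp: k_def fun_eq_iff powr_def indicator_def Ln_of_real)
    then show ?thesis by simp
  qed
  have bound: "norm (k t x) \<le> norm (F t) * W x" for t x
  proof (cases "x > 0")
    case True
    have "norm (of_real x powr (- g t)) = x powr (- Re (g t))"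
      using True by (simp add: norm_powr_real_powr)
    also have "\<dots> \<le> 1 + x powr (- c)"
    proof (cases "x \<ge> 1")
      case True
      then have "x powr (- Re (g t)) \<le> x powr 0" using strip by (intro powr_mono) auto
      then show ?thesis using True by (simp add: add_increasing2)
    next
      case False
      then have "x powr (- Re (g t)) \<le> x powr (- c)" using strip \<open>x > 0\<close> by (intro powr_mono') auto
      then show ?thesis by simp
    qed
    finally have "norm (F t) * norm (of_real x powr (- g t)) \<le> norm (F t) * (1 + x powr (- c))"
      by (rule mult_left_mono) simp
    then have "exp (- y * x) * (norm (F t) * norm (of_real x powr (- g t))) \<le> exp (- y * x) * (norm (F t) * (1 + x powr (- c)))"
      by (rule mult_left_mono) simp
    then show ?thesis using True by (simp add: k_def W_def norm_mult mult_ac)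
  qed (simp add: k_def W_def)
  have prod: "integrable (lborel \<Otimes>\<^sub>M lborel) (\<lambda>(t, x). norm (F t) * W x)"
  proof (rule lborel_pair.Fubini_integrable)
    have [measurable]: "W \<in> borel_measurable borel" using borel_measurable_integrable[OF W] by simp
    show "(\<lambda>(t, x). norm (F t) * W x) \<in> borel_measurable (lborel \<Otimes>\<^sub>M lborel)" by measurable
    have "(\<lambda>t. LINT x|lborel. norm (case (t, x) of (t, x) \<Rightarrow> norm (F t) * W x))
        = (\<lambda>t. norm (F t) * (LINT x|lborel. W x))"
      using W_nonneg by (simp add: abs_mult)
    then show "integrable lborel (\<lambda>t. LINT x|lborel. norm (case (t, x) of (t, x) \<Rightarrow> norm (F t) * W x))"
      using F(2) by simp
    show "AE t in lborel. integrable lborel (\<lambda>x. case (t, x) of (t, x) \<Rightarrow> norm (F t) * W x)"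
      using W by simp
  qed
  have joint: "integrable (lborel \<Otimes>\<^sub>M lborel) (case_prod k)"
    by (rule Bochner_Integration.integrable_bound[OF prod meas])
       (use bound W_nonneg in \<open>auto simp: abs_mult\<close>)
  have H: "(LINT t|lborel. k t x) = indicator {0<..} x *\<^sub>R (of_real (exp (- y * x)) * H x)" for x
    by (simp add: k_def H_def)
  show "integrable lborel (\<lambda>x. indicator {0<..} x *\<^sub>R (of_real (exp (- y * x)) * H x))"
    using lborel_pair.integrable_snd[OF joint] unfolding H .
  have "(LINT x|lborel. indicator {0<..} x *\<^sub>R (of_real (exp (- y * x)) * H x)) = (LINT t|lborel. LINT x|lborel. k t x)"
    using lborel_pair.Fubini_integral[OF joint] unfolding H .
  also have "(\<lambda>t. LINT x|lborel. k t x) = (\<lambda>t. F t * (Gamma (1 - g t) * of_real y powr (g t - 1)))"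
  proof
    fix t
    have "k t = (\<lambda>x. F t * (indicator {0<..} x *\<^sub>R (of_real (exp (- y * x)) * of_real x powr ((1 - g t) - 1))))"
      by (auto simp: k_def fun_eq_iff)
    then have "(LINT x|lborel. k t x) = F t * (LINT x|lborel. indicator {0<..} x *\<^sub>R (of_real (exp (- y * x)) * of_real x powr ((1 - g t) - 1)))"
      by (simp only: integral_mult_right_zero)
    also have "\<dots> = F t * (Gamma (1 - g t) * of_real y powr (- (1 - g t)))"
      using strip(2)[of t] strip(3) y by (subst laplace_powr(2)) auto
    finally show "(LINT x|lborel. k t x) = F t * (Gamma (1 - g t) * of_real y powr (g t - 1))" by simp
  qed
  finally show "(LINT x|lborel. indicator {0<..} x *\<^sub>R (of_real (exp (- y * x)) * H x))
      = (LINT t|lborel. F t * (Gamma (1 - g t) * of_real y powr (g t - 1)))" .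
qed

text \<open>
  The branch \<open>Ln\<close> is a primitive on the right half-plane. In the limit the argument along the contour
  increases from \<open>- \<pi> / 2\<close> to \<open>\<pi> / 2\<close>.
\<close>
lemma bump_log_integral:
  assumes "\<gamma> > 0" "c > 0"
  shows "((\<lambda>T. integral {-T..T} (\<lambda>t. bump_deriv \<gamma> c t / bump \<gamma> c t)) \<longlongrightarrow> \<i> * of_real pi) at_top"
proof -
  have Re: "Re (bump \<gamma> c t) > 0" for t
    using Re_bump[of \<gamma> c t] assms by (auto simp: closed_segment_eq_real_ivl split: if_splits)
  have d: "((\<lambda>t. Ln (bump \<gamma> c t)) has_vector_derivative bump_deriv \<gamma> c t / bump \<gamma> c t) (at t within S)" for t S
  proof -
    have "(Ln has_field_derivative inverse (bump \<gamma> c t)) (at (bump \<gamma> c t))"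
      using Re[of t] by (intro has_field_derivative_Ln) (auto simp: complex_nonpos_Reals_iff)
    from field_vector_diff_chain_within[OF bump_has_derivative[THEN has_vector_derivative_at_within] this[THEN has_field_derivative_at_within]]
    show ?thesis by (simp add: comp_def divide_inverse mult.commute)
  qed
  have I: "integral {-T..T} (\<lambda>t. bump_deriv \<gamma> c t / bump \<gamma> c t) = \<i> * of_real (2 * arctan (T / \<gamma>))" if "T \<ge> 1" for T
  proof -
    have "integral {-T..T} (\<lambda>t. bump_deriv \<gamma> c t / bump \<gamma> c t) = Ln (bump \<gamma> c T) - Ln (bump \<gamma> c (-T))"
      using that by (intro integral_unique fundamental_theorem_of_calculus d) auto
    also have "\<dots> = Ln (Complex \<gamma> T) - Ln (Complex \<gamma> (-T))" using that by (simp add: bump_tail)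
    also have "\<dots> = Ln (Complex \<gamma> T) - cnj (Ln (Complex \<gamma> T))"
    proof -
      have "Complex \<gamma> (-T) = cnj (Complex \<gamma> T)" by (simp add: complex_eq_iff)
      moreover have "Complex \<gamma> T \<notin> \<real>\<^sub>\<le>\<^sub>0" using assms by (simp add: complex_nonpos_Reals_iff)
      ultimately show ?thesis by (metis cnj_Ln)
    qed
    also have "\<dots> = \<i> * of_real (2 * Im (Ln (Complex \<gamma> T)))" by (simp add: complex_eq_iff)
    also have "Im (Ln (Complex \<gamma> T)) = arctan (T / \<gamma>)"
      using assms arg_conv_arctan[of "Complex \<gamma> T"] Arg_eq_Im_Ln[of "Complex \<gamma> T"] by (simp add: complex_eq_iff)
    finally show ?thesis .
  qed
  have "\<forall>\<^sub>F T in at_top. \<i> * of_real (2 * arctan (T / \<gamma>)) = integral {-T..T} (\<lambda>t. bump_deriv \<gamma> c t / bump \<gamma> c t)"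
    by (rule eventually_mono[OF eventually_ge_at_top[of 1]]) (rule I[symmetric])
  moreover have "((\<lambda>T. \<i> * of_real (2 * arctan (T / \<gamma>))) \<longlongrightarrow> \<i> * of_real (2 * (pi / 2))) at_top"
  proof (intro tendsto_intros)
    have "filterlim (\<lambda>T. T / \<gamma>) at_top at_top" using assms(1) by real_asymp
    then show "((\<lambda>T. arctan (T / \<gamma>)) \<longlongrightarrow> pi / 2) at_top" by (rule filterlim_compose[OF tendsto_arctan_at_top])
  qed
  ultimately show ?thesis by (auto elim: Lim_transform_eventually[rotated])
qed

lemma bump_log_integral_minus:
  assumes "\<delta> > 0"
  shows "((\<lambda>T. integral {-T..T} (\<lambda>t. bump_deriv (-\<delta>) (-\<delta>) t / bump (-\<delta>) (-\<delta>) t)) \<longlongrightarrow> - (\<i> * of_real pi)) at_top"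
proof -
  have "bump_deriv (-\<delta>) (-\<delta>) t / bump (-\<delta>) (-\<delta>) t = - (bump_deriv \<delta> \<delta> (-t) / bump \<delta> \<delta> (-t))" for t
  proof -
    have "bump (-\<delta>) (-\<delta>) t = - bump \<delta> \<delta> (-t)" "bump_deriv (-\<delta>) (-\<delta>) t = bump_deriv \<delta> \<delta> (-t)"
      by (simp_all add: bump_def bump_deriv_def complex_eq_iff)
    then show ?thesis by simp
  qed
  then have "integral {-T..T} (\<lambda>t. bump_deriv (-\<delta>) (-\<delta>) t / bump (-\<delta>) (-\<delta>) t) =
      - integral {-T..T} (\<lambda>t. bump_deriv \<delta> \<delta> t / bump \<delta> \<delta> t)" for T
    using Henstock_Kurzweil_Integration.integral_reflect_real[of T "-T" "\<lambda>t. bump_deriv \<delta> \<delta> t / bump \<delta> \<delta> t"] by simp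
  then show ?thesis using tendsto_minus[OF bump_log_integral[OF assms assms]] by simp
qed

text \<open>
  Subtracting the polar part \<open>N 0 / s\<close> leaves a function without singularity at \<open>0\<close>, to which
  \<open>contour_shift\<close> applies. The integrals of \<open>1 / s\<close> along the two contours tend to \<open>\<i> * \<pi>\<close> and
  \<open>- \<i> * \<pi>\<close>, so no winding number about \<open>0\<close> has to be computed.
\<close>
theorem Mellin_Barnes_residue_at_0:
  assumes real: "PL \<union> PR \<subseteq> \<real>" and fin: "\<And>r. finite ((PL \<union> PR) \<inter> cball 0 r)"
    and left: "\<And>w. w \<in> PL \<Longrightarrow> Re w < - \<delta>" and right: "\<And>w. w \<in> PR \<Longrightarrow> Re w > c"
    and pos: "\<delta> > 0" "c > 0" "\<gamma> > 0"
    and hol: "N holomorphic_on - (PL \<union> PR)" and k: "\<And>s. s \<noteq> 0 \<Longrightarrow> k s = N s / s"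
    and growth: "vertical_growth k e u v" and e: "e > 0" and x: "x > 0"
  shows "(LINT t|lborel. k (bump \<gamma> c t) * of_real x powr (- bump \<gamma> c t) * bump_deriv \<gamma> c t) =
      (LINT t|lborel. k (bump (-\<delta>) (-\<delta>) t) * of_real x powr (- bump (-\<delta>) (-\<delta>) t) * bump_deriv (-\<delta>) (-\<delta>) t)
      + 2 * of_real pi * \<i> * N 0"
proof -
  define g1 where "g1 = bump \<gamma> c"
  define g2 where "g2 = bump (-\<delta>) (-\<delta>)"
  define d1 where "d1 = bump_deriv \<gamma> c"
  define d2 where "d2 = bump_deriv (-\<delta>) (-\<delta>)"
  define f where "f = (\<lambda>s. N s * of_real x powr (- s))"
  \<comment> \<open>the integrand without its polar part, continued to the origin by the derivative of \<open>f\<close>\<close>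
  define A where "A = (\<lambda>s. if s = 0 then deriv f 0 else (f s - f 0) / (s - 0))"
  let ?P = "PL \<union> PR"
  have f0: "f 0 = N 0" using x by (simp add: f_def)
  have Pw: "w = of_real (Re w)" if "w \<in> ?P" for w using that real by (auto simp: complex_eq_iff complex_is_Real_iff)
  have sides: "left_of g1 w \<and> left_of g2 w" if "w \<in> PL" for w
    using left_of_bump[of "Re w" c \<gamma>] left_of_bump[of "Re w" "-\<delta>" "-\<delta>"] left[OF that] pos Pw[of w] that
    unfolding g1_def g2_def by simp
  have sides': "right_of g1 w \<and> right_of g2 w" if "w \<in> PR" for w
    using right_of_bump[of c "Re w" \<gamma>] right_of_bump[of "-\<delta>" "Re w" "-\<delta>"] right[OF that] pos Pw[of w] that
    unfolding g1_def g2_def by simp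
  have closed: "open (- ?P)" using finite_in_balls_imp_closed[OF fin] by (rule open_Compl)
  have holf: "f holomorphic_on - ?P" unfolding f_def using x by (intro holomorphic_intros hol) auto
  then have holA: "A holomorphic_on - ?P" unfolding A_def by (rule pole_lemma_open[OF _ closed])
  have A_eq: "A s = k s * of_real x powr (- s) - N 0 / s" if "s \<noteq> 0" for s
    using that by (simp add: A_def k[OF that] f0) (simp add: f_def diff_divide_distrib)
  have Re1: "Re (g1 t) > 0" and Re2: "Re (g2 t) = - \<delta>" for t
    using Re_bump[of \<gamma> c t] Re_bump[of "-\<delta>" "-\<delta>" t] pos
    by (auto simp: g1_def g2_def closed_segment_eq_real_ivl split: if_splits)
  then have nz: "g1 t \<noteq> 0" "g2 t \<noteq> 0" for t using pos by (auto simp: complex_eq_iff) (metis less_irrefl zero_complex.sel(1))+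
  have decay: "\<forall>\<^sub>F T in at_top. \<forall>\<sigma>\<in>closed_segment \<gamma> (-\<delta>).
      norm (A (Complex \<sigma> T)) \<le> \<epsilon> \<and> norm (A (Complex \<sigma> (-T))) \<le> \<epsilon>" if "\<epsilon> > 0" for \<epsilon>
  proof -
    have "\<epsilon> / 2 > 0" using that by simp
    have "e > 0 \<or> e = 0 \<and> u + v * \<gamma> < 0 \<and> u + v * (-\<delta>) < 0" using e by simp
    note ev = vertical_growth_decay[OF growth this x \<open>\<epsilon> / 2 > 0\<close>]
    have "((\<lambda>T. norm (N 0) / T) \<longlongrightarrow> 0) at_top" by real_asymp
    from order_tendstoD(2)[OF this \<open>\<epsilon> / 2 > 0\<close>] ev eventually_gt_at_top[of 0]
    show ?thesis
    proof eventually_elim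
      case (elim T)
      have main: "norm (A (Complex \<sigma> t)) \<le> \<epsilon>"
        if t: "\<bar>t\<bar> = T" and b: "norm (k (Complex \<sigma> t) * of_real x powr (- Complex \<sigma> t)) \<le> \<epsilon> / 2" for \<sigma> t
      proof -
        have nz: "Complex \<sigma> t \<noteq> 0" using t elim(3) by (auto simp: complex_eq_iff)
        have T: "T \<le> norm (Complex \<sigma> t)" using abs_Im_le_cmod[of "Complex \<sigma> t"] t by simp
        have "norm (N 0 / Complex \<sigma> t) \<le> norm (N 0) / T"
          unfolding norm_divide using T elim(3) by (intro divide_left_mono mult_pos_pos) auto
        then have "norm (N 0 / Complex \<sigma> t) \<le> \<epsilon> / 2" using elim(1) by linarith
        then show ?thesis unfolding A_eq[OF nz] using b
          norm_triangle_ineq4[of "k (Complex \<sigma> t) * of_real x powr (- Complex \<sigma> t)" "N 0 / Complex \<sigma> t"] by linarith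
      qed
      show ?case using elim(2,3) by (auto intro!: main)
    qed
  qed
  have shift: "((\<lambda>T. integral {-T..T} (\<lambda>t. A (g1 t) * vector_derivative g1 (at t))
             - integral {-T..T} (\<lambda>t. A (g2 t) * vector_derivative g2 (at t))) \<longlongrightarrow> 0) at_top"
    unfolding g1_def g2_def
    by (rule contour_shift[OF vertical_contour_bump vertical_contour_bump real fin _ _ holA decay])
       (use sides sides' in \<open>auto simp: g1_def g2_def\<close>)
  have "w \<notin> range g1 \<and> w \<notin> range g2" if "w \<in> ?P" for w
    using that sides[of w] sides'[of w] left_of_notin_range right_of_notin_range by blast
  moreover have "0 \<notin> range g1" "0 \<notin> range g2" using nz by (metis rangeE)+
  ultimately have range: "range g1 \<subseteq> - ?P - {0}" "range g2 \<subseteq> - ?P - {0}" by blast+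
  have hol_k: "k holomorphic_on - ?P - {0}"
  proof -
    have "(\<lambda>s. N s / s) holomorphic_on - ?P - {0}"
      by (intro holomorphic_intros holomorphic_on_subset[OF hol]) auto
    then show ?thesis by (rule holomorphic_transform) (simp add: k)
  qed
  let ?F1 = "\<lambda>t. k (g1 t) * of_real x powr (- g1 t) * d1 t"
  let ?F2 = "\<lambda>t. k (g2 t) * of_real x powr (- g2 t) * d2 t"
  have ints: "integrable lborel ?F1" "integrable lborel ?F2"
    unfolding g1_def g2_def d1_def d2_def
    by (rule bump_integrable[OF growth _ x hol_k], use e range in \<open>simp_all add: g1_def g2_def\<close>)+
  have split1: "integral {-T..T} (\<lambda>t. A (g1 t) * vector_derivative g1 (at t)) =
      integral {-T..T} ?F1 - N 0 * integral {-T..T} (\<lambda>t. d1 t / g1 t)" for T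
  proof -
    have i1: "?F1 integrable_on {-T..T}"
      using integrable_on_lborel[OF ints(1)] integrable_on_subinterval by blast
    have i2: "(\<lambda>t. d1 t / g1 t) integrable_on {-T..T}"
      unfolding g1_def d1_def using nz(1)
      by (intro integrable_continuous_real continuous_intros continuous_bump) (simp add: g1_def)
    have "A (g1 t) * vector_derivative g1 (at t) = ?F1 t - N 0 * (d1 t / g1 t)" for t
      using nz(1)[of t] by (simp add: A_eq g1_def d1_def bump_vector_derivative algebra_simps)
    then have "integral {-T..T} (\<lambda>t. A (g1 t) * vector_derivative g1 (at t)) =
        integral {-T..T} (\<lambda>t. ?F1 t - N 0 * (d1 t / g1 t))" by simp
    also have "\<dots> = integral {-T..T} ?F1 - integral {-T..T} (\<lambda>t. N 0 * (d1 t / g1 t))"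
      by (intro integral_diff integrable_on_mult_right i1 i2)
    finally show ?thesis by (simp only: Henstock_Kurzweil_Integration.integral_mult_right)
  qed
  have split2: "integral {-T..T} (\<lambda>t. A (g2 t) * vector_derivative g2 (at t)) =
      integral {-T..T} ?F2 - N 0 * integral {-T..T} (\<lambda>t. d2 t / g2 t)" for T
  proof -
    have i1: "?F2 integrable_on {-T..T}"
      using integrable_on_lborel[OF ints(2)] integrable_on_subinterval by blast
    have i2: "(\<lambda>t. d2 t / g2 t) integrable_on {-T..T}"
      unfolding g2_def d2_def using nz(2)
      by (intro integrable_continuous_real continuous_intros continuous_bump) (simp add: g2_def)
    have "A (g2 t) * vector_derivative g2 (at t) = ?F2 t - N 0 * (d2 t / g2 t)" for t
      using nz(2)[of t] by (simp add: A_eq g2_def d2_def bump_vector_derivative algebra_simps)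
    then have "integral {-T..T} (\<lambda>t. A (g2 t) * vector_derivative g2 (at t)) =
        integral {-T..T} (\<lambda>t. ?F2 t - N 0 * (d2 t / g2 t))" by simp
    also have "\<dots> = integral {-T..T} ?F2 - integral {-T..T} (\<lambda>t. N 0 * (d2 t / g2 t))"
      by (intro integral_diff integrable_on_mult_right i1 i2)
    finally show ?thesis by (simp only: Henstock_Kurzweil_Integration.integral_mult_right)
  qed
  have "((\<lambda>T. (integral {-T..T} ?F1 - N 0 * integral {-T..T} (\<lambda>t. d1 t / g1 t))
       - (integral {-T..T} ?F2 - N 0 * integral {-T..T} (\<lambda>t. d2 t / g2 t))) \<longlongrightarrow>
      ((LINT t|lborel. ?F1 t) - N 0 * (\<i> * of_real pi)) - ((LINT t|lborel. ?F2 t) - N 0 * (- (\<i> * of_real pi)))) at_top"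
    unfolding g1_def g2_def d1_def d2_def
    by (intro tendsto_diff tendsto_mult tendsto_const integral_truncated_tendsto
          ints[unfolded g1_def g2_def d1_def d2_def] bump_log_integral bump_log_integral_minus pos)
  from tendsto_unique[OF trivial_limit_at_top_linorder this shift[unfolded split1 split2]]
  have "(LINT t|lborel. ?F1 t) = (LINT t|lborel. ?F2 t) + 2 * of_real pi * \<i> * N 0"
    by (simp add: algebra_simps)
  then show "(LINT t|lborel. k (bump \<gamma> c t) * of_real x powr (- bump \<gamma> c t) * bump_deriv \<gamma> c t) =
      (LINT t|lborel. k (bump (-\<delta>) (-\<delta>) t) * of_real x powr (- bump (-\<delta>) (-\<delta>) t) * bump_deriv (-\<delta>) (-\<delta>) t)
      + 2 * of_real pi * \<i> * N 0"
    unfolding g1_def g2_def d1_def d2_def .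
qed

section \<open>Fox-H densities\<close>

lemma fox_kernel_1_pos:
  assumes "\<forall>i\<in>{1..n}. a i + \<alpha> i < 1" "\<forall>i\<in>{n+1..p}. a i + \<alpha> i > 0"
    and "\<forall>j\<in>{1..m}. b j + \<beta> j > 0" "\<forall>j\<in>{m+1..q}. b j + \<beta> j < 1"
  obtains r where "r > 0" "fox_kernel m n p q a \<alpha> b \<beta> 1 = of_real r"
proof -
  define r where "r = ((\<Prod>j=1..m. Gamma (b j + \<beta> j)) * (\<Prod>i=1..n. Gamma (1 - a i - \<alpha> i))) /
     ((\<Prod>i=n+1..p. Gamma (a i + \<alpha> i)) * (\<Prod>j=m+1..q. Gamma (1 - b j - \<beta> j)))"
  have "r > 0" unfolding r_def using assms
    by (intro divide_pos_pos mult_pos_pos prod_pos ballI Gamma_real_pos) (auto simp: algebra_simps)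
  moreover have "fox_kernel m n p q a \<alpha> b \<beta> 1 = of_real r"
    by (simp add: fox_kernel_def r_def Gamma_complex_of_real[symmetric])
  ultimately show ?thesis by (rule that)
qed

lemma upper_bound_below:
  fixes f :: "nat \<Rightarrow> real"
  assumes "\<forall>j\<in>{1..m}. f j < 1"
  obtains c where "0 < c" "c < 1" "\<forall>j\<in>{1..m}. f j < c"
proof -
  define M where "M = Max (insert 0 (f ` {1..m}))"
  have M: "M < 1" unfolding M_def using assms by (subst Max_less_iff) auto
  have ge: "x \<le> M" if "x \<in> insert 0 (f ` {1..m})" for x
    unfolding M_def using that by (intro Max_ge) auto
  have "0 \<le> M" by (rule ge) simp
  moreover have "f j < (1 + M) / 2" if "j \<in> {1..m}" for j
    using ge[of "f j"] that M by simp
  ultimately show ?thesis using M by (intro that[of "(1 + M) / 2"] ballI) simp_all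
qed

lemma lower_bound_above:
  fixes f :: "nat \<Rightarrow> real"
  assumes "\<forall>j\<in>{1..m}. 0 < f j"
  obtains d where "0 < d" "d < 1" "\<forall>j\<in>{1..m}. d < f j"
proof -
  obtain c where "0 < c" "c < 1" "\<forall>j\<in>{1..m}. 1 - f j < c" using upper_bound_below[of m "\<lambda>j. 1 - f j"] assms by auto
  then show ?thesis by (intro that[of "1 - c"]) (auto simp: algebra_simps)
qed

text \<open>
  The parameters \<open>(d, 1), (1 - a i - \<alpha> i, \<alpha> i)\<close> that enter the Fox-H function of the Laplace
  transform, with the index shifted by one to make room for the first pair.
\<close>
abbreviation (input) laplace_offset :: "real \<Rightarrow> (nat \<Rightarrow> real) \<Rightarrow> (nat \<Rightarrow> real) \<Rightarrow> nat \<Rightarrow> real" where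
  "laplace_offset d a \<alpha> \<equiv> (\<lambda>i. if i = 1 then d else 1 - a (i - 1) - \<alpha> (i - 1))"

abbreviation (input) laplace_scale :: "(nat \<Rightarrow> real) \<Rightarrow> nat \<Rightarrow> real" where
  "laplace_scale \<alpha> \<equiv> (\<lambda>i. if i = 1 then 1 else \<alpha> (i - 1))"

abbreviation (input) laplace_fox_H ::
  "nat \<Rightarrow> nat \<Rightarrow> nat \<Rightarrow> nat \<Rightarrow> (nat \<Rightarrow> real) \<Rightarrow> (nat \<Rightarrow> real) \<Rightarrow> (nat \<Rightarrow> real) \<Rightarrow> (nat \<Rightarrow> real) \<Rightarrow> complex \<Rightarrow> complex" where
  "laplace_fox_H m n p q a \<alpha> b \<beta> \<equiv>
     fox_H (n + 1) m q (p + 1) (\<lambda>j. 1 - b j - \<beta> j) \<beta> (laplace_offset 0 a \<alpha>) (laplace_scale \<alpha>)"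

locale fox_parameters =
  fixes m n p q :: nat and a \<alpha> b \<beta> :: "nat \<Rightarrow> real"
  assumes np: "n \<le> p" and mq: "m \<le> q"
    and \<alpha>: "\<forall>i\<in>{1..p}. \<alpha> i > 0" and a_n: "\<forall>i\<in>{1..n}. a i + \<alpha> i < 1"
    and \<beta>: "\<forall>j\<in>{1..q}. \<beta> j > 0" and b_m: "\<forall>j\<in>{1..m}. b j + \<beta> j > 0"
    and star: "fox_a_star m n p q \<alpha> \<beta> > 0 \<or> fox_a_star m n p q \<alpha> \<beta> = 0 \<and> fox_mu p q a b < -1"
begin

lemma laplace_scale_pos: "\<forall>i\<in>{1..p+1}. laplace_scale \<alpha> i > 0"
proof
  fix i assume "i \<in> {1..p+1}"
  then have "i - 1 \<in> {1..p}" if "i \<noteq> 1" using that by auto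
  then have "\<alpha> (i - 1) > 0" if "i \<noteq> 1" using that \<alpha> by blast
  then show "laplace_scale \<alpha> i > 0" by simp
qed

lemma laplace_star: "fox_a_star (n + 1) m q (p + 1) \<beta> (laplace_scale \<alpha>) > 0"
  unfolding fox_a_star_of_laplace_parameters using star by linarith

text \<open>
  All left poles are at most \<open>max\<^sub>j (- b j / \<beta> j) < 1\<close> and all right poles exceed \<open>1\<close>, so any \<open>c\<close>
  between this maximum and \<open>1\<close> separates them; under \<open>s \<mapsto> 1 - s\<close> the point \<open>1 - c\<close> then
  separates the poles of the kernel of the Laplace transform. Taking \<open>c\<close> between \<open>0\<close> and \<open>1\<close> keeps the
  contour in the strip where \<open>laplace_contour_integral\<close> applies.
\<close>
lemma separating_contours:
  obtains c where "0 < c" "c < 1" "fox_contour m n a \<alpha> b \<beta> (bump 0 c)"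
    "fox_contour (n + 1) m (\<lambda>j. 1 - b j - \<beta> j) \<beta> (laplace_offset 0 a \<alpha>) (laplace_scale \<alpha>) (bump 1 (1 - c))"
    "\<forall>j\<in>{1..m}. - b j / \<beta> j < c"
proof -
  have "- b j / \<beta> j < 1" if "j \<in> {1..m}" for j
  proof -
    have "\<beta> j > 0" "b j + \<beta> j > 0" using that \<beta> b_m mq by auto
    then show ?thesis by (subst pos_divide_less_eq) simp_all
  qed
  then obtain c where c: "0 < c" "c < 1" "\<forall>j\<in>{1..m}. - b j / \<beta> j < c"
    using upper_bound_below[of m "\<lambda>j. - b j / \<beta> j"] by blast
  have i: "\<alpha> i > 0" "1 < (1 - a i) / \<alpha> i" if "i \<in> {1..n}" for i
  proof -
    show "\<alpha> i > 0" using that \<alpha> np by auto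
    moreover have "a i + \<alpha> i < 1" using a_n that by blast
    ultimately show "1 < (1 - a i) / \<alpha> i" by (subst pos_less_divide_eq) simp_all
  qed
  have j: "\<beta> j > 0" if "j \<in> {1..m}" for j using that \<beta> mq by auto
  have con: "fox_contour m n a \<alpha> b \<beta> (bump 0 c)"
  proof (rule fox_contour_bump)
    show "\<forall>j\<in>{1..m}. \<beta> j > 0 \<and> - b j / \<beta> j < c" using c j by blast
    show "\<forall>i\<in>{1..n}. \<alpha> i > 0 \<and> c < (1 - a i) / \<alpha> i" using c(2) i less_trans by blast
  qed
  have con': "fox_contour (n + 1) m (\<lambda>j. 1 - b j - \<beta> j) \<beta> (laplace_offset 0 a \<alpha>) (laplace_scale \<alpha>) (bump 1 (1 - c))"
  proof (rule fox_contour_bump; intro ballI)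
    fix k assume "k \<in> {1..n+1}"
    show "laplace_scale \<alpha> k > 0 \<and> - laplace_offset 0 a \<alpha> k / laplace_scale \<alpha> k < 1 - c"
    proof (cases "k = 1")
      case False
      then have k: "k - 1 \<in> {1..n}" using \<open>k \<in> {1..n+1}\<close> by auto
      have eq: "- (1 - a (k-1) - \<alpha> (k-1)) / \<alpha> (k-1) = 1 - (1 - a (k-1)) / \<alpha> (k-1)"
        using i(1)[OF k] by (simp add: field_simps)
      have "c < (1 - a (k-1)) / \<alpha> (k-1)" using i(2)[OF k] c by linarith
      then show ?thesis unfolding if_not_P[OF False] eq using i(1)[OF k] by linarith
    qed (use c in auto)
  next
    fix k assume k: "k \<in> {1..m}"
    have "(1 - (1 - b k - \<beta> k)) / \<beta> k = 1 - (- b k / \<beta> k)" using j[OF k] by (simp add: field_simps)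
    moreover have "- b k / \<beta> k < c" using c(3) k by blast
    ultimately show "\<beta> k > 0 \<and> 1 - c < (1 - (1 - b k - \<beta> k)) / \<beta> k" using j[OF k] by linarith
  qed
  show ?thesis by (rule that[OF c(1,2) con con' c(3)])
qed

text \<open>
  Fubini's theorem on the contour \<open>bump 0 c\<close> produces the factor \<open>Gamma (1 - s) * y powr (s - 1)\<close>; the
  reflection \<open>t \<mapsto> - t\<close> of the parameter then realizes the substitution of \<open>1 - s\<close> for \<open>s\<close> as a passage to
  the contour \<open>bump 1 (1 - c)\<close>.
\<close>
lemma laplace_transform:
  assumes y: "y > 0"
  shows "integrable lborel (\<lambda>x. indicator {0<..} x *\<^sub>R (of_real (exp (- y * x)) * fox_H m n p q a \<alpha> b \<beta> (of_real x)))"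
    and "(LINT x|lborel. indicator {0<..} x *\<^sub>R (of_real (exp (- y * x)) * fox_H m n p q a \<alpha> b \<beta> (of_real x)))
      = laplace_fox_H m n p q a \<alpha> b \<beta> (of_real y)"
proof -
  obtain c where c: "0 < c" "c < 1" and con: "fox_contour m n a \<alpha> b \<beta> (bump 0 c)"
    and con': "fox_contour (n + 1) m (\<lambda>j. 1 - b j - \<beta> j) \<beta> (laplace_offset 0 a \<alpha>) (laplace_scale \<alpha>) (bump 1 (1 - c))"
    by (rule separating_contours)
  define k where "k = fox_kernel m n p q a \<alpha> b \<beta>"
  define F where "F = (\<lambda>t. 1 / (2 * of_real pi * \<i>) * (k (bump 0 c t) * bump_deriv 0 c t))"
  have star0: "fox_a_star m n p q \<alpha> \<beta> > 0 \<or> fox_a_star m n p q \<alpha> \<beta> = 0 \<and>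
      fox_mu p q a b + ((\<Sum>j=1..q. \<beta> j) - (\<Sum>i=1..p. \<alpha> i)) * 0 < -1" using star by simp
  note old = fox_H_bump[OF np mq \<alpha> \<beta> star0 con, folded k_def]
  have pos: "\<forall>j\<in>{1..m}. \<beta> j > 0" "\<forall>i\<in>{1..n}. \<alpha> i > 0" using \<alpha> \<beta> np mq by auto
  have contF: "continuous_on UNIV F"
  proof -
    have "continuous_on UNIV (\<lambda>t. k (bump 0 c t))"
      unfolding k_def
      by (rule continuous_on_compose2[OF holomorphic_on_imp_continuous_on[OF fox_kernel_holomorphic[OF pos]] continuous_bump(1)])
         (use fox_contour_range[OF con] in auto)
    then show ?thesis unfolding F_def by (intro continuous_intros continuous_bump)
  qed
  have "integrable lborel (\<lambda>t. k (bump 0 c t) * bump_deriv 0 c t)" using old(1)[of 1] by simp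
  then have intF: "integrable lborel F" unfolding F_def by (rule integrable_mult_right)
  have strip: "0 \<le> Re (bump 0 c t)" "Re (bump 0 c t) \<le> c" for t
    using Re_bump[of 0 c t] c by (auto simp: closed_segment_eq_real_ivl)
  have H: "fox_H m n p q a \<alpha> b \<beta> (of_real x) = (LINT t|lborel. F t * of_real x powr (- bump 0 c t))" if "x > 0" for x
    unfolding old(2)[OF that] F_def by (simp add: mult_ac)
  have ind: "indicator {0<..} x *\<^sub>R (of_real (exp (- y * x)) * fox_H m n p q a \<alpha> b \<beta> (of_real x)) =
     indicator {0<..} x *\<^sub>R (of_real (exp (- y * x)) * (LINT t|lborel. F t * of_real x powr (- bump 0 c t)))" for x
    using H[of x] by (auto simp: indicator_def)
  note L = laplace_contour_integral[OF contF intF continuous_bump(1) strip c(2) y]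
  show "integrable lborel (\<lambda>x. indicator {0<..} x *\<^sub>R (of_real (exp (- y * x)) * fox_H m n p q a \<alpha> b \<beta> (of_real x)))"
    unfolding ind by (rule L(1))
  define G where "G = (\<lambda>t. F t * (Gamma (1 - bump 0 c t) * of_real y powr (bump 0 c t - 1)))"
  have "(LINT x|lborel. indicator {0<..} x *\<^sub>R (of_real (exp (- y * x)) * fox_H m n p q a \<alpha> b \<beta> (of_real x)))
      = (LINT t|lborel. G t)"
    unfolding ind L(2) G_def ..
  also have "\<dots> = (LINT t|lborel. G (- t))"
    using lborel_integral_real_affine[of "-1" G 0] by simp
  also have "(\<lambda>t. G (- t)) = (\<lambda>t. 1 / (2 * of_real pi * \<i>) * (fox_kernel (n + 1) m q (p + 1) (\<lambda>j. 1 - b j - \<beta> j) \<beta>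
      (laplace_offset 0 a \<alpha>) (laplace_scale \<alpha>) (bump 1 (1 - c) t) * of_real y powr (- bump 1 (1 - c) t) * bump_deriv 1 (1 - c) t))"
  proof
    fix t
    have "bump 1 (1 - c) t = 1 - bump 0 c (- t)" "bump_deriv 1 (1 - c) t = bump_deriv 0 c (- t)"
      by (simp_all add: bump_def bump_deriv_def complex_eq_iff algebra_simps)
    then show "G (- t) = 1 / (2 * of_real pi * \<i>) * (fox_kernel (n + 1) m q (p + 1) (\<lambda>j. 1 - b j - \<beta> j) \<beta>
      (laplace_offset 0 a \<alpha>) (laplace_scale \<alpha>) (bump 1 (1 - c) t) * of_real y powr (- bump 1 (1 - c) t) * bump_deriv 1 (1 - c) t)"
      unfolding fox_kernel_of_laplace_parameters by (simp add: G_def F_def k_def mult_ac)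
  qed
  also have "(LINT t|lborel. 1 / (2 * of_real pi * \<i>) * (fox_kernel (n + 1) m q (p + 1) (\<lambda>j. 1 - b j - \<beta> j) \<beta>
      (laplace_offset 0 a \<alpha>) (laplace_scale \<alpha>) (bump 1 (1 - c) t) * of_real y powr (- bump 1 (1 - c) t) * bump_deriv 1 (1 - c) t))
     = laplace_fox_H m n p q a \<alpha> b \<beta> (of_real y)"
    unfolding integral_mult_right_zero
    by (rule fox_H_bump(2)[symmetric]) (use np mq \<beta> laplace_scale_pos laplace_star con' y in auto)
  finally show "(LINT x|lborel. indicator {0<..} x *\<^sub>R (of_real (exp (- y * x)) * fox_H m n p q a \<alpha> b \<beta> (of_real x)))
      = laplace_fox_H m n p q a \<alpha> b \<beta> (of_real y)" .
qed

text \<open>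
  The contour through \<open>1 - c\<close> is moved to the line \<open>Re s = - \<delta>\<close>, which lies to the right of all left
  poles except \<open>0\<close>. The residue at \<open>0\<close> is the limit, and the remaining integral is of
  order \<open>y powr \<delta>\<close>.
\<close>
lemma laplace_fox_H_at_0:
  "((\<lambda>y. laplace_fox_H m n p q a \<alpha> b \<beta> (of_real y)) \<longlongrightarrow> fox_kernel m n p q a \<alpha> b \<beta> 1) (at_right 0)"
proof -
  obtain c where c: "0 < c" "c < 1"
    and con': "fox_contour (n + 1) m (\<lambda>j. 1 - b j - \<beta> j) \<beta> (laplace_offset 0 a \<alpha>) (laplace_scale \<alpha>) (bump 1 (1 - c))"
    and bc: "\<forall>j\<in>{1..m}. - b j / \<beta> j < c"
    by (rule separating_contours)
  have "0 < (1 - a i - \<alpha> i) / \<alpha> i" if "i \<in> {1..n}" for i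
  proof -
    have "\<alpha> i > 0" "a i + \<alpha> i < 1" using that \<alpha> a_n np by auto
    then show ?thesis by (intro divide_pos_pos) auto
  qed
  \<comment> \<open>\<open>\<delta>\<close> is less than the distance from \<open>0\<close> to any other left pole of the new kernel\<close>
  then obtain \<delta> where \<delta>: "0 < \<delta>" "\<delta> < 1" "\<forall>i\<in>{1..n}. \<delta> < (1 - a i - \<alpha> i) / \<alpha> i"
    using lower_bound_above[of n "\<lambda>i. (1 - a i - \<alpha> i) / \<alpha> i"] by blast
  define k where "k = fox_kernel (n + 1) m q (p + 1) (\<lambda>j. 1 - b j - \<beta> j) \<beta> (laplace_offset 0 a \<alpha>) (laplace_scale \<alpha>)"
  \<comment> \<open>\<open>N s = Gamma (1 + s) * k (1 - s)\<close> with the original kernel \<open>k\<close>; the first pole of \<open>Gamma (1 + s)\<close> is at \<open>-1\<close>\<close>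
  define N where "N = fox_kernel (n + 1) m q (p + 1) (\<lambda>j. 1 - b j - \<beta> j) \<beta> (laplace_offset 1 a \<alpha>) (laplace_scale \<alpha>)"
  define PL where "PL = fox_left_poles (n + 1) (laplace_offset 1 a \<alpha>) (laplace_scale \<alpha>)"
  define PR where "PR = fox_right_poles m (\<lambda>j. 1 - b j - \<beta> j) \<beta>"
  have pos: "\<forall>i\<in>{1..n+1}. laplace_scale \<alpha> i > 0" "\<forall>j\<in>{1..m}. \<beta> j > 0"
    using laplace_scale_pos \<beta> np mq by auto
  have real: "PL \<union> PR \<subseteq> \<real>" unfolding PL_def PR_def by (rule fox_poles_real)
  have fin: "finite ((PL \<union> PR) \<inter> cball 0 r)" for r unfolding PL_def PR_def by (rule finite_fox_poles[OF pos])
  have left: "Re w < - \<delta>" if w_PL: "w \<in> PL" for w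
  proof -
    obtain i l where i: "i \<in> {1..n+1}" and w: "w = fox_b_pole (laplace_offset 1 a \<alpha>) (laplace_scale \<alpha>) i l"
      using w_PL unfolding PL_def fox_left_poles_def by blast
    show ?thesis
    proof (cases "i = 1")
      case True
      then show ?thesis using \<delta> unfolding w fox_b_pole_def by simp
    next
      case False
      then have i': "i - 1 \<in> {1..n}" using i by auto
      have "\<alpha> (i - 1) > 0" using i' \<alpha> np by auto
      then have "(1 - a (i-1) - \<alpha> (i-1)) / \<alpha> (i-1) \<le> (1 - a (i-1) - \<alpha> (i-1) + real l) / \<alpha> (i-1)"
        by (intro divide_right_mono) auto
      then have "\<delta> < (1 - a (i-1) - \<alpha> (i-1) + real l) / \<alpha> (i-1)" using \<delta>(3) i' by (meson less_le_trans)
      then show ?thesis using False unfolding w fox_b_pole_def Re_complex_of_real minus_divide_left[symmetric] by simp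
    qed
  qed
  have right: "1 - c < Re w" if w_PR: "w \<in> PR" for w
  proof -
    obtain j l where j: "j \<in> {1..m}" and w: "w = fox_a_pole (\<lambda>j. 1 - b j - \<beta> j) \<beta> j l"
      using w_PR unfolding PR_def fox_right_poles_def by blast
    have "\<beta> j > 0" using pos j by blast
    then have "1 - (- b j / \<beta> j) + real l / \<beta> j = (1 - (1 - b j - \<beta> j) + real l) / \<beta> j" by (simp add: field_simps)
    moreover have "real l / \<beta> j \<ge> 0" using \<open>\<beta> j > 0\<close> by simp
    moreover have "- b j / \<beta> j < c" using bc j by blast
    ultimately show ?thesis unfolding w fox_a_pole_def Re_complex_of_real by linarith
  qed
  have hol: "N holomorphic_on - (PL \<union> PR)"
    unfolding N_def PL_def PR_def by (rule fox_kernel_holomorphic[OF pos])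
  have k_N: "k s = N s / s" if "s \<noteq> 0" for s
  proof -
    have "Gamma (1 + s) = s * Gamma s"
    proof (cases "s \<in> \<int>\<^sub>\<le>\<^sub>0")
      case True
      then obtain l where l: "s = - of_nat l" by (elim nonpos_Ints_cases')
      then have "1 + s = - of_nat (l - 1)" using that by (cases l) auto
      then have "1 + s \<in> \<int>\<^sub>\<le>\<^sub>0" by simp
      then have "Gamma (1 + s) = 0" "Gamma s = 0" using True by (simp_all only: Gamma_eq_zero_iff)
      then show ?thesis by simp
    next
      case False
      show ?thesis using Gamma_plus1[OF False] by (simp only: add.commute)
    qed
    then show ?thesis using that unfolding k_def N_def fox_kernel_of_laplace_parameters by simp
  qed
  have N0: "N 0 = fox_kernel m n p q a \<alpha> b \<beta> 1" unfolding N_def fox_kernel_of_laplace_parameters by simp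
  have growth: "vertical_growth k (fox_a_star (n + 1) m q (p + 1) \<beta> (laplace_scale \<alpha>))
      (fox_mu q (p + 1) (\<lambda>j. 1 - b j - \<beta> j) (laplace_offset 0 a \<alpha>))
      ((\<Sum>j=1..p+1. laplace_scale \<alpha> j) - (\<Sum>i=1..q. \<beta> i))"
    unfolding k_def by (rule fox_kernel_growth) (use np mq \<beta> laplace_scale_pos in auto)
  define g where "g = bump (-\<delta>) (-\<delta>)"
  define g' where "g' = bump_deriv (-\<delta>) (-\<delta>)"
  have c1: "1 - c > 0" using c by simp
  note residue = Mellin_Barnes_residue_at_0[OF real fin left right \<delta>(1) c1 zero_less_one hol k_N growth laplace_star,
      folded g_def g'_def]
  have shifted: "laplace_fox_H m n p q a \<alpha> b \<beta> (of_real y) = fox_kernel m n p q a \<alpha> b \<beta> 1 +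
      1 / (2 * of_real pi * \<i>) * (LINT t|lborel. k (g t) * of_real y powr (- g t) * g' t)" if y: "y > 0" for y
  proof -
    have "laplace_fox_H m n p q a \<alpha> b \<beta> (of_real y) = 1 / (2 * of_real pi * \<i>) *
      (LINT t|lborel. k (bump 1 (1 - c) t) * of_real y powr (- bump 1 (1 - c) t) * bump_deriv 1 (1 - c) t)"
      unfolding k_def by (rule fox_H_bump(2)) (use np mq \<beta> laplace_scale_pos laplace_star con' y in auto)
    also have "(LINT t|lborel. k (bump 1 (1 - c) t) * of_real y powr (- bump 1 (1 - c) t) * bump_deriv 1 (1 - c) t) =
      (LINT t|lborel. k (g t) * of_real y powr (- g t) * g' t) + 2 * of_real pi * \<i> * N 0"
      by (rule residue[OF _ _ _ y])
    finally show ?thesis unfolding N0 by (simp add: field_simps)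
  qed
  define B where "B = (LINT t|lborel. norm (k (g t) * g' t))"
  have Re_g: "Re (g t) = - \<delta>" for t using Re_bump[of "-\<delta>" "-\<delta>" t] by (simp add: g_def)
  have bound: "norm (LINT t|lborel. k (g t) * of_real y powr (- g t) * g' t) \<le> y powr \<delta> * B" if y: "y > 0" for y
  proof -
    have "norm (LINT t|lborel. k (g t) * of_real y powr (- g t) * g' t)
        \<le> (LINT t|lborel. norm (k (g t) * of_real y powr (- g t) * g' t))" by (rule integral_norm_bound)
    also have "(\<lambda>t. norm (k (g t) * of_real y powr (- g t) * g' t)) = (\<lambda>t. y powr \<delta> * norm (k (g t) * g' t))"
      using y by (simp add: norm_mult norm_powr_real_powr Re_g mult_ac)
    finally show ?thesis unfolding B_def by simp
  qed
  have "((\<lambda>y. y powr \<delta> * B) \<longlongrightarrow> 0 * B) (at_right 0)"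
    using \<delta>(1) by (intro tendsto_mult tendsto_const) real_asymp
  then have "((\<lambda>y. y powr \<delta> * B) \<longlongrightarrow> 0) (at_right 0)" by simp
  then have "((\<lambda>y. LINT t|lborel. k (g t) * of_real y powr (- g t) * g' t) \<longlongrightarrow> 0) (at_right 0)"
    by (rule Lim_null_comparison[rotated]) (use bound in \<open>auto simp: eventually_at_right_less intro!: eventually_mono[OF eventually_at_right_less[of 0]]\<close>)
  then have "((\<lambda>y. fox_kernel m n p q a \<alpha> b \<beta> 1 + 1 / (2 * of_real pi * \<i>) *
       (LINT t|lborel. k (g t) * of_real y powr (- g t) * g' t)) \<longlongrightarrow>
      fox_kernel m n p q a \<alpha> b \<beta> 1 + 1 / (2 * of_real pi * \<i>) * 0) (at_right 0)"
    by (intro tendsto_intros)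
  moreover have "\<forall>\<^sub>F y in at_right 0. fox_kernel m n p q a \<alpha> b \<beta> 1 + 1 / (2 * of_real pi * \<i>) *
       (LINT t|lborel. k (g t) * of_real y powr (- g t) * g' t) = laplace_fox_H m n p q a \<alpha> b \<beta> (of_real y)"
    by (rule eventually_mono[OF eventually_at_right_less[of 0]]) (rule shifted[symmetric])
  ultimately show ?thesis by (auto elim: Lim_transform_eventually)
qed

end

text \<open>
  For non-negative \<open>\<rho>\<close> the functions \<open>exp (- y * x) * \<rho> x\<close> increase to \<open>\<rho> x\<close> as \<open>y\<close> decreases to \<open>0\<close>;
  monotone convergence then gives integrability of \<open>\<rho>\<close> together with the value of the integral.
\<close>
lemma mass_from_laplace_transform:
  fixes \<rho> :: "real \<Rightarrow> real"
  assumes nonneg: "\<And>x. x > 0 \<Longrightarrow> \<rho> x \<ge> 0"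
    and int: "\<And>y. y > 0 \<Longrightarrow> integrable lborel (\<lambda>x. indicator {0<..} x * (exp (- y * x) * \<rho> x))"
    and lim: "((\<lambda>y. LINT x|lborel. indicator {0<..} x * (exp (- y * x) * \<rho> x)) \<longlongrightarrow> l) (at_right 0)"
  shows "integrable lborel (\<lambda>x. indicator {0<..} x * \<rho> x)" and "(LINT x|lborel. indicator {0<..} x * \<rho> x) = l"
proof -
  define y where "y = (\<lambda>n. inverse (real (Suc n)))"
  define f where "f = (\<lambda>n x. indicator {0<..} x * (exp (- y n * x) * \<rho> x))"
  have y: "y n > 0" for n by (simp add: y_def)
  have y0: "y \<longlonglongrightarrow> 0" unfolding y_def by (rule LIMSEQ_inverse_real_of_nat)
  then have "filterlim y (at_right 0) sequentially"
    unfolding filterlim_at using y less_imp_neq[OF y] by (auto intro!: always_eventually)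
  from filterlim_compose[OF lim this] have ilim: "(\<lambda>n. integral\<^sup>L lborel (f n)) \<longlonglongrightarrow> l"
    by (simp add: f_def)
  have fint: "integrable lborel (f n)" for n unfolding f_def by (rule int[OF y])
  have flim: "(\<lambda>n. f n x) \<longlonglongrightarrow> indicator {0<..} x * \<rho> x" for x
  proof -
    have "(\<lambda>n. f n x) \<longlonglongrightarrow> indicator {0<..} x * (exp (- 0 * x) * \<rho> x)"
      unfolding f_def by (intro tendsto_intros y0)
    then show ?thesis by simp
  qed
  have mono: "mono (\<lambda>n. f n x)" for x
  proof (rule monoI)
    fix i j :: nat assume "i \<le> j"
    then have "y j \<le> y i" unfolding y_def by (intro le_imp_inverse_le) auto
    then show "f i x \<le> f j x"
      using nonneg[of x] by (auto simp: f_def indicator_def intro!: mult_right_mono)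
  qed
  have pos: "0 \<le> f n x" for n x using nonneg[of x] by (auto simp: f_def indicator_def)
  have meas: "(\<lambda>x. indicator {0<..} x * \<rho> x) \<in> borel_measurable lborel"
    by (rule borel_measurable_LIMSEQ_real[OF flim borel_measurable_integrable[OF fint]])
  note mc = integral_monotone_convergence_nonneg[of lborel f "\<lambda>x. indicator {0<..} x * \<rho> x" l,
      OF fint AE_I2[OF mono] AE_I2[OF pos] AE_I2[OF flim] ilim meas]
  show "integrable lborel (\<lambda>x. indicator {0<..} x * \<rho> x)" by (rule mc(1))
  show "(LINT x|lborel. indicator {0<..} x * \<rho> x) = l" by (rule mc(2))
qed

theorem lemma3:
  fixes m n p q :: nat
    and a \<alpha> b \<beta> :: "nat \<Rightarrow> real"
    and K :: complex and \<rho> \<phi> :: "real \<Rightarrow> real" and L :: "real \<Rightarrow> complex"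
  assumes "n \<le> p" and "m \<le> q"
    and "\<forall>i\<in>{1..p}. \<alpha> i > 0"
    and "\<forall>i\<in>{1..n}. a i + \<alpha> i < 1"
    and "\<forall>i\<in>{n+1..p}. a i + \<alpha> i > 0"
    and "\<forall>i\<in>{1..n}. \<forall>k.
           simple_pole (\<lambda>s. \<Prod>i'=1..n. Gamma (1 - of_real (a i') - s * of_real (\<alpha> i')))
             (fox_a_pole a \<alpha> i k)"
    and "\<forall>j\<in>{1..q}. \<beta> j > 0"
    and "\<forall>j\<in>{1..m}. b j + \<beta> j > 0"
    and "\<forall>j\<in>{m+1..q}. b j + \<beta> j < 1"
    and "fox_a_star m n p q \<alpha> \<beta> > 0 \<or> (fox_a_star m n p q \<alpha> \<beta> = 0 \<and> fox_mu p q a b < -1)"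
    and "\<forall>x>0. fox_H m n p q a \<alpha> b \<beta> (complex_of_real x) \<in> \<real>\<^sub>\<ge>\<^sub>0"
  defines "K \<equiv> fox_kernel m n p q a \<alpha> b \<beta> 1"
    and "\<rho> \<equiv> (\<lambda>x. Re (1 / K * fox_H m n p q a \<alpha> b \<beta> (complex_of_real x)))"
    and "\<phi> \<equiv> (\<lambda>s. LINT x:{0<..}|lborel. exp (- s * x) * \<rho> x)"
    and "L \<equiv> (\<lambda>s. 1 / K * fox_H (n + 1) m q (p + 1)
           (\<lambda>j. 1 - b j - \<beta> j) \<beta>
           (\<lambda>i. if i = 1 then 0 else 1 - a (i - 1) - \<alpha> (i - 1))
           (\<lambda>i. if i = 1 then 1 else \<alpha> (i - 1))
           (complex_of_real s))"
  shows "(\<forall>x>0. complex_of_real (\<rho> x) = 1 / K * fox_H m n p q a \<alpha> b \<beta> (complex_of_real x)) \<and>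
         (\<forall>x>0. \<rho> x \<ge> 0) \<and>
         set_integrable lborel {0<..} \<rho> \<and> (LINT x:{0<..}|lborel. \<rho> x) = 1 \<and>
         (\<forall>s>0. complex_of_real (\<phi> s) = L s) \<and>
         (L \<longlongrightarrow> complex_of_real (\<phi> 0)) (at_right 0)"
proof -
  interpret fox_parameters m n p q a \<alpha> b \<beta>
    using assms(1-10) by unfold_locales auto
  let ?H = "\<lambda>x. fox_H m n p q a \<alpha> b \<beta> (complex_of_real x)"
  let ?M = "\<lambda>y. laplace_fox_H m n p q a \<alpha> b \<beta> (complex_of_real y)"
  obtain r where r: "r > 0" "K = of_real r"
    using fox_kernel_1_pos[OF assms(4,5,8,9)] unfolding K_def by metis
  have H: "?H x = of_real (r * \<rho> x)" and \<rho>_nonneg: "\<rho> x \<ge> 0" if "x > 0" for x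
  proof -
    have "?H x \<in> \<real>\<^sub>\<ge>\<^sub>0" using assms(11) that by blast
    then obtain h where h: "?H x = of_real h" "h \<ge> 0" by (auto elim: nonneg_Reals_cases)
    then have "\<rho> x = h / r" unfolding \<rho>_def r(2) by (simp add: Re_divide_of_real)
    then show "?H x = of_real (r * \<rho> x)" "\<rho> x \<ge> 0" using h r by auto
  qed
  have kernel: "indicator {0<..} x *\<^sub>R (of_real (exp (- y * x)) * ?H x) =
      of_real (r * (indicator {0<..} x * (exp (- y * x) * \<rho> x)))" for x y
    using H[of x] by (auto simp: indicator_def)
  have int: "integrable lborel (\<lambda>x. indicator {0<..} x * (exp (- y * x) * \<rho> x))"
    and val: "of_real (r * (LINT x|lborel. indicator {0<..} x * (exp (- y * x) * \<rho> x))) = ?M y" if "y > 0" for y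
  proof -
    have "integrable lborel (\<lambda>x. Re (of_real (r * (indicator {0<..} x * (exp (- y * x) * \<rho> x)))))"
      using integrable_Re[OF laplace_transform(1)[OF that, unfolded kernel]] .
    then show "integrable lborel (\<lambda>x. indicator {0<..} x * (exp (- y * x) * \<rho> x))"
      using r by simp
    show "of_real (r * (LINT x|lborel. indicator {0<..} x * (exp (- y * x) * \<rho> x))) = ?M y"
      using laplace_transform(2)[OF that, unfolded kernel] unfolding integral_complex_of_real by simp
  qed
  have L: "of_real (LINT x|lborel. indicator {0<..} x * (exp (- y * x) * \<rho> x)) = L y" if "y > 0" for y
    unfolding L_def val[OF that, symmetric] r(2) using r(1) by simp
  have "(L \<longlongrightarrow> 1 / K * K) (at_right 0)"
    unfolding L_def using laplace_fox_H_at_0 unfolding K_def by (intro tendsto_intros)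
  then have L1: "(L \<longlongrightarrow> 1) (at_right 0)" using r by simp
  have "\<forall>\<^sub>F y in at_right 0. L y = of_real (LINT x|lborel. indicator {0<..} x * (exp (- y * x) * \<rho> x))"
    by (rule eventually_mono[OF eventually_at_right_less[of 0]]) (rule L[symmetric])
  from Lim_transform_eventually[OF L1 this]
  have "((\<lambda>y. LINT x|lborel. indicator {0<..} x * (exp (- y * x) * \<rho> x)) \<longlongrightarrow> 1) (at_right 0)"
    unfolding of_real_1[symmetric, where 'a = complex] tendsto_of_real_iff .
  note mass = mass_from_laplace_transform[OF \<rho>_nonneg int this]
  have "\<phi> 0 = 1" unfolding \<phi>_def set_lebesgue_integral_def using mass(2) by simp
  moreover have "of_real (\<phi> s) = L s" if "s > 0" for s
    using L[OF that] unfolding \<phi>_def set_lebesgue_integral_def by simp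
  moreover have "of_real (\<rho> x) = 1 / K * ?H x" if "x > 0" for x
    unfolding H[OF that] r(2) using r(1) by simp
  ultimately show ?thesis
    using \<rho>_nonneg mass L1 unfolding set_integrable_def set_lebesgue_integral_def by simp
qed

end
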